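(* Let $H$ be a fixed graph (so $|V(H)|$ is a constant). For every fixed $\epsilon>0$ there is a constant $c=\frac{\mathrm{poly}(|V(H)|)}{\epsilon^2}$ such that the local search algorithm with swap size $c$ (described in the context), run on any $n$-vertex $H$-minor-free graph $G$, terminates in time $O(n^{c'})$ for some $c'=\frac{\mathrm{poly}(|V(H)|)}{\epsilon^2}$ and outputs a feedback vertex set $S$ of $G$ with $|S|\le (1+\epsilon)\,\mathrm{OPT}(G)$, where $\mathrm{OPT}(G)$ is the minimum size of a feedback vertex set of $G$.
   Context: All graphs are finite and undirected. A feedback vertex set of a graph $G$ is a set $S\subseteq V(G)$ such that $G-S$ is acyclic (a forest); the Feedback Vertex Set (FVS) problem asks for a minimum-size feedback vertex set. A graph $H$ is a minor of $G$ if $H$ can be obtained from $G$ by a sequence of vertex deletions, edge deletions and edge contractions; $G$ is $H$-minor-free if it does not contain $H$ as a minor. The local search algorithm with swap size $c$ is: start with an arbitrary feedback vertex set $S$ of $G$ (e.g. $S=V(G)$); while there exists a feedback vertex set $S'$ of $G$ with $|S\setminus S'|\le c$, $|S'\setminus S|\le c$ and $|S'|<|S|$, replace $S$ by $S'$; when no such $S'$ exists, output $S$. The algorithm does not need to know $H$.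
   Formalization: Proved with c = poly(|V(H)|)/min(1,ε)², rounded up, and c' = poly(|V(H)|)/min(1,ε)²: for large ε the formula poly(|V(H)|)/ε² gives swap size at most 1, which fails, e.g. on K_{2,m}. Time is the step count of an explicit exhaustive-search implementation. *)

theory Defs
  imports
    "HOL-Library.Monad_Syntax"
    "HOL-Library.Landau_Symbols"
    "HOL-Computational_Algebra.Polynomial"
    "Graph_Theory.Digraph_Component"
    "Graph_Theory.Digraph_Isomorphism"
begin

section \<open>Feedback vertex sets\<close>

text \<open>
  A finite simple undirected graph is a \<^locale>\<open>pair_graph\<close>, that is, a finite, loop-free digraph
  without parallel arcs that contains both orientations of every edge. The notion
  \<^const>\<open>forest\<close> of \<^theory>\<open>Graph_Theory.Digraph_Component\<close> cannot be used here: there the closed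
  walk \<open>u, v, u\<close> along a single edge counts as a cycle. A cycle of a simple undirected graph is a
  cycle of length at least 3.
\<close>

definition acyclic_graph :: "('a, 'b) pre_digraph \<Rightarrow> bool" where
  "acyclic_graph G \<longleftrightarrow> \<not> (\<exists>p. pre_digraph.cycle G p \<and> 3 \<le> length p)"

definition feedback_vertex_set :: "'a pair_pre_digraph \<Rightarrow> 'a set \<Rightarrow> bool" where
  "feedback_vertex_set G S \<longleftrightarrow>
     S \<subseteq> pverts G \<and> acyclic_graph (with_proj G \<restriction> (pverts G - S))"

definition fvs_opt :: "'a pair_pre_digraph \<Rightarrow> nat" where
  "fvs_opt G = (LEAST k. \<exists>S. feedback_vertex_set G S \<and> card S = k)"


section \<open>Minors\<close>

text \<open>
  Contracting the edge \<open>{u, v}\<close> identifies \<open>v\<close> with \<open>u\<close>; the resulting loop is dropped and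
  parallel edges are merged.
\<close>

definition merge_into :: "'a \<Rightarrow> 'a \<Rightarrow> 'a \<Rightarrow> 'a" where
  "merge_into u v x = (if x = v then u else x)"

inductive minor_step :: "'a pair_pre_digraph \<Rightarrow> 'a pair_pre_digraph \<Rightarrow> bool" for G where
  delete_vertex:
    "v \<in> pverts G \<Longrightarrow>
     minor_step G \<lparr> pverts = pverts G - {v}, parcs = {(a, b) \<in> parcs G. a \<noteq> v \<and> b \<noteq> v} \<rparr>"
| delete_edge:
    "(u, v) \<in> parcs G \<Longrightarrow>
     minor_step G \<lparr> pverts = pverts G, parcs = parcs G - {(u, v), (v, u)} \<rparr>"
| contract_edge:
    "(u, v) \<in> parcs G \<Longrightarrow>
     minor_step G \<lparr> pverts = pverts G - {v},
                    parcs = {(merge_into u v a, merge_into u v b) | a b.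
                      (a, b) \<in> parcs G \<and> merge_into u v a \<noteq> merge_into u v b} \<rparr>"

definition is_minor :: "'b pair_pre_digraph \<Rightarrow> 'a pair_pre_digraph \<Rightarrow> bool" where
  "is_minor H G \<longleftrightarrow> (\<exists>M. minor_step\<^sup>*\<^sup>* G M \<and> digraph_iso (with_proj H) (with_proj M))"


section \<open>Local search\<close>

text \<open>
  The algorithm with its unspecified choices: from a feedback vertex set one may move to any smaller
  one that is reachable by a swap of size \<open>c\<close>, and one stops when there is none.
\<close>

definition improving_swap :: "nat \<Rightarrow> 'a pair_pre_digraph \<Rightarrow> 'a set \<Rightarrow> 'a set \<Rightarrow> bool" where
  "improving_swap c G S S' \<longleftrightarrow>
     feedback_vertex_set G S' \<and> card (S - S') \<le> c \<and> card (S' - S) \<le> c \<and> card S' < card S"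

definition local_search_output :: "nat \<Rightarrow> 'a pair_pre_digraph \<Rightarrow> 'a set \<Rightarrow> 'a set \<Rightarrow> bool" where
  "local_search_output c G S\<^sub>0 S \<longleftrightarrow>
     (improving_swap c G)\<^sup>*\<^sup>* S\<^sub>0 S \<and> \<not> (\<exists>S'. improving_swap c G S S')"


section \<open>Running time\<close>

text \<open>
  Running times are counted in a step-counting monad. Every call of one of the functions below,
  recursive calls included, costs one step. Besides calling each other, these functions only
  construct and match lists, pairs, options and truth values, compare two vertices, increment or
  decrement a number, and compare a number with 0 or 1.
\<close>

datatype 'a timed = Timed (val: 'a) (steps: nat)

definition bind_timed :: "'a timed \<Rightarrow> ('a \<Rightarrow> 'b timed) \<Rightarrow> 'b timed" where
  "bind_timed m f = (case m of Timed x s \<Rightarrow> case f x of Timed y t \<Rightarrow> Timed y (s + t))"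

adhoc_overloading Monad_Syntax.bind \<rightleftharpoons> bind_timed

definition return :: "'a \<Rightarrow> 'a timed" where
  "return x = Timed x 0"

definition tick :: "'a timed \<Rightarrow> 'a timed" where
  "tick m = (case m of Timed x s \<Rightarrow> Timed x (Suc s))"

lemma bind_timed_cong [fundef_cong]:
  assumes "m = m'" and "\<And>x. x = val m' \<Longrightarrow> f x = f' x"
  shows "bind_timed m f = bind_timed m' f'"
  using assms by (cases m') (simp add: bind_timed_def)

lemma val_timed [simp]:
  "val (bind_timed m f) = val (f (val m))"
  "val (return x) = x"
  "val (tick m) = val m"
  by (simp_all add: bind_timed_def return_def tick_def split: timed.splits)

lemma steps_timed [simp]:
  "steps (bind_timed m f) = steps m + steps (f (val m))"
  "steps (return x) = 0"
  "steps (tick m) = Suc (steps m)"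
  by (simp_all add: bind_timed_def return_def tick_def split: timed.splits)


section \<open>An implementation of local search\<close>

text \<open>
  The input graph is given by a list of its vertices and a list of its arcs, which contains every
  edge in both orientations.
\<close>

definition represents :: "nat list \<Rightarrow> (nat \<times> nat) list \<Rightarrow> nat pair_pre_digraph \<Rightarrow> bool" where
  "represents vs es G \<longleftrightarrow>
     distinct vs \<and> set vs = pverts G \<and> distinct es \<and> set es = parcs G"

fun mem :: "nat \<Rightarrow> nat list \<Rightarrow> bool timed" where
  "mem x [] = tick (return False)"
| "mem x (y # ys) = tick (if x = y then return True else mem x ys)"

fun difference :: "nat list \<Rightarrow> nat list \<Rightarrow> nat list timed" where
  "difference [] ys = tick (return [])"
| "difference (x # xs) ys = tick (do {
     b \<leftarrow> mem x ys;
     zs \<leftarrow> difference xs ys;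
     return (if b then zs else x # zs) })"

fun join :: "'a list \<Rightarrow> 'a list \<Rightarrow> 'a list timed" where
  "join [] ys = tick (return ys)"
| "join (x # xs) ys = tick (do { zs \<leftarrow> join xs ys; return (x # zs) })"

fun shorter :: "'a list \<Rightarrow> 'a list \<Rightarrow> bool timed" where
  "shorter xs [] = tick (return False)"
| "shorter [] (y # ys) = tick (return True)"
| "shorter (x # xs) (y # ys) = tick (shorter xs ys)"

fun cons_all :: "'a \<Rightarrow> 'a list list \<Rightarrow> 'a list list timed" where
  "cons_all x [] = tick (return [])"
| "cons_all x (xs # xss) = tick (do { yss \<leftarrow> cons_all x xss; return ((x # xs) # yss) })"

text \<open>The subsequences of length at most \<open>k\<close>:\<close>

fun small_subseqs :: "nat \<Rightarrow> 'a list \<Rightarrow> 'a list list timed" where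
  "small_subseqs 0 xs = tick (return [[]])"
| "small_subseqs (Suc k) [] = tick (return [[]])"
| "small_subseqs (Suc k) (x # xs) = tick (do {
     A \<leftarrow> small_subseqs k xs;
     A' \<leftarrow> cons_all x A;
     B \<leftarrow> small_subseqs (Suc k) xs;
     join A' B })"

text \<open>
  A graph is acyclic if and only if it vanishes when vertices of degree at most 1 are deleted one
  after the other. The last argument of \<open>vanishes\<close> only serves as a counter for the rounds.
\<close>

fun degree_in :: "(nat \<times> nat) list \<Rightarrow> nat list \<Rightarrow> nat \<Rightarrow> nat timed" where
  "degree_in [] W v = tick (return 0)"
| "degree_in ((a, b) # es) W v = tick (
     if a = v then do {
       w \<leftarrow> mem b W;
       d \<leftarrow> degree_in es W v;
       return (if w then Suc d else d) }
     else degree_in es W v)"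

fun delete_leaf :: "(nat \<times> nat) list \<Rightarrow> nat list \<Rightarrow> nat list \<Rightarrow> nat list timed" where
  "delete_leaf es W [] = tick (return [])"
| "delete_leaf es W (v # us) = tick (do {
     d \<leftarrow> degree_in es W v;
     if d \<le> 1 then return us
     else do { us' \<leftarrow> delete_leaf es W us; return (v # us') } })"

fun vanishes :: "(nat \<times> nat) list \<Rightarrow> nat list \<Rightarrow> nat list \<Rightarrow> bool timed" where
  "vanishes es W [] = tick (return (W = []))"
| "vanishes es W (r # rs) = tick (do { W' \<leftarrow> delete_leaf es W W; vanishes es W' rs })"

definition is_fvs :: "nat list \<Rightarrow> (nat \<times> nat) list \<Rightarrow> nat list \<Rightarrow> bool timed" where
  "is_fvs vs es S = tick (do { W \<leftarrow> difference vs S; vanishes es W W })"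

text \<open>
  All candidates that arise from \<open>S\<close> by removing at most \<open>c\<close> vertices and inserting at most \<open>c\<close>
  vertices are tried in turn, until an improving one is found.
\<close>

fun try_insertions ::
  "nat list \<Rightarrow> (nat \<times> nat) list \<Rightarrow> nat list \<Rightarrow> nat list \<Rightarrow> nat list list \<Rightarrow> nat list option timed"
where
  "try_insertions vs es S R [] = tick (return None)"
| "try_insertions vs es S R (Y # Ys) = tick (do {
     S' \<leftarrow> join R Y;
     a \<leftarrow> shorter S' S;
     b \<leftarrow> is_fvs vs es S';
     if a \<and> b then return (Some S') else try_insertions vs es S R Ys })"

fun try_removals ::
  "nat list \<Rightarrow> (nat \<times> nat) list \<Rightarrow> nat list \<Rightarrow> nat list list \<Rightarrow> nat list list \<Rightarrow> nat list option timed"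
where
  "try_removals vs es S Ys [] = tick (return None)"
| "try_removals vs es S Ys (X # Xs) = tick (do {
     R \<leftarrow> difference S X;
     r \<leftarrow> try_insertions vs es S R Ys;
     case r of
       Some S' \<Rightarrow> return (Some S')
     | None \<Rightarrow> try_removals vs es S Ys Xs })"

definition find_improvement ::
  "nat \<Rightarrow> nat list \<Rightarrow> (nat \<times> nat) list \<Rightarrow> nat list \<Rightarrow> nat list option timed"
where
  "find_improvement c vs es S = tick (do {
     Xs \<leftarrow> small_subseqs c S;
     W \<leftarrow> difference vs S;
     Ys \<leftarrow> small_subseqs c W;
     try_removals vs es S Ys Xs })"

lemma shorter_iff: "val (shorter xs ys) \<longleftrightarrow> length xs < length ys"
  by (induction xs ys rule: shorter.induct) auto

lemma try_insertions_length:
  "val (try_insertions vs es S R Ys) = Some S' \<Longrightarrow> length S' < length S"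
  by (induction Ys) (auto simp: shorter_iff split: if_splits)

lemma try_removals_length:
  "val (try_removals vs es S Ys Xs) = Some S' \<Longrightarrow> length S' < length S"
  by (induction Xs) (auto split: option.splits dest: try_insertions_length)

lemma find_improvement_length:
  "val (find_improvement c vs es S) = Some S' \<Longrightarrow> length S' < length S"
  by (auto simp: find_improvement_def dest: try_removals_length)

function local_search :: "nat \<Rightarrow> nat list \<Rightarrow> (nat \<times> nat) list \<Rightarrow> nat list \<Rightarrow> nat list timed" where
  "local_search c vs es S = tick (do {
     r \<leftarrow> find_improvement c vs es S;
     case r of
       None \<Rightarrow> return S
     | Some S' \<Rightarrow> local_search c vs es S' })"
  by pat_completeness auto
termination
  by (relation "measure (\<lambda>(c, vs, es, S). length S)")
     (auto dest: find_improvement_length[OF sym])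

declare local_search.simps [simp del]

end

theory Submission
  imports Defs
begin

text \<open>
  Let \<open>S\<close> be locally optimal and \<open>T\<close> optimal. In \<open>G - (S \<inter> T)\<close> both \<open>S - T\<close> and \<open>T - S\<close> meet every
  cycle. Deleting or suppressing vertices of degree at most 2 outside the symmetric difference leads
  to a minor of \<open>G\<close>, the exchange graph, with at most \<open>2 \<bar>(S - T) \<union> (T - S)\<bar>\<close> vertices: there,
  every other vertex has degree at least 3, while the two forests bound the number of edges.
  A vertex set that separates \<open>S - T\<close> from \<open>T - S\<close> in the exchange graph separates them in \<open>G\<close>, and
  hence meets every cycle, because a cycle avoiding it would contain vertices of both.

  By the separator theorem of Alon, Seymour and Thomas, recursive separation divides the exchange
  graph into pieces of \<open>O(1 / \<epsilon>\<^sup>2)\<close> vertices with only \<open>O(\<epsilon> (\<bar>S\<bar> + \<bar>T\<bar>))\<close> shared vertices, counted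
  with multiplicity. Exchanging, in one piece \<open>R\<close>, the unshared vertices of \<open>S\<close> for \<open>T \<inter> R\<close> together
  with the shared vertices of \<open>R\<close> is a swap of bounded size, which cannot be improving. Summing
  these inequalities over all pieces gives the approximation ratio.
\<close>

section \<open>Connectedness and clique minors\<close>

text \<open>A division loses a fraction of the vertices that it divides, and \<open>G\<close> can be
  arbitrarily larger than its feedback vertex sets; the exchange graph makes this loss a fraction of
  |S| + |T|. \<open>H\<close> enters only through \<open>h = card (pverts H)\<close>: a graph
  without minor \<open>H\<close> has no clique minor with \<open>h\<close> branch sets. This
  property passes to the exchange graph and to all of its subsets, which is what recursive
  separation requires. The swap size is the bound \<open>r\<close> on the pieces. It is quadratic in
  1 / \<epsilon> because pieces of \<open>r\<close> vertices share a fraction of order h^2 / sqrt r.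
  The constant in sqrt r = 2016 h^2 / \<epsilon> is 28 * 2 * 36: 28 comes from the division, 2 from
  rounding a square root in the separator theorem, and 36 = 6 * 2 * 3 from the exchange inequality
  (6), the size of the exchange graph (2) and the final solution for |S - T| (3).\<close>

definition linked :: "('a \<times> 'a) set \<Rightarrow> 'a set \<Rightarrow> ('a \<times> 'a) set" where
  "linked E W = (E \<inter> W \<times> W)\<^sup>*"

definition connected_set :: "('a \<times> 'a) set \<Rightarrow> 'a set \<Rightarrow> bool" where
  "connected_set E W \<longleftrightarrow> (\<forall>u\<in>W. \<forall>v\<in>W. (u, v) \<in> linked E W)"

lemma linked_refl [simp]: "(u, u) \<in> linked E W"
  by (simp add: linked_def)

lemma linked_trans: "(u, v) \<in> linked E W \<Longrightarrow> (v, w) \<in> linked E W \<Longrightarrow> (u, w) \<in> linked E W"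
  unfolding linked_def by (rule rtrancl_trans)

lemma linked_edge: "(u, v) \<in> E \<Longrightarrow> u \<in> W \<Longrightarrow> v \<in> W \<Longrightarrow> (u, v) \<in> linked E W"
  unfolding linked_def by blast

lemma linked_mono: "W \<subseteq> W' \<Longrightarrow> (u, v) \<in> linked E W \<Longrightarrow> (u, v) \<in> linked E W'"
  unfolding linked_def by (rule subsetD[OF rtrancl_mono]) auto

lemma linked_sym: "sym E \<Longrightarrow> (u, v) \<in> linked E W \<Longrightarrow> (v, u) \<in> linked E W"
  unfolding linked_def by (rule symD[OF sym_rtrancl]) (auto simp: sym_def)

text \<open>\<open>A\<close> is an invariant of the walk. The second conjunct, which confines the
  walk to \<open>A\<close>, is what makes a component connected within itself.\<close>

lemma linked_closed:
  assumes "(u, v) \<in> linked E W" "u \<in> A"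
    and "\<And>x y. x \<in> A \<Longrightarrow> x \<in> W \<Longrightarrow> y \<in> W \<Longrightarrow> (x, y) \<in> E \<Longrightarrow> y \<in> A"
  shows "v \<in> A \<and> (u, v) \<in> linked E (W \<inter> A)"
  using assms(1,2) unfolding linked_def
proof (induction rule: rtrancl_induct)
  case (step y z)
  then have "y \<in> A" "(u, y) \<in> (E \<inter> (W \<inter> A) \<times> (W \<inter> A))\<^sup>*" by auto
  moreover have "z \<in> A" using assms(3) step \<open>y \<in> A\<close> by blast
  ultimately show ?case using step.hyps(2) by (auto intro!: rtrancl_into_rtrancl[of u y])
qed simp

lemma linked_in: "(u, v) \<in> linked E W \<Longrightarrow> u \<in> W \<Longrightarrow> v \<in> W"
  using linked_closed[of u v E W W] by blast

lemma linked_image: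
  assumes "(u, v) \<in> linked E W"
    and "\<And>x y. x \<in> W \<Longrightarrow> y \<in> W \<Longrightarrow> (x, y) \<in> E \<Longrightarrow> (f x, f y) \<in> linked E' W'"
  shows "(f u, f v) \<in> linked E' W'"
  using assms(1) unfolding linked_def
proof (induction rule: rtrancl_induct)
  case (step y z)
  then show ?case using assms(2)[of y z] unfolding linked_def by (auto intro: rtrancl_trans)
qed simp

lemma connected_setI:
  assumes "sym E" and "\<And>v. v \<in> W \<Longrightarrow> (r, v) \<in> linked E W"
  shows "connected_set E W"
  unfolding connected_set_def using assms by (blast intro: linked_sym linked_trans)

lemma connected_set_Un:
  assumes "sym E" "connected_set E A" "connected_set E B" "a \<in> A" "b \<in> B" "a = b \<or> (a, b) \<in> E"
  shows "connected_set E (A \<union> B)"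
proof (rule connected_setI[OF \<open>sym E\<close>, of _ a])
  fix v assume "v \<in> A \<union> B"
  moreover have "(a, v) \<in> linked E (A \<union> B)" if "v \<in> A"
    using that assms linked_mono[of A "A \<union> B"] by (auto simp: connected_set_def)
  moreover have "(a, v) \<in> linked E (A \<union> B)" if "v \<in> B"
  proof -
    have "(b, v) \<in> linked E (A \<union> B)"
      using that assms linked_mono[of B "A \<union> B"] by (auto simp: connected_set_def)
    moreover have "(a, b) \<in> linked E (A \<union> B)" using assms by (auto intro: linked_edge)
    ultimately show ?thesis by (rule linked_trans[rotated])
  qed
  ultimately show "(a, v) \<in> linked E (A \<union> B)" by blast
qed

definition component_of :: "('a \<times> 'a) set \<Rightarrow> 'a set \<Rightarrow> 'a \<Rightarrow> 'a set" where
  "component_of E W v = {w. (v, w) \<in> linked E W}"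

lemma component_of_self [simp]: "v \<in> component_of E W v"
  by (simp add: component_of_def)

lemma component_of_subset: "v \<in> W \<Longrightarrow> component_of E W v \<subseteq> W"
  by (auto simp: component_of_def dest: linked_in)

lemma component_of_closed:
  "x \<in> component_of E W v \<Longrightarrow> (x, y) \<in> E \<Longrightarrow> x \<in> W \<Longrightarrow> y \<in> W \<Longrightarrow> y \<in> component_of E W v"
  by (auto simp: component_of_def intro: linked_trans linked_edge)

lemma connected_component_of:
  assumes "sym E" "v \<in> W"
  shows "connected_set E (component_of E W v)"
proof (rule connected_setI[OF \<open>sym E\<close>, of _ v])
  fix w assume "w \<in> component_of E W v"
  then have "(v, w) \<in> linked E W" by (simp add: component_of_def)
  from linked_closed[OF this component_of_self]
  have "(v, w) \<in> linked E (W \<inter> component_of E W v)"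
    using component_of_closed by fast
  then show "(v, w) \<in> linked E (component_of E W v)" by (rule linked_mono[rotated]) simp
qed

text \<open>The branch sets of a complete minor. No sequence of minor operations is involved, so
  later constructions only move vertices between branch sets; their number is the cardinality of
  \<open>\<C>\<close>.\<close>

definition clique_model :: "('a \<times> 'a) set \<Rightarrow> 'a set \<Rightarrow> 'a set set \<Rightarrow> bool" where
  "clique_model E V \<C> \<longleftrightarrow>
     (\<forall>C\<in>\<C>. C \<noteq> {} \<and> C \<subseteq> V \<and> connected_set E C) \<and>
     (\<forall>C\<in>\<C>. \<forall>D\<in>\<C>. C \<noteq> D \<longrightarrow> C \<inter> D = {} \<and> (\<exists>x\<in>C. \<exists>y\<in>D. (x, y) \<in> E))"

definition has_clique_minor :: "('a \<times> 'a) set \<Rightarrow> 'a set \<Rightarrow> nat \<Rightarrow> bool" where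
  "has_clique_minor E V h \<longleftrightarrow> (\<exists>\<C>. finite \<C> \<and> card \<C> = h \<and> clique_model E V \<C>)"

lemma has_clique_minor_mono:
  assumes "has_clique_minor E V h" "V \<subseteq> V'"
  shows "has_clique_minor E V' h"
proof -
  obtain \<C> where "finite \<C>" "card \<C> = h" "clique_model E V \<C>"
    using assms unfolding has_clique_minor_def by blast
  moreover from this(3) \<open>V \<subseteq> V'\<close> have "clique_model E V' \<C>"
    unfolding clique_model_def by fast
  ultimately show ?thesis unfolding has_clique_minor_def by blast
qed

section \<open>From branch sets to sequences of minor operations\<close>

lemma pair_graphI:
  assumes "finite V" "E \<subseteq> V \<times> V" "sym E" "irrefl E"
  shows "pair_graph \<lparr>pverts = V, parcs = E\<rparr>"
proof -
  have "finite E" using assms finite_subset by blast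
  have "symmetric (with_proj \<lparr>pverts = V, parcs = E\<rparr>)"
    using \<open>sym E\<close> by (simp add: symmetric_def)
  then show ?thesis using assms \<open>finite E\<close> by unfold_locales (auto simp: irrefl_def)
qed

lemma pair_graphD:
  assumes "pair_graph G"
  shows "finite (pverts G)" "parcs G \<subseteq> pverts G \<times> pverts G" "sym (parcs G)" "irrefl (parcs G)"
proof -
  interpret pair_graph G by fact
  show "finite (pverts G)" "parcs G \<subseteq> pverts G \<times> pverts G"
    using pair_finite_verts by (auto dest: in_arcsD1 in_arcsD2)
  show "sym (parcs G)" using sym_arcs by (simp add: symmetric_def)
  show "irrefl (parcs G)" using no_loops unfolding irrefl_def by fastforce
qed

lemma minor_steps_delete_edges:
  assumes "finite (parcs G)" "sym (parcs G)" "F \<subseteq> parcs G" "sym F"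
  shows "minor_step\<^sup>*\<^sup>* G \<lparr>pverts = pverts G, parcs = F\<rparr>"
  using assms
proof (induction "card (parcs G - F)" arbitrary: G rule: less_induct)
  case less
  show ?case
  proof (cases "parcs G = F")
    case True
    then have "G = \<lparr>pverts = pverts G, parcs = F\<rparr>" by simp
    then show ?thesis by (metis rtranclp.rtrancl_refl)
  next
    case False
    then obtain u v where uv: "(u, v) \<in> parcs G" "(u, v) \<notin> F" using less.prems by auto
    let ?G = "\<lparr>pverts = pverts G, parcs = parcs G - {(u, v), (v, u)}\<rparr>"
    have "minor_step G ?G" using uv by (intro minor_step.delete_edge)
    moreover have "card (parcs ?G - F) < card (parcs G - F)"
      using uv less.prems by (intro psubset_card_mono) auto
    then have "minor_step\<^sup>*\<^sup>* ?G \<lparr>pverts = pverts ?G, parcs = F\<rparr>"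
      using less.prems uv by (intro less.hyps) (auto simp: sym_def)
    ultimately show ?thesis by (simp add: converse_rtranclp_into_rtranclp)
  qed
qed

lemma connected_set_edge:
  assumes "connected_set E C" "a \<in> C" "b \<in> C" "a \<noteq> b"
  obtains u v where "u \<in> C" "v \<in> C" "(u, v) \<in> E" "u \<noteq> v"
proof -
  have "(a, b) \<in> (E \<inter> C \<times> C)\<^sup>*" using assms by (auto simp: connected_set_def linked_def)
  then have "a \<noteq> b \<longrightarrow> (\<exists>u v. u \<in> C \<and> v \<in> C \<and> (u, v) \<in> E \<and> u \<noteq> v)"
    by (induction rule: rtrancl_induct) auto
  then show ?thesis using that \<open>a \<noteq> b\<close> by blast
qed

text \<open>Induction on the number of vertices: a vertex outside the branch sets is deleted, an
  edge inside a branch set is contracted. If neither is possible, the branch sets are the single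
  vertices of \<open>G\<close>; then \<open>G\<close> is complete on as many vertices as
  \<open>H\<close> has, and deleting edges leaves a copy of \<open>H\<close>.\<close>

lemma clique_model_imp_is_minor:
  fixes H :: "'b pair_pre_digraph" and G :: "'a pair_pre_digraph"
  assumes "pair_graph H" "pair_graph G"
    and "has_clique_minor (parcs G) (pverts G) (card (pverts H))"
  shows "is_minor H G"
  using assms(2,3)
proof (induction "card (pverts G)" arbitrary: G rule: less_induct)
  case less
  note G = pair_graphD[OF less.prems(1)]
  have finE: "finite (parcs G)" using G finite_subset by blast
  obtain \<C> where \<C>: "finite \<C>" "card \<C> = card (pverts H)"
    and model: "clique_model (parcs G) (pverts G) \<C>"
    using less.prems(2) unfolding has_clique_minor_def by blast
  have reduce: "is_minor H G"
    if step: "minor_step G G'" and G': "pair_graph G'"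
      and "card (pverts G') < card (pverts G)"
      and "has_clique_minor (parcs G') (pverts G') (card (pverts H))" for G'
  proof -
    have "is_minor H G'" using less.hyps that by blast
    then show ?thesis
      unfolding is_minor_def using step by (meson converse_rtranclp_into_rtranclp)
  qed
  consider (outside) v where "v \<in> pverts G" "v \<notin> \<Union>\<C>"
    | (big) C a b where "C \<in> \<C>" "a \<in> C" "b \<in> C" "a \<noteq> b"
    | (tight) "pverts G \<subseteq> \<Union>\<C>" "\<And>C a b. C \<in> \<C> \<Longrightarrow> a \<in> C \<Longrightarrow> b \<in> C \<Longrightarrow> a = b"
    by blast
  then show ?case
  proof cases
    case outside
    let ?E = "{(a, b) \<in> parcs G. a \<noteq> v \<and> b \<noteq> v}"
    let ?G = "\<lparr>pverts = pverts G - {v}, parcs = ?E\<rparr>"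
    show ?thesis
    proof (rule reduce)
      show "minor_step G ?G" using outside by (intro minor_step.delete_vertex)
      show "pair_graph ?G"
        using G by (intro pair_graphI) (auto simp: sym_def irrefl_def)
      show "card (pverts ?G) < card (pverts G)"
        using outside G by (simp add: card_Diff1_less del: card_Diff_insert)
      have eq: "?E \<inter> C \<times> C = parcs G \<inter> C \<times> C" if "C \<in> \<C>" for C
        using outside that by auto
      have "clique_model ?E (pverts G - {v}) \<C>"
        unfolding clique_model_def
      proof (intro conjI ballI impI)
        fix C assume C: "C \<in> \<C>"
        show "C \<noteq> {}" "C \<subseteq> pverts G - {v}"
          using C model outside unfolding clique_model_def by blast+
        show "connected_set ?E C"
          using C model unfolding clique_model_def connected_set_def linked_def eq[OF C] by blast
        fix D assume D: "D \<in> \<C>" "C \<noteq> D"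
        show "C \<inter> D = {}" using C D model unfolding clique_model_def by blast
        obtain x y where xy: "x \<in> C" "y \<in> D" "(x, y) \<in> parcs G"
          using C D model unfolding clique_model_def by blast
        then have "(x, y) \<in> ?E" using C D outside by auto
        then show "\<exists>x\<in>C. \<exists>y\<in>D. (x, y) \<in> ?E" using xy by blast
      qed
      then show "has_clique_minor (parcs ?G) (pverts ?G) (card (pverts H))"
        using \<C> by (auto simp: has_clique_minor_def)
    qed
  next
    case big
    then obtain u v where uv: "u \<in> C" "v \<in> C" "(u, v) \<in> parcs G" "u \<noteq> v"
      using model connected_set_edge unfolding clique_model_def by metis
    let ?m = "merge_into u v"
    let ?E = "{(?m a, ?m b) | a b. (a, b) \<in> parcs G \<and> ?m a \<noteq> ?m b}"
    let ?G = "\<lparr>pverts = pverts G - {v}, parcs = ?E\<rparr>"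
    have E: "(?m a, ?m b) \<in> ?E" if "(a, b) \<in> parcs G" "?m a \<noteq> ?m b" for a b
      using that by blast
    \<comment> \<open>The vertex \<open>v\<close> is merged into a vertex of its own branch set, so
      no branch set receives a vertex of another one. This keeps the images disjoint.\<close>
    have sub: "?m ` D \<subseteq> D - {v}" if "D \<in> \<C>" for D
    proof -
      have "u \<in> D" if "v \<in> D"
        using model big(1) uv \<open>D \<in> \<C>\<close> that unfolding clique_model_def by blast
      then show ?thesis using uv by (auto simp: merge_into_def)
    qed
    have disj: "D \<inter> D' = {}" if "D \<in> \<C>" "D' \<in> \<C>" "D \<noteq> D'" for D D'
      using model that unfolding clique_model_def by blast
    have ne: "D \<noteq> {}" "D \<subseteq> pverts G" "connected_set (parcs G) D" if "D \<in> \<C>" for D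
      using model that unfolding clique_model_def by blast+
    have adj: "\<exists>x\<in>D. \<exists>y\<in>D'. (x, y) \<in> parcs G" if "D \<in> \<C>" "D' \<in> \<C>" "D \<noteq> D'" for D D'
      using model that unfolding clique_model_def by blast
    have mdisj: "?m ` D \<inter> ?m ` D' = {}" if "D \<in> \<C>" "D' \<in> \<C>" "D \<noteq> D'" for D D'
      using sub[OF that(1)] sub[OF that(2)] disj[OF that] by blast
    have inj: "inj_on ((`) ?m) \<C>"
    proof (rule inj_onI, rule ccontr)
      fix D D' assume "D \<in> \<C>" "D' \<in> \<C>" "?m ` D = ?m ` D'" "D \<noteq> D'"
      then show False using mdisj[of D D'] ne(1)[of D] by auto
    qed
    have conn: "connected_set ?E (?m ` D)" if D: "D \<in> \<C>" for D
    proof -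
      have "(?m a, ?m b) \<in> linked ?E (?m ` D)" if "a \<in> D" "b \<in> D" for a b
      proof (rule linked_image[where E = "parcs G" and W = D and f = ?m and u = a and v = b])
        show "(a, b) \<in> linked (parcs G) D"
          using ne(3)[OF D] that by (auto simp: connected_set_def)
        fix x y assume xy: "x \<in> D" "y \<in> D" "(x, y) \<in> parcs G"
        show "(?m x, ?m y) \<in> linked ?E (?m ` D)"
        proof (cases "?m x = ?m y")
          case False
          show ?thesis by (rule linked_edge[OF E[OF xy(3) False]]) (use xy in blast)+
        qed simp
      qed
      then show ?thesis unfolding connected_set_def by blast
    qed
    show ?thesis
    proof (rule reduce)
      show "minor_step G ?G" using uv by (intro minor_step.contract_edge)
      show "pair_graph ?G"
      proof (rule pair_graphI)
        show "?E \<subseteq> (pverts G - {v}) \<times> (pverts G - {v})"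
          using G(2) uv by (auto simp: merge_into_def split: if_splits)
        show "sym ?E"
        proof (rule symI)
          fix x y assume "(x, y) \<in> ?E"
          then obtain a b where "x = ?m a" "y = ?m b" "(a, b) \<in> parcs G" "x \<noteq> y" by blast
          then show "(y, x) \<in> ?E" using E[OF symD[OF G(3)]] by simp
        qed
        show "irrefl ?E" unfolding irrefl_def by blast
        show "finite (pverts G - {v})" using G(1) by simp
      qed
      show "card (pverts ?G) < card (pverts G)"
        using uv G by (auto intro!: psubset_card_mono)
      have "clique_model ?E (pverts G - {v}) ((`) ?m ` \<C>)"
        unfolding clique_model_def
      proof (intro conjI ballI impI)
        fix D assume "D \<in> (`) ?m ` \<C>"
        then obtain D0 where D0: "D0 \<in> \<C>" "D = ?m ` D0" by blast
        show "D \<noteq> {}" using D0 ne by simp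
        show "D \<subseteq> pverts G - {v}" using D0 ne(2)[of D0] sub[of D0] by blast
        show "connected_set ?E D" using D0 conn by simp
        fix D' assume "D' \<in> (`) ?m ` \<C>" "D \<noteq> D'"
        then obtain D1 where D1: "D1 \<in> \<C>" "D' = ?m ` D1" "D0 \<noteq> D1" using D0 by blast
        show "D \<inter> D' = {}" using D0 D1 mdisj by simp
        obtain x y where xy: "x \<in> D0" "y \<in> D1" "(x, y) \<in> parcs G"
          using adj[OF D0(1) D1(1,3)] by blast
        have "?m x \<in> ?m ` D0" "?m y \<in> ?m ` D1" using xy by simp_all
        then have "?m x \<noteq> ?m y" using mdisj[OF D0(1) D1(1,3)] by (metis disjoint_iff)
        then have "(?m x, ?m y) \<in> ?E" by (rule E[OF xy(3)])
        moreover have "?m x \<in> D" "?m y \<in> D'" using xy D0 D1 by simp_all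
        ultimately show "\<exists>x\<in>D. \<exists>y\<in>D'. (x, y) \<in> ?E" by (rule_tac bexI)+
      qed
      then show "has_clique_minor (parcs ?G) (pverts ?G) (card (pverts H))"
        unfolding has_clique_minor_def using \<C> inj
        by (intro exI[of _ "(`) ?m ` \<C>"]) (simp add: card_image)
    qed
  next
    case tight
    note H = pair_graphD[OF \<open>pair_graph H\<close>]
    have "C \<noteq> {}" "C \<subseteq> pverts G" if "C \<in> \<C>" for C
      using model that unfolding clique_model_def by blast+
    then have V: "pverts G = \<Union>\<C>" using tight(1) by blast
    have sing: "\<exists>x. C = {x}" if "C \<in> \<C>" for C
    proof -
      obtain x where "x \<in> C" using \<open>C \<in> \<C> \<Longrightarrow> C \<noteq> {}\<close> \<open>C \<in> \<C>\<close> by blast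
      then have "C = {x}" using tight(2)[OF that] by blast
      then show ?thesis by blast
    qed
    have complete: "(x, y) \<in> parcs G" if xy: "x \<in> pverts G" "y \<in> pverts G" "x \<noteq> y" for x y
    proof -
      have mem: "{z} \<in> \<C>" if z: "z \<in> pverts G" for z
      proof -
        obtain C where "C \<in> \<C>" "z \<in> C" using z V by blast
        then show ?thesis using sing[of C] by auto
      qed
      have "{x} \<noteq> {y}" using \<open>x \<noteq> y\<close> by simp
      then have "\<exists>a\<in>{x}. \<exists>b\<in>{y}. (a, b) \<in> parcs G"
        using model mem[OF xy(1)] mem[OF xy(2)] unfolding clique_model_def by metis
      then show ?thesis by simp
    qed
    have "\<C> = (\<lambda>x. {x}) ` pverts G"
    proof (intro equalityI subsetI)
      fix C assume C: "C \<in> \<C>"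
      then obtain x where "C = {x}" using sing by blast
      then show "C \<in> (\<lambda>x. {x}) ` pverts G" using C V by blast
    next
      fix C assume "C \<in> (\<lambda>x. {x}) ` pverts G"
      then obtain x D where "C = {x}" "x \<in> D" "D \<in> \<C>" using V by blast
      then show "C \<in> \<C>" using sing[of D] by auto
    qed
    then have "card (pverts G) = card (pverts H)" using \<C> by (simp add: card_image)
    \<comment> \<open>As \<open>G\<close> is complete, any bijection between the vertex sets carries
      the arcs of \<open>H\<close> to arcs of \<open>G\<close>.\<close>
    then obtain f where f: "bij_betw f (pverts H) (pverts G)"
      using finite_same_card_bij[OF H(1) G(1)] by metis
    then have inj: "inj_on f (pverts H)" and img: "f ` pverts H = pverts G"
      by (auto simp: bij_betw_def)
    let ?F = "map_prod f f ` parcs H"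
    let ?M = "\<lparr>pverts = pverts G, parcs = ?F\<rparr>"
    have "?F \<subseteq> parcs G"
    proof (clarsimp)
      fix a b assume ab: "(a, b) \<in> parcs H"
      then have "a \<noteq> b" "a \<in> pverts H" "b \<in> pverts H" using H(2,4) by (auto simp: irrefl_def)
      then have "f a \<noteq> f b" "f a \<in> pverts G" "f b \<in> pverts G"
        using inj img by (auto simp: inj_on_def)
      then show "(f a, f b) \<in> parcs G" by (intro complete)
    qed
    moreover have "sym ?F"
    proof (rule symI)
      fix x y assume "(x, y) \<in> ?F"
      then obtain a b where "x = f a" "y = f b" "(a, b) \<in> parcs H" by auto
      then show "(y, x) \<in> ?F" using symD[OF H(3)] by force
    qed
    ultimately have steps: "minor_step\<^sup>*\<^sup>* G ?M"
      using finE G(3) by (intro minor_steps_delete_edges)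
    have "inj_on (map_prod f f) (pverts H \<times> pverts H)"
      using inj inj by (rule map_prod_inj_on)
    then have injF: "inj_on (map_prod f f) (parcs H)" using H(2) by (rule inj_on_subset)
    interpret H: pair_graph H by fact
    let ?hom = "\<lparr>iso_verts = f, iso_arcs = map_prod f f, iso_head = snd, iso_tail = fst\<rparr>"
    have "pre_digraph.digraph_isomorphism (with_proj H) ?hom"
      unfolding pre_digraph.digraph_isomorphism_def
      using inj injF H.wf_digraph by auto
    moreover have "with_proj ?M = app_iso ?hom (with_proj H)"
      by (simp add: app_iso_def with_proj_def img)
    ultimately show ?thesis using steps unfolding is_minor_def digraph_iso_def by blast
  qed
qed

section \<open>Cycle-free vertex sets\<close>

text \<open>
  A graph has a cycle if and only if it has such a set: a longest path inside the set closes up at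
  its first vertex. Unlike cycles, these sets are easy to transport through vertex suppression.
\<close>

definition core :: "('a \<times> 'a) set \<Rightarrow> 'a set \<Rightarrow> bool" where
  "core E U \<longleftrightarrow> U \<noteq> {} \<and> (\<forall>v\<in>U. \<exists>a\<in>U. \<exists>b\<in>U. a \<noteq> b \<and> (v, a) \<in> E \<and> (v, b) \<in> E)"

definition cycle_free :: "('a \<times> 'a) set \<Rightarrow> 'a set \<Rightarrow> bool" where
  "cycle_free E W \<longleftrightarrow> (\<forall>U\<subseteq>W. \<not> core E U)"

lemma cycle_free_mono: "cycle_free E W \<Longrightarrow> W' \<subseteq> W \<Longrightarrow> cycle_free E W'"
  by (auto simp: cycle_free_def)

section \<open>Cores versus closed walks with distinct vertices\<close>

lemma cas_iff_nth:
  assumes "tail D = fst" "head D = snd" "p \<noteq> []"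
  shows "pre_digraph.cas D u p v \<longleftrightarrow>
    fst (p ! 0) = u \<and> snd (last p) = v \<and> (\<forall>i. Suc i < length p \<longrightarrow> fst (p ! Suc i) = snd (p ! i))"
  using assms(3)
proof (induction p arbitrary: u)
  case (Cons e p)
  show ?case
  proof (cases "p = []")
    case True
    then show ?thesis by (simp add: pre_digraph.cas.simps assms)
  next
    case False
    have "(\<forall>i. Suc i < length (e # p) \<longrightarrow> fst ((e # p) ! Suc i) = snd ((e # p) ! i)) \<longleftrightarrow>
       fst (p ! 0) = snd e \<and> (\<forall>i. Suc i < length p \<longrightarrow> fst (p ! Suc i) = snd (p ! i))"
      using False by (simp add: All_less_Suc2 less_Suc_eq_0_disj all_conj_distrib nth_Cons split: nat.splits)
    then show ?thesis using False Cons.IH[OF False] by (simp add: pre_digraph.cas.simps assms) blast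
  qed
qed simp

text \<open>Each vertex of the cycle has its predecessor and its successor as neighbours; length at
  least 3 makes these two distinct.\<close>

lemma cycle_imp_core:
  assumes "sym E" and D: "D = \<lparr>verts = W, arcs = E \<inter> W \<times> W, tail = fst, head = snd\<rparr>"
    and cyc: "pre_digraph.cycle D p" and len: "3 \<le> length p"
  shows "\<exists>U\<subseteq>W. core E U"
proof -
  have [simp]: "tail D = fst" "head D = snd" "arcs D = E \<inter> W \<times> W" by (simp_all add: D)
  obtain u where walk: "pre_digraph.awalk D u p u" and dist: "distinct (tl (pre_digraph.awalk_verts D u p))"
    and ne: "p \<noteq> []"
    using cyc unfolding pre_digraph.cycle_def by blast
  have sub: "set p \<subseteq> E \<inter> W \<times> W" and cas: "pre_digraph.cas D u p u"
    using walk by (auto simp: pre_digraph.awalk_def)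
  have "distinct (map snd p)"
    using dist ne by (simp add: pre_digraph.awalk_verts_conv'[OF cas])
  then have inj: "snd (p ! i) \<noteq> snd (p ! j)" if "i < length p" "j < length p" "i \<noteq> j" for i j
    using that by (metis length_map nth_map nth_eq_iff_index_eq)
  let ?n = "length p"
  \<comment> \<open>Positions are read modulo \<open>?n\<close>: the heads of the arcs
    \<open>nxt i\<close> and \<open>prv i\<close> are the two neighbours of the head of arc
    \<open>i\<close>.\<close>
  define nxt where "nxt i = (if Suc i < ?n then Suc i else 0)" for i
  define prv where "prv i = (if i = 0 then ?n - 1 else i - 1)" for i
  have nxt: "nxt i < ?n" "fst (p ! nxt i) = snd (p ! i)" if "i < ?n" for i
  proof -
    show "nxt i < ?n" using that len by (auto simp: nxt_def)
    have "fst (p ! 0) = u" "snd (p ! (?n - 1)) = u" "\<forall>i. Suc i < ?n \<longrightarrow> fst (p ! Suc i) = snd (p ! i)"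
      using cas ne by (auto simp: cas_iff_nth last_conv_nth)
    moreover have "i = ?n - 1" if "\<not> Suc i < ?n" using \<open>i < ?n\<close> that by simp
    ultimately show "fst (p ! nxt i) = snd (p ! i)" by (auto simp: nxt_def)
  qed
  have edge: "(snd (p ! i), snd (p ! nxt i)) \<in> E \<inter> W \<times> W" if "i < ?n" for i
  proof -
    have "p ! nxt i \<in> E \<inter> W \<times> W" using sub nxt(1)[OF that] nth_mem by blast
    then show ?thesis using nxt(2)[OF that] by (metis prod.collapse)
  qed
  have "core E (snd ` set p)"
    unfolding core_def
  proof (intro conjI ballI)
    fix v assume "v \<in> snd ` set p"
    then obtain i where i: "i < ?n" "v = snd (p ! i)" by (auto simp: in_set_conv_nth)
    have prv: "prv i < ?n" "nxt (prv i) = i" "prv i \<noteq> nxt i"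
      using i len by (auto simp: prv_def nxt_def)
    show "\<exists>a\<in>snd ` set p. \<exists>b\<in>snd ` set p. a \<noteq> b \<and> (v, a) \<in> E \<and> (v, b) \<in> E"
    proof (intro bexI conjI)
      show "snd (p ! nxt i) \<noteq> snd (p ! prv i)" using inj nxt(1)[OF i(1)] prv by metis
      show "(v, snd (p ! nxt i)) \<in> E" using edge[OF i(1)] i by simp
      show "(v, snd (p ! prv i)) \<in> E" using edge[OF prv(1)] prv(2) i symD[OF \<open>sym E\<close>] by simp
    qed (use nxt(1)[OF i(1)] prv in auto)
  qed (use ne in simp)
  moreover have "snd ` set p \<subseteq> W" using sub by auto
  ultimately show ?thesis by blast
qed

lemma core_imp_cycle:
  assumes "sym E" "irrefl E" "finite U" "U \<subseteq> W" and core: "core E U"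
    and D: "D = \<lparr>verts = W, arcs = E \<inter> W \<times> W, tail = fst, head = snd\<rparr>"
  shows "\<exists>p. pre_digraph.cycle D p \<and> 3 \<le> length p"
proof -
  define P where "P xs \<longleftrightarrow> xs \<noteq> [] \<and> distinct xs \<and> set xs \<subseteq> U \<and>
    (\<forall>i. Suc i < length xs \<longrightarrow> (xs ! i, xs ! Suc i) \<in> E)" for xs
  obtain v where "v \<in> U" using core unfolding core_def by blast
  then have "P [v]" by (simp add: P_def)
  have bound: "length xs \<le> card U" if "P xs" for xs
    using that \<open>finite U\<close> unfolding P_def by (metis card_mono distinct_card)
  obtain xs where xs: "P xs" and max: "\<And>ys. P ys \<Longrightarrow> length ys \<le> length xs"
    using ex_has_greatest_nat[of P "[v]" length "Suc (card U)"] \<open>P [v]\<close> bound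
    by (metis less_Suc_eq_le)
  then have ne: "xs \<noteq> []" and dist: "distinct xs" and sub: "set xs \<subseteq> U"
    and adj: "\<And>i. Suc i < length xs \<Longrightarrow> (xs ! i, xs ! Suc i) \<in> E"
    unfolding P_def by blast+
  have "xs ! 0 \<in> U" using ne sub by (simp add: subset_iff)
  then obtain a b where ab: "a \<in> U" "b \<in> U" "a \<noteq> b" "(xs ! 0, a) \<in> E" "(xs ! 0, b) \<in> E"
    using core unfolding core_def by blast
  have irr: "(x, x) \<notin> E" for x using \<open>irrefl E\<close> by (simp add: irrefl_def)
  show ?thesis
  proof (cases "a \<in> set xs \<and> b \<in> set xs")
    case True
    then obtain i j where ij: "i < length xs" "a = xs ! i" "j < length xs" "b = xs ! j"
      by (metis in_set_conv_nth)
    have "i \<noteq> 0" "j \<noteq> 0" "i \<noteq> j" using ij ab irr by metis+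
    \<comment> \<open>Of two distinct positive positions the later one is at least 2, so closing the
      path there gives at least three arcs.\<close>
    then have "2 \<le> max i j" by linarith
    then obtain j where j: "2 \<le> j" "j < length xs" "(xs ! 0, xs ! j) \<in> E"
      using ij ab by (metis max_def)
    let ?p = "map (\<lambda>i. (xs ! i, xs ! Suc i)) [0..<j] @ [(xs ! j, xs ! 0)]"
    have len: "length ?p = Suc j" by simp
    have in_W: "xs ! i \<in> W" if "i < length xs" for i using that sub \<open>U \<subseteq> W\<close> nth_mem by blast
    have [simp]: "tail D = fst" "head D = snd" "arcs D = E \<inter> W \<times> W" "verts D = W" by (simp_all add: D)
    have cas: "pre_digraph.cas D (xs ! 0) ?p (xs ! 0)"
      using j by (subst cas_iff_nth) (auto simp: nth_append less_Suc_eq)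
    have "(xs ! j, xs ! 0) \<in> E" using j \<open>sym E\<close> symD by fast
    moreover have "xs ! 0 \<in> W" using in_W ne by blast
    ultimately have walk: "pre_digraph.awalk D (xs ! 0) ?p (xs ! 0)"
      using cas j adj in_W by (auto simp: pre_digraph.awalk_def)
    have "map snd ?p = map ((!) xs) (map Suc [0..<j] @ [0])" by simp
    also have "distinct \<dots>"
    proof -
      have "xs ! i \<noteq> xs ! k" if "i \<noteq> k" "i \<le> j" "k \<le> j" for i k
        using that dist j nth_eq_iff_index_eq[of xs i k] by simp
      then have "inj_on ((!) xs) {..j}" unfolding inj_on_def by auto
      then have "inj_on ((!) xs) (set (map Suc [0..<j] @ [0]))" by (rule inj_on_subset) auto
      moreover have "distinct (map Suc [0..<j] @ [0])" by (simp add: distinct_map)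
      ultimately show ?thesis by (simp only: distinct_map)
    qed
    finally have "distinct (map snd ?p)" .
    then have "distinct (tl (pre_digraph.awalk_verts D (xs ! 0) ?p))"
      by (simp add: pre_digraph.awalk_verts_conv'[OF cas])
    then have "pre_digraph.cycle D ?p" using walk unfolding pre_digraph.cycle_def by blast
    then show ?thesis using len j by (intro exI[of _ ?p]) simp
  next
    case False
    \<comment> \<open>A neighbour off the path would prolong it at its front, although it is a
      longest one.\<close>
    then obtain c where c: "c \<in> U" "c \<notin> set xs" "(c, xs ! 0) \<in> E"
      using ab symD[OF \<open>sym E\<close>] by blast
    then have "P (c # xs)"
      using ne dist sub adj by (auto simp: P_def nth_Cons split: nat.splits)
    then show ?thesis using max by fastforce
  qed
qed

lemma acyclic_graph_induce_iff:
  assumes "pair_graph G" "finite W"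
  shows "acyclic_graph (with_proj G \<restriction> W) \<longleftrightarrow> cycle_free (parcs G) W"
proof -
  note G = pair_graphD[OF assms(1)]
  have D: "with_proj G \<restriction> W = \<lparr>verts = W, arcs = parcs G \<inter> W \<times> W, tail = fst, head = snd\<rparr>"
    by (auto simp: induce_subgraph_def)
  show ?thesis
    unfolding acyclic_graph_def cycle_free_def
    using cycle_imp_core[OF G(3) D] core_imp_cycle[OF G(3,4) _ _ _ D] finite_subset[OF _ assms(2)]
    by blast
qed

lemma feedback_vertex_set_iff:
  assumes "pair_graph G"
  shows "feedback_vertex_set G S \<longleftrightarrow> S \<subseteq> pverts G \<and> cycle_free (parcs G) (pverts G - S)"
  using assms pair_graphD(1)[OF assms]
  by (auto simp: feedback_vertex_set_def acyclic_graph_induce_iff)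

text \<open>A nonempty cycle-free set is not a core, so it has a vertex with at most one neighbour
  inside. Removing this vertex loses at most one edge, that is, two ordered pairs of
  \<open>E\<close>.\<close>

lemma cycle_free_card_edges:
  assumes "finite W" "sym E" "irrefl E" "cycle_free E W"
  shows "card (E \<inter> W \<times> W) \<le> 2 * card W"
  using assms(1,4)
proof (induction "card W" arbitrary: W)
  case (Suc n)
  then have "\<not> core E W" "W \<noteq> {}" by (auto simp: cycle_free_def)
  then obtain v where v: "v \<in> W" and deg: "\<And>a b. a \<in> W \<Longrightarrow> b \<in> W \<Longrightarrow> (v, a) \<in> E \<Longrightarrow> (v, b) \<in> E \<Longrightarrow> a = b"
    unfolding core_def by blast
  define N where "N = E `` {v} \<inter> W"
  have finN: "finite N" using Suc.prems by (simp add: N_def)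
  have "card N \<le> 1" using deg finN by (auto simp: N_def card_le_Suc0_iff_eq)
  have "E \<inter> W \<times> W \<subseteq> (E \<inter> (W - {v}) \<times> (W - {v})) \<union> ({v} \<times> N \<union> N \<times> {v})"
    using \<open>sym E\<close> by (auto simp: N_def dest: symD)
  then have "card (E \<inter> W \<times> W) \<le> card ((E \<inter> (W - {v}) \<times> (W - {v})) \<union> ({v} \<times> N \<union> N \<times> {v}))"
    using Suc.prems finN by (intro card_mono) auto
  also have "\<dots> \<le> card (E \<inter> (W - {v}) \<times> (W - {v})) + (card ({v} \<times> N) + card (N \<times> {v}))"
    by (meson card_Un_le add_left_mono order_trans)
  also have "\<dots> \<le> 2 * card (W - {v}) + 2"
  proof (rule add_mono)
    show "card (E \<inter> (W - {v}) \<times> (W - {v})) \<le> 2 * card (W - {v})"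
      using Suc v by (intro Suc.hyps) (auto intro: cycle_free_mono)
    show "card ({v} \<times> N) + card (N \<times> {v}) \<le> 2"
      using \<open>card N \<le> 1\<close> by (simp add: card_cartesian_product)
  qed
  also have "\<dots> = 2 * card W" using Suc v by simp
  finally show ?case .
qed simp

section \<open>The separator theorem of Alon, Seymour and Thomas\<close>

text \<open>For \<open>card V\<close> at most \<open>t * t\<close> and \<open>k\<close> at most
  \<open>h\<close>, both outcomes have at most \<open>h * t\<close> vertices. This balance is the
  origin of the square root in the separator theorem.\<close>

lemma small_connector_or_cut:
  assumes "finite V" "sym E" "1 \<le> k" "1 \<le> t"
  shows "(\<exists>T\<subseteq>V. connected_set E T \<and> card T \<le> t \<and> (\<forall>i<k. T \<inter> A i \<noteq> {})) \<or>
    (\<exists>Z\<subseteq>V. t * card Z \<le> (k - 1) * card V \<and>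
       (\<forall>F\<subseteq>V - Z. connected_set E F \<longrightarrow> (\<exists>i<k. F \<inter> A i = {})))"
proof (rule disj_imp[THEN iffD2], rule impI)
  assume no: "\<not> (\<exists>T\<subseteq>V. connected_set E T \<and> card T \<le> t \<and> (\<forall>i<k. T \<inter> A i \<noteq> {}))"
  \<comment> \<open>\<open>D j\<close> is a breadth-first search that collects the sets \<open>A 0, A 1, \<dots>\<close> in this order; as it
    never finishes within \<open>t\<close> steps, one of its \<open>t\<close> layers is thin, and that layer is the cut.\<close>
  define D where "D j = {(v, i). v \<in> V \<and> i < k \<and>
    (\<exists>T\<subseteq>V. connected_set E T \<and> v \<in> T \<and> card T \<le> j \<and> (\<forall>l\<le>i. T \<inter> A l \<noteq> {}))}" for j
  have DI: "(v, i) \<in> D j" if "T \<subseteq> V" "connected_set E T" "v \<in> T" "card T \<le> j" "i < k"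
      "\<And>l. l \<le> i \<Longrightarrow> T \<inter> A l \<noteq> {}" for v i j T
    unfolding D_def using that by blast
  have DE: "\<exists>T\<subseteq>V. connected_set E T \<and> v \<in> T \<and> card T \<le> j \<and> (\<forall>l\<le>i. T \<inter> A l \<noteq> {})"
    and Din: "v \<in> V" "i < k" if "(v, i) \<in> D j" for v i j
    using that unfolding D_def by blast+
  have mono: "D i \<subseteq> D j" if "i \<le> j" for i j
    unfolding D_def using that by (auto dest: order_trans)
  have "D 0 = {}"
  proof -
    have "T = {}" if "T \<subseteq> V" "card T \<le> 0" for T
      using that finite_subset[OF _ \<open>finite V\<close>] by simp
    then show ?thesis unfolding D_def by blast
  qed
  \<comment> \<open>Moving along an edge adds one vertex to the connected set and so costs one step;
    collecting the next set, in \<open>up\<close>, is free.\<close>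
  have step: "(w, i) \<in> D (Suc j)" if vi: "(v, i) \<in> D j" and w: "(v, w) \<in> E" "w \<in> V" for v w i j
  proof -
    obtain T where T: "T \<subseteq> V" "connected_set E T" "v \<in> T" "card T \<le> j" "\<forall>l\<le>i. T \<inter> A l \<noteq> {}"
      using DE[OF vi] by blast
    have "connected_set E (T \<union> {w})"
      using T w by (intro connected_set_Un[OF \<open>sym E\<close>, of _ _ v w]) (auto simp: connected_set_def)
    moreover have "card (T \<union> {w}) \<le> Suc j"
      using T(4) card_Un_le[of T "{w}"] by simp
    ultimately show ?thesis
      using T w Din(2)[OF vi] by (intro DI[of "T \<union> {w}"]) auto
  qed
  have up: "(v, Suc i) \<in> D j" if vi: "(v, i) \<in> D j" and "v \<in> A (Suc i)" "Suc i < k" for v i j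
  proof -
    obtain T where T: "T \<subseteq> V" "connected_set E T" "v \<in> T" "card T \<le> j" "\<forall>l\<le>i. T \<inter> A l \<noteq> {}"
      using DE[OF vi] by blast
    show ?thesis using T that by (intro DI[of T]) (auto simp: le_Suc_eq)
  qed
  \<comment> \<open>A pair with index \<open>k - 1\<close> would come from a connector of at most
    \<open>t\<close> vertices. So all layers together fit into \<open>k - 1\<close> copies of
    \<open>V\<close>.\<close>
  have Dt: "D t \<subseteq> V \<times> {..<k - 1}"
  proof
    fix x assume "x \<in> D t"
    then obtain v i where x: "x = (v, i)" "(v, i) \<in> D t" by (cases x) auto
    have "i \<noteq> k - 1"
    proof
      assume i: "i = k - 1"
      obtain T where T: "T \<subseteq> V" "connected_set E T" "card T \<le> t" "\<forall>l\<le>i. T \<inter> A l \<noteq> {}"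
        using DE[OF x(2)] by blast
      have "\<forall>l<k. T \<inter> A l \<noteq> {}" using T(4) i by simp
      with no T show False by blast
    qed
    then show "x \<in> V \<times> {..<k - 1}" using Din[OF x(2)] x by auto
  qed
  have fin: "finite (D t)" using Dt \<open>finite V\<close> by (rule finite_subset[OF _ finite_cartesian_product]) simp
  define L where "L j = D (Suc j) - D j" for j
  have "disjoint_family_on L {..<t}"
    unfolding disjoint_family_on_def
  proof (intro ballI impI)
    have "L i \<inter> L j = {}" if "i < j" for i j
      using mono[of "Suc i" j] that unfolding L_def by auto
    then show "L i \<inter> L j = {}" if "i \<noteq> j" for i j
      using that by (metis inf_commute nat_neq_iff)
  qed
  moreover have finL: "finite (L j)" if "j < t" for j
    using mono[of "Suc j" t] that fin unfolding L_def by (auto intro: finite_subset)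
  moreover have LD: "L j \<subseteq> D t" if "j < t" for j using mono[of "Suc j" t] that unfolding L_def by auto
  ultimately have "(\<Sum>j<t. card (L j)) = card (\<Union>j<t. L j)"
    using fin by (intro card_UN_disjoint[symmetric]) (auto simp: disjoint_family_on_def)
  also have "\<dots> \<le> card (D t)" using fin LD by (intro card_mono) auto
  also have "\<dots> \<le> card (V \<times> {..<k - 1})" using Dt \<open>finite V\<close> by (intro card_mono) auto
  finally have sum: "(\<Sum>j<t. card (L j)) \<le> (k - 1) * card V" by (simp add: card_cartesian_product mult.commute)
  have "\<exists>j<t. t * card (L j) \<le> (k - 1) * card V"
  proof (rule ccontr)
    assume *: "\<not> ?thesis"
    have "(\<Sum>j<t. (k - 1) * card V) < (\<Sum>j<t. t * card (L j))"
      using * \<open>1 \<le> t\<close> by (intro sum_strict_mono) (auto simp: lessThan_empty_iff)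
    also have "\<dots> = t * (\<Sum>j<t. card (L j))" by (simp add: sum_distrib_left)
    also have "\<dots> \<le> t * ((k - 1) * card V)" using sum by simp
    finally show False by simp
  qed
  then obtain j where j: "j < t" "t * card (L j) \<le> (k - 1) * card V" by blast
  show "\<exists>Z\<subseteq>V. t * card Z \<le> (k - 1) * card V \<and>
       (\<forall>F\<subseteq>V - Z. connected_set E F \<longrightarrow> (\<exists>i<k. F \<inter> A i = {}))"
  proof (intro exI[of _ "fst ` L j"] conjI allI impI)
    show "fst ` L j \<subseteq> V" using LD[OF j(1)] Dt by auto
    have "card (fst ` L j) \<le> card (L j)"
      using LD[OF j(1)] fin by (intro card_image_le) (rule finite_subset)
    then show "t * card (fst ` L j) \<le> (k - 1) * card V" using j by (meson mult_le_mono2 order_trans)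
    fix F assume F: "F \<subseteq> V - fst ` L j" and conn: "connected_set E F"
    show "\<exists>i<k. F \<inter> A i = {}"
    proof (rule ccontr)
      assume "\<not> ?thesis"
      then have meets: "\<And>i. i < k \<Longrightarrow> F \<inter> A i \<noteq> {}" by blast
      \<comment> \<open>As \<open>F\<close> avoids layer \<open>j\<close>, no pair over
        \<open>F\<close> is new at step \<open>j + 1\<close>. Hence membership in \<open>D j\<close>
        spreads over all of \<open>F\<close>, and \<open>F\<close> collects every \<open>A i\<close>
        within \<open>D j\<close>, up to the excluded index \<open>k - 1\<close>.\<close>
      have stay: "(v, i) \<in> D j" if "v \<in> F" "(v, i) \<in> D (Suc j)" for v i
        using that F unfolding L_def by force
      have spread: "(w, i) \<in> D j" if "v \<in> F" "w \<in> F" "(v, i) \<in> D j" for v w i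
      proof -
        have "(v, w) \<in> linked E F" using conn that by (auto simp: connected_set_def)
        have "w \<in> {x. (x, i) \<in> D j}"
        proof (rule linked_closed[OF \<open>(v, w) \<in> linked E F\<close>, THEN conjunct1])
          show "v \<in> {x. (x, i) \<in> D j}" using that by simp
          fix x y assume "x \<in> {x. (x, i) \<in> D j}" "x \<in> F" "y \<in> F" "(x, y) \<in> E"
          then show "y \<in> {x. (x, i) \<in> D j}" using step[of x i j y] stay[of y i] F by auto
        qed
        then show ?thesis by simp
      qed
      have all: "\<forall>v\<in>F. (v, i) \<in> D j" if "i < k" for i
        using that
      proof (induction i)
        case 0
        obtain a where a: "a \<in> F" "a \<in> A 0" using meets[OF 0] by blast
        have "(a, 0) \<in> D (Suc j)"
          using a F 0 by (intro DI[of "{a}"]) (auto simp: connected_set_def)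
        then show ?case using stay spread a by blast
      next
        case (Suc i)
        obtain a where a: "a \<in> F" "a \<in> A (Suc i)" using meets[OF Suc.prems] by blast
        have "(a, i) \<in> D j" using Suc a by simp
        then have "(a, Suc i) \<in> D j" using up a(2) Suc.prems by blast
        then show ?case using spread[OF a(1)] by blast
      qed
      obtain a where "a \<in> F" using meets[of 0] \<open>1 \<le> k\<close> by auto
      then have "(a, k - 1) \<in> D t" using all[of "k - 1"] \<open>1 \<le> k\<close> mono[of j t] j by auto
      then show False using Dt by auto
    qed
  qed
qed


text \<open>A choice of such a set for every small \<open>X\<close> is known as a haven. Closure
  under edges replaces \<open>component_of\<close>, so there is no distinguished root, and the same
  \<open>B\<close> can be shown to be big for different \<open>X\<close>.\<close>

definition big_component :: "('a \<times> 'a) set \<Rightarrow> 'a set \<Rightarrow> 'a set \<Rightarrow> 'a set \<Rightarrow> bool" where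
  "big_component E V X B \<longleftrightarrow> B \<subseteq> V - X \<and> connected_set E B \<and>
     (\<forall>x\<in>B. \<forall>y\<in>V - X. (x, y) \<in> E \<longrightarrow> y \<in> B) \<and> card V < 2 * card B"

lemma connected_set_closed:
  assumes "connected_set E F" "x \<in> F" "x \<in> Q"
    and "\<And>x y. x \<in> Q \<Longrightarrow> x \<in> F \<Longrightarrow> y \<in> F \<Longrightarrow> (x, y) \<in> E \<Longrightarrow> y \<in> Q"
  shows "F \<subseteq> Q"
  using linked_closed[of x _ E F Q] assms unfolding connected_set_def by blast

text \<open>Two sets with more than half of the vertices meet, and a connected set that avoids
  \<open>X\<close> and meets \<open>B\<close> stays inside \<open>B\<close>.\<close>

lemma big_component_antimono:
  assumes "finite V" "big_component E V X B" "big_component E V Y B'" "X \<subseteq> Y"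
  shows "B' \<subseteq> B"
proof -
  have sub: "B \<subseteq> V" "B' \<subseteq> V - Y" using assms unfolding big_component_def by blast+
  then have fin: "finite B" "finite B'" using \<open>finite V\<close> by (auto intro: finite_subset)
  have "B \<inter> B' \<noteq> {}"
  proof
    assume "B \<inter> B' = {}"
    then have "card B + card B' = card (B \<union> B')" using fin by (simp add: card_Un_disjoint)
    also have "\<dots> \<le> card V" using sub \<open>finite V\<close> by (intro card_mono) auto
    finally show False using assms(2,3) unfolding big_component_def by linarith
  qed
  then obtain x where x: "x \<in> B" "x \<in> B'" by blast
  have "connected_set E B'" using assms(3) unfolding big_component_def by blast
  moreover have "y \<in> B" if "x \<in> B" "y \<in> B'" "(x, y) \<in> E" for x y
    using assms(2,4) sub that unfolding big_component_def by blast
  ultimately show ?thesis using x connected_set_closed[of E B' x B] by blast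
qed

text \<open>
  Otherwise every small \<open>X\<close> leaves a component \<open>B\<close> with more than half of the vertices. Consider
  disjoint, connected, pairwise adjacent sets outside \<open>B\<close> that contain \<open>X\<close>, each of them only a
  small part of it, and make \<open>B\<close> and then their number minimal. If one of the sets does not touch
  \<open>B\<close>, it can be dropped. If a small connected subset of \<open>B\<close> touches all of them, it can be added.
  If a small cut \<open>Z\<close> shields the big component of \<open>B - Z\<close> from one of them, that set can be extended
  into \<open>B\<close> up to \<open>Z\<close>. So the process only stops with \<open>h\<close> sets, the branch sets of a clique minor.
\<close>

theorem clique_minor_free_separator:
  assumes "finite V" "sym E" and no: "\<not> has_clique_minor E V h" and t: "card V \<le> t * t"
  shows "\<exists>Z\<subseteq>V. card Z \<le> h * (h * t) \<and> (\<forall>v\<in>V - Z. 2 * card (component_of E (V - Z) v) \<le> card V)"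
proof (rule ccontr)
  assume no_sep: "\<not> ?thesis"
  have ex_big: "\<exists>B. big_component E V X B" if "X \<subseteq> V" "card X \<le> h * (h * t)" for X
  proof -
    have "\<not> (\<forall>v\<in>V - X. 2 * card (component_of E (V - X) v) \<le> card V)" using no_sep that by blast
    then obtain v where v: "v \<in> V - X" "card V < 2 * card (component_of E (V - X) v)"
      by (auto simp: not_le)
    have "big_component E V X (component_of E (V - X) v)"
      unfolding big_component_def
      using v component_of_subset[of v "V - X" E] connected_component_of[OF \<open>sym E\<close> v(1)]
        component_of_closed[of _ E "V - X" v] by blast
    then show ?thesis by blast
  qed
  have "h \<noteq> 0"
  proof
    assume "h = 0"
    then have "has_clique_minor E V h"
      unfolding has_clique_minor_def clique_model_def by (intro exI[of _ "{}"]) simp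
    with no show False by blast
  qed
  have "1 \<le> t"
  proof (rule ccontr)
    assume "\<not> 1 \<le> t"
    then have "t = 0" by simp
    then have "V = {}" using t \<open>finite V\<close> by simp
    with ex_big[of "{}"] show False by (auto simp: big_component_def)
  qed
  define state where "state \<C> X B \<longleftrightarrow> finite \<C> \<and> clique_model E V \<C> \<and> card \<C> \<le> h \<and> X \<subseteq> \<Union>\<C> \<and>
    (\<forall>C\<in>\<C>. card (X \<inter> C) \<le> h * t) \<and> big_component E V X B \<and> B \<inter> \<Union>\<C> = {}" for \<C> X B
  have stateI: "state \<C> X B" if "finite \<C>" "clique_model E V \<C>" "card \<C> \<le> h" "X \<subseteq> \<Union>\<C>"
    "\<And>C. C \<in> \<C> \<Longrightarrow> card (X \<inter> C) \<le> h * t" "big_component E V X B" "B \<inter> \<Union>\<C> = {}" for \<C> X B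
    unfolding state_def using that by blast
  have False if "state \<C> X B" for \<C> X B
    using that
  proof (induction "(card B, card \<C>)" arbitrary: \<C> X B
      rule: wf_induct_rule[OF wf_lex_prod[OF wf_less_than wf_less_than]])
    case 1
    have IH: False if "state \<C>' X' B'" "card B' < card B \<or> card B' = card B \<and> card \<C>' < card \<C>" for \<C>' X' B'
      using 1(1)[OF _ that(1)] that(2) by simp
    have st: "finite \<C>" "card \<C> \<le> h" "X \<subseteq> \<Union>\<C>" "B \<inter> \<Union>\<C> = {}"
      "clique_model E V \<C>" and big: "big_component E V X B"
      and XC: "\<And>C. C \<in> \<C> \<Longrightarrow> card (X \<inter> C) \<le> h * t"
      using 1(2) unfolding state_def by blast+
    have ne: "C \<noteq> {}" "C \<subseteq> V" "connected_set E C" if "C \<in> \<C>" for C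
      using st(5) that unfolding clique_model_def by blast+
    have disj: "C \<inter> D = {}" if "C \<in> \<C>" "D \<in> \<C>" "C \<noteq> D" for C D
      using st(5) that unfolding clique_model_def by blast
    have adj: "\<exists>x\<in>C. \<exists>y\<in>D. (x, y) \<in> E" if "C \<in> \<C>" "D \<in> \<C>" "C \<noteq> D" for C D
      using st(5) that unfolding clique_model_def by blast
    have B: "B \<subseteq> V - X" "connected_set E B" "card V < 2 * card B"
      and Bcl: "\<And>x y. x \<in> B \<Longrightarrow> y \<in> V - X \<Longrightarrow> (x, y) \<in> E \<Longrightarrow> y \<in> B"
      using big unfolding big_component_def by blast+
    have XV: "X \<subseteq> V" using st(3) ne(2) by blast
    have finB: "finite B" and finX: "finite X"
      using B(1) XV \<open>finite V\<close> by (auto intro: finite_subset)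
    have "card \<C> \<noteq> h" using no st unfolding has_clique_minor_def by blast
    then have k: "card \<C> + 1 \<le> h" using st(2) by simp
    have cardX: "card X \<le> card \<C> * (h * t)"
    proof -
      have "X = (\<Union>C\<in>\<C>. X \<inter> C)" using st(3) by blast
      then have "card X \<le> (\<Sum>C\<in>\<C>. card (X \<inter> C))" using card_UN_le[OF st(1)] by metis
      also have "\<dots> \<le> (\<Sum>C\<in>\<C>. h * t)" using XC by (intro sum_mono)
      finally show ?thesis by simp
    qed
    \<comment> \<open>Fewer than \<open>h\<close> branch sets hold at most \<open>h * t\<close>
      vertices of \<open>X\<close> each, so \<open>X\<close> can still take in \<open>h * t\<close>
      vertices, a whole connector or cut, and leave a big component.\<close>
    have room: "Y \<le> h * t \<Longrightarrow> card X + Y \<le> h * (h * t)" for Y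
    proof -
      assume "Y \<le> h * t"
      then have "card X + Y \<le> (card \<C> + 1) * (h * t)" using cardX by simp
      also have "\<dots> \<le> h * (h * t)" using k by (intro mult_le_mono1)
      finally show ?thesis .
    qed
    \<comment> \<open>The new branch set \<open>T\<close> is also added to \<open>X\<close>. This
      expels it from the big component, so \<open>B\<close> strictly shrinks, which outweighs the
      larger number of branch sets.\<close>
    have grow: "False" if T: "T \<subseteq> B" "T \<noteq> {}" "connected_set E T" "card T \<le> t"
      and meets: "\<And>C. C \<in> \<C> \<Longrightarrow> \<exists>x\<in>T. \<exists>y\<in>C. (x, y) \<in> E" for T
    proof -
      have Tdisj: "T \<inter> C = {}" if "C \<in> \<C>" for C using T(1) st(4) that by blast
      have "card T \<le> h * t" using T(4) \<open>h \<noteq> 0\<close> by (cases h) auto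
      have "card (X \<union> T) \<le> h * (h * t)"
        using room[OF \<open>card T \<le> h * t\<close>] card_Un_le[of X T] by linarith
      moreover have "X \<union> T \<subseteq> V" using XV T(1) B(1) by blast
      ultimately obtain B' where B': "big_component E V (X \<union> T) B'" using ex_big by blast
      have "B' \<subseteq> B" using big_component_antimono[OF \<open>finite V\<close> big B'] by blast
      moreover have "B' \<inter> T = {}" using B' unfolding big_component_def by blast
      ultimately have "B' \<subset> B" using T(1,2) by blast
      then have "card B' < card B" using finB by (intro psubset_card_mono) auto
      moreover have "state (insert T \<C>) (X \<union> T) B'"
      proof (rule stateI)
        show "clique_model E V (insert T \<C>)"
          unfolding clique_model_def
        proof (intro conjI ballI impI)
          fix C assume C: "C \<in> insert T \<C>"
          have "T \<subseteq> V" using T(1) B(1) by blast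
          then show "C \<noteq> {}" "C \<subseteq> V" "connected_set E C" using C T(2,3) ne by blast+
          fix D assume D: "D \<in> insert T \<C>" "C \<noteq> D"
          show "C \<inter> D = {}" using C D Tdisj disj by blast
          have "\<exists>x\<in>C. \<exists>y\<in>T. (x, y) \<in> E" if "C \<in> \<C>" for C
            using meets[OF that] symD[OF \<open>sym E\<close>] by blast
          then show "\<exists>x\<in>C. \<exists>y\<in>D. (x, y) \<in> E" using C D adj meets by auto
        qed
        show "card (insert T \<C>) \<le> h" using k st(1) by (simp add: card_insert_if)
        fix C assume "C \<in> insert T \<C>"
        then consider "C = T" | "C \<in> \<C>" by blast
        then show "card ((X \<union> T) \<inter> C) \<le> h * t"
        proof cases
          case 1
          then have "(X \<union> T) \<inter> C = T" by blast
          then show ?thesis using \<open>card T \<le> h * t\<close> by simp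
        next
          case 2
          then have "(X \<union> T) \<inter> C = X \<inter> C" using Tdisj by blast
          then show ?thesis using XC[OF 2] by simp
        qed
      qed (use st B' \<open>B' \<subseteq> B\<close> \<open>B' \<inter> T = {}\<close> in auto)
      ultimately show False using IH by blast
    qed
    show False
    proof (cases "\<exists>C\<in>\<C>. \<forall>x\<in>B. \<forall>y\<in>C. (x, y) \<notin> E")
      case True
      then obtain C where C: "C \<in> \<C>" and nadj: "\<And>x y. x \<in> B \<Longrightarrow> y \<in> C \<Longrightarrow> (x, y) \<notin> E" by blast
      \<comment> \<open>Without edges between \<open>B\<close> and \<open>C\<close>, the vertices of
        \<open>C\<close> can leave \<open>X\<close>, and \<open>B\<close> is still closed under
        edges.\<close>
      have "state (\<C> - {C}) (X - C) B"
      proof (rule stateI)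
        show "clique_model E V (\<C> - {C})" using st(5) unfolding clique_model_def by blast
        show "X - C \<subseteq> \<Union>(\<C> - {C})" using st(3) by blast
        show "B \<inter> \<Union>(\<C> - {C}) = {}" using st(4) by blast
        show "big_component E V (X - C) B"
          unfolding big_component_def using B Bcl nadj by blast
        show "card ((X - C) \<inter> D) \<le> h * t" if "D \<in> \<C> - {C}" for D
        proof -
          have "(X - C) \<inter> D = X \<inter> D" using disj[OF C, of D] that by blast
          then show ?thesis using XC that by simp
        qed
      qed (use st in \<open>auto intro: order_trans[OF card_mono[OF st(1)]]\<close>)
      moreover have "card (\<C> - {C}) < card \<C>" using C st(1) by (rule card_Diff1_less[rotated])
      ultimately show False using IH by blast
    next
      case False
      then have touch: "\<exists>x\<in>B. \<exists>y\<in>C. (x, y) \<in> E" if "C \<in> \<C>" for C using that by blast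
      show False
      proof (cases "\<C> = {}")
        case True
        have "B \<noteq> {}" using B(3) by auto
        then obtain b where "b \<in> B" by blast
        then show False
          using True \<open>1 \<le> t\<close> by (intro grow[of "{b}"]) (auto simp: connected_set_def)
      next
        case False
        then have "1 \<le> card \<C>" using st(1) by (simp add: Suc_leI card_gt_0_iff)
        obtain c where c: "bij_betw c {..<card \<C>} \<C>"
          using ex_bij_betw_nat_finite[OF st(1)] by (auto simp: atLeast0LessThan)
        then have c_in: "c i \<in> \<C>" if "i < card \<C>" for i using that by (auto simp: bij_betw_def)
        have c_surj: "\<exists>i<card \<C>. c i = C" if "C \<in> \<C>" for C
        proof -
          have "C \<in> c ` {..<card \<C>}" using that bij_betw_imp_surj_on[OF c] by simp
          then show ?thesis by blast
        qed
        define A where "A i = {x \<in> B. \<exists>y\<in>c i. (x, y) \<in> E}" for i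
        from small_connector_or_cut[OF finB \<open>sym E\<close> \<open>1 \<le> card \<C>\<close> \<open>1 \<le> t\<close>, of A]
        show False
        proof (elim disjE exE conjE)
          fix T assume T: "T \<subseteq> B" "connected_set E T" "card T \<le> t" "\<forall>i<card \<C>. T \<inter> A i \<noteq> {}"
          show False
          proof (rule grow[OF T(1) _ T(2,3)])
            have "0 < card \<C>" using \<open>1 \<le> card \<C>\<close> by simp
            then show "T \<noteq> {}" using T(4) by blast
            fix C assume "C \<in> \<C>"
            then obtain i where "i < card \<C>" "c i = C" using c_surj by blast
            then show "\<exists>x\<in>T. \<exists>y\<in>C. (x, y) \<in> E" using T(4) unfolding A_def by blast
          qed
        next
          fix Z assume Z: "Z \<subseteq> B" "t * card Z \<le> (card \<C> - 1) * card B"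
            "\<forall>F\<subseteq>B - Z. connected_set E F \<longrightarrow> (\<exists>i<card \<C>. F \<inter> A i = {})"
          have "t * card Z \<le> h * (t * t)"
          proof -
            have "card B \<le> t * t" using B(1) \<open>finite V\<close> t by (meson Diff_subset card_mono order_trans)
            then have "(card \<C> - 1) * card B \<le> h * (t * t)" using k by (intro mult_le_mono) auto
            then show ?thesis using Z(2) by linarith
          qed
          then have "t * card Z \<le> t * (h * t)" by (simp add: algebra_simps)
          then have cardZ: "card Z \<le> h * t" using \<open>1 \<le> t\<close> by simp
          have "card (X \<union> Z) \<le> h * (h * t)"
            using room[OF cardZ] card_Un_le[of X Z] by linarith
          moreover have XZ: "X \<union> Z \<subseteq> V" using XV Z(1) B(1) by blast
          ultimately obtain F where F: "big_component E V (X \<union> Z) F" using ex_big by blast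
          have FB: "F \<subseteq> B" using big_component_antimono[OF \<open>finite V\<close> big F] by blast
          have Fsub: "F \<subseteq> V - (X \<union> Z)" "connected_set E F" "card V < 2 * card F"
            and Fcl: "\<And>x y. x \<in> F \<Longrightarrow> y \<in> V - (X \<union> Z) \<Longrightarrow> (x, y) \<in> E \<Longrightarrow> y \<in> F"
            using F unfolding big_component_def by blast+
          have "F \<subseteq> B - Z" using FB Fsub by blast
          then obtain i where i: "i < card \<C>" "F \<inter> A i = {}" using Z(3) Fsub(2) by blast
          define C where "C = c i"
          have C: "C \<in> \<C>" using c_in[OF i(1)] by (simp add: C_def)
          define N where "N = {x \<in> B. \<exists>y\<in>C. (x, y) \<in> E}"
          have FN: "F \<inter> N = {}" using i(2) by (simp add: A_def N_def C_def)
          have "N \<noteq> {}" using touch[OF C] by (auto simp: N_def)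
          \<comment> \<open>\<open>M\<close> is what \<open>C\<close> can reach inside
            \<open>B\<close> without entering \<open>F\<close>. Absorbing it extends the branch set
            up to the cut, and \<open>F\<close> remains untouched.\<close>
          define M where "M = (\<Union>a\<in>N. component_of E (B - F) a)"
          have NBF: "N \<subseteq> B - F" using FN by (auto simp: N_def)
          have MBF: "M \<subseteq> B - F" using component_of_subset[of _ "B - F" E] NBF unfolding M_def by blast
          have NM: "N \<subseteq> M" by (auto simp: M_def)
          have Mcl: "y \<in> M" if "x \<in> M" "y \<in> B - F" "(x, y) \<in> E" for x y
            using that component_of_closed[of x E "B - F" _ y] MBF unfolding M_def by blast
          have CB: "C \<inter> B = {}" using st(4) C by blast
          define C' where "C' = C \<union> M"
          have conn: "connected_set E C'"
          proof -
            obtain r where r: "r \<in> C" using ne[OF C] by blast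
            show ?thesis
            proof (rule connected_setI[OF \<open>sym E\<close>, of _ r])
              fix v assume "v \<in> C'"
              then consider "v \<in> C" | a where "a \<in> N" "v \<in> component_of E (B - F) a"
                unfolding C'_def M_def by blast
              then show "(r, v) \<in> linked E C'"
              proof cases
                case 1
                then show ?thesis using ne(3)[OF C] r linked_mono[of C C']
                  unfolding connected_set_def C'_def by blast
              next
                case 2
                then obtain y where y: "y \<in> C" "(a, y) \<in> E" unfolding N_def by blast
                have "(r, y) \<in> linked E C'" using ne(3)[OF C] r y linked_mono[of C C']
                  unfolding connected_set_def C'_def by blast
                moreover have "(y, a) \<in> linked E C'"
                  using y 2 NM symD[OF \<open>sym E\<close>] by (intro linked_edge) (auto simp: C'_def)
                moreover have "(a, v) \<in> linked E C'"
                proof -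
                  have "component_of E (B - F) a \<subseteq> C'" using 2 unfolding C'_def M_def by blast
                  moreover have "(a, v) \<in> linked E (component_of E (B - F) a)"
                    using connected_component_of[OF \<open>sym E\<close>, of a "B - F"] 2 NBF
                    unfolding connected_set_def by auto
                  ultimately show ?thesis by (rule linked_mono)
                qed
                ultimately show ?thesis by (meson linked_trans)
              qed
            qed
          qed
          \<comment> \<open>The part of \<open>X\<close> in \<open>C\<close> is exchanged for
            \<open>Z \<inter> M\<close>, which now shields \<open>F\<close> from the extended branch
            set. Thus \<open>C'\<close> contains only vertices of \<open>Z\<close> from
            \<open>X'\<close>, at most \<open>h * t\<close> of them.\<close>
          define X' where "X' = (X - C) \<union> (Z \<inter> M)"
          have X'sub: "X' \<subseteq> X \<union> Z" by (auto simp: X'_def)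
          then have "card X' \<le> card (X \<union> Z)"
            using XZ \<open>finite V\<close> by (meson card_mono finite_subset)
          then have "card X' \<le> h * (h * t)" using \<open>card (X \<union> Z) \<le> h * (h * t)\<close> by linarith
          then obtain B' where B': "big_component E V X' B'" using ex_big[of X'] X'sub XZ by blast
          have B'sub: "B' \<subseteq> V - X'" "connected_set E B'" using B' unfolding big_component_def by blast+
          have "F \<subseteq> B'" using big_component_antimono[OF \<open>finite V\<close> B' F X'sub] .
          obtain f where f: "f \<in> F" using Fsub(3) by fastforce
          \<comment> \<open>Starting in \<open>F\<close>, an edge of \<open>B'\<close> cannot leave
            \<open>B - M\<close>. It does not lead to \<open>C\<close>, since all neighbours of
            \<open>C\<close> in \<open>B\<close> are in \<open>M\<close>; it then stays in
            \<open>B\<close>. If it led into \<open>M\<close>, it would either come from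
            \<open>F\<close> and end in \<open>Z \<inter> M\<close>, a part of \<open>X'\<close>, or
            start in \<open>M\<close> itself.\<close>
          have B'Q: "B' \<subseteq> B - M"
          proof (rule connected_set_closed[OF B'sub(2), of f])
            show "f \<in> B'" using f \<open>F \<subseteq> B'\<close> by blast
            show "f \<in> B - M" using f FB MBF by blast
            fix x y assume x: "x \<in> B - M" and y: "y \<in> B'" and xy: "(x, y) \<in> E"
            have yV: "y \<in> V" "y \<notin> X'" using y B'sub by blast+
            have "y \<notin> C" using x xy NM by (auto simp: N_def)
            then have "y \<notin> X" using yV by (auto simp: X'_def)
            then have "y \<in> B" using Bcl[OF _ _ xy] x yV by blast
            moreover have "y \<notin> M"
            proof
              assume yM: "y \<in> M"
              show False
              proof (cases "x \<in> F")
                case True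
                have "y \<notin> F" using yM MBF by blast
                then have "y \<in> Z" using Fcl[OF True _ xy] yV \<open>y \<notin> X\<close> by blast
                then show False using yM yV(2) by (auto simp: X'_def)
              next
                case False
                then have "x \<in> M" using Mcl[OF yM, of x] x symD[OF \<open>sym E\<close> xy] by blast
                then show False using x by blast
              qed
            qed
            ultimately show "y \<in> B - M" by blast
          qed
          have "B' \<subset> B" using B'Q NM \<open>N \<noteq> {}\<close> NBF by blast
          then have less: "card B' < card B" using finB by (intro psubset_card_mono) auto
          have C'disj: "C' \<inter> D = {}" if "D \<in> \<C>" "D \<noteq> C" for D
            using that disj[OF C that(1)] MBF st(4) unfolding C'_def by blast
          have C'adj: "\<exists>x\<in>C'. \<exists>y\<in>D. (x, y) \<in> E" "\<exists>x\<in>D. \<exists>y\<in>C'. (x, y) \<in> E"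
            if "D \<in> \<C>" "D \<noteq> C" for D
            using adj[OF C that(1)] adj[OF that(1) C] that(2) unfolding C'_def by blast+
          have "state (insert C' (\<C> - {C})) X' B'"
          proof (rule stateI)
            show "clique_model E V (insert C' (\<C> - {C}))"
              unfolding clique_model_def
            proof (intro conjI ballI impI)
              fix D assume D: "D \<in> insert C' (\<C> - {C})"
              show "D \<noteq> {}" "D \<subseteq> V" "connected_set E D"
                using D ne C MBF B(1) conn by (auto simp: C'_def)
              fix D' assume D': "D' \<in> insert C' (\<C> - {C})" "D \<noteq> D'"
              show "D \<inter> D' = {}" using D D' C'disj disj by blast
              show "\<exists>x\<in>D. \<exists>y\<in>D'. (x, y) \<in> E" using D D' C'adj adj by auto
            qed
            have "card (insert C' (\<C> - {C})) \<le> Suc (card (\<C> - {C}))" using st(1) by (simp add: card_insert_if)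
            also have "\<dots> = card \<C>" using st(1) C by (rule card_Suc_Diff1)
            finally show "card (insert C' (\<C> - {C})) \<le> h" using st(2) by linarith
            show "X' \<subseteq> \<Union>(insert C' (\<C> - {C}))" using st(3) unfolding X'_def C'_def by blast
            show "B' \<inter> \<Union>(insert C' (\<C> - {C})) = {}" using B'Q st(4) CB unfolding C'_def by blast
            fix D assume "D \<in> insert C' (\<C> - {C})"
            then consider "D = C'" | "D \<in> \<C>" "D \<noteq> C" by blast
            then show "card (X' \<inter> D) \<le> h * t"
            proof cases
              case 1
              have "X' \<inter> D \<subseteq> Z" using 1 MBF B(1) unfolding X'_def C'_def by blast
              then have "card (X' \<inter> D) \<le> card Z"
                using Z(1) finB by (meson card_mono finite_subset)
              then show ?thesis using cardZ by linarith
            next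
              case 2
              have "X' \<inter> D \<subseteq> X \<inter> D" using 2 C'disj[OF 2] unfolding X'_def C'_def by blast
              then have "card (X' \<inter> D) \<le> card (X \<inter> D)"
                using finX by (intro card_mono) auto
              then show ?thesis using XC[OF 2(1)] by linarith
            qed
          qed (use st B' in auto)
          then show False using IH less by blast
        qed
      qed
    qed
  qed
  moreover obtain B where "big_component E V {} B" using ex_big[of "{}"] by auto
  then have "state {} {} B" by (intro stateI) (auto simp: clique_model_def)
  ultimately show False by blast
qed

section \<open>Divisions\<close>

text \<open>Take a largest union \<open>P\<close> of components with at most 2/3 of the vertices. If
  the rest \<open>Q\<close> exceeds 2/3, then \<open>P\<close> is below 1/3, and a component
  \<open>D\<close> of the rest that cannot be added to \<open>P\<close> exceeds 1/3. As
  \<open>D\<close> has at most half of the vertices, \<open>D\<close> alone is one side and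
  everything else the other.\<close>

lemma balanced_partition:
  assumes "finite W" "sym E" "Z \<subseteq> W"
    and comp: "\<And>v. v \<in> W - Z \<Longrightarrow> 2 * card (component_of E (W - Z) v) \<le> card W"
  shows "\<exists>P Q. P \<union> Q = W - Z \<and> P \<inter> Q = {} \<and> (\<forall>x\<in>P. \<forall>y\<in>Q. (x, y) \<notin> E) \<and>
    3 * card P \<le> 2 * card W \<and> 3 * card Q \<le> 2 * card W"
proof -
  define ok where "ok P \<longleftrightarrow> P \<subseteq> W - Z \<and> (\<forall>x\<in>P. \<forall>y\<in>W - Z. (x, y) \<in> E \<longrightarrow> y \<in> P) \<and>
    3 * card P \<le> 2 * card W" for P
  have "ok {}" by (simp add: ok_def)
  moreover have "card P < Suc (card W)" if "ok P" for P
    using that \<open>finite W\<close> unfolding ok_def by (auto simp: less_Suc_eq_le intro: card_mono)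
  ultimately obtain P where P: "ok P" and max: "\<And>P'. ok P' \<Longrightarrow> card P' \<le> card P"
    using ex_has_greatest_nat[of ok "{}" card "Suc (card W)"] by blast
  define Q where "Q = W - Z - P"
  have Psub: "P \<subseteq> W - Z" and Pcl: "\<And>x y. x \<in> P \<Longrightarrow> y \<in> W - Z \<Longrightarrow> (x, y) \<in> E \<Longrightarrow> y \<in> P"
    and cardP: "3 * card P \<le> 2 * card W"
    using P unfolding ok_def by blast+
  have fin: "finite P" "finite Q" using Psub \<open>finite W\<close> by (auto simp: Q_def intro: finite_subset)
  show ?thesis
  proof (cases "3 * card Q \<le> 2 * card W")
    case True
    have "P \<union> Q = W - Z" "P \<inter> Q = {}" "\<forall>x\<in>P. \<forall>y\<in>Q. (x, y) \<notin> E"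
      using Psub Pcl by (auto simp: Q_def)
    then show ?thesis using True cardP by blast
  next
    case False
    then obtain v where v: "v \<in> Q" by fastforce
    define D where "D = component_of E (W - Z) v"
    have DQ: "D \<subseteq> Q"
    proof
      fix w assume "w \<in> D"
      then have vw: "(v, w) \<in> linked E (W - Z)" by (simp add: D_def component_of_def)
      show "w \<in> Q"
      proof (rule linked_closed[OF vw v, THEN conjunct1])
        fix x y assume "x \<in> Q" "x \<in> W - Z" "y \<in> W - Z" "(x, y) \<in> E"
        then show "y \<in> Q" using Pcl[of y x] symD[OF \<open>sym E\<close>] by (auto simp: Q_def)
      qed
    qed
    have "v \<in> W - Z" using v by (simp add: Q_def)
    have Dcl: "y \<in> D" if "x \<in> D" "y \<in> W - Z" "(x, y) \<in> E" for x y
      using that component_of_closed[of x E "W - Z" v y] component_of_subset[OF \<open>v \<in> W - Z\<close>, of E]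
      unfolding D_def by blast
    have Dsub: "D \<subseteq> W - Z" using DQ by (auto simp: Q_def)
    have "v \<in> D" by (simp add: D_def)
    have finD: "finite D" using DQ fin(2) by (rule finite_subset)
    have PD: "P \<inter> D = {}" using DQ by (auto simp: Q_def)
    have card_PD: "card (P \<union> D) = card P + card D" using fin finD PD by (intro card_Un_disjoint)
    have "card P + card Q \<le> card W"
      using card_Un_disjoint[of P Q] fin Psub card_mono[OF \<open>finite W\<close>, of "P \<union> Q"]
      by (auto simp: Q_def)
    have "card W < 3 * card D"
    proof (rule ccontr)
      assume "\<not> ?thesis"
      then have "3 * card (P \<union> D) \<le> 2 * card W"
        using card_PD \<open>card P + card Q \<le> card W\<close> False by linarith
      then have "ok (P \<union> D)" unfolding ok_def using Psub Pcl Dsub Dcl by blast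
      then have "card D = 0" using max card_PD by fastforce
      then show False using \<open>v \<in> D\<close> finD by auto
    qed
    moreover have "2 * card D \<le> card W" using comp[OF \<open>v \<in> W - Z\<close>] by (simp add: D_def)
    moreover have "card (W - Z - D) + card D \<le> card W"
    proof -
      have "card (W - Z - D) + card D = card ((W - Z - D) \<union> D)"
        using finD \<open>finite W\<close> by (intro card_Un_disjoint[symmetric]) auto
      also have "\<dots> \<le> card W" using Dsub by (intro card_mono[OF \<open>finite W\<close>]) blast
      finally show ?thesis .
    qed
    ultimately have "3 * card D \<le> 2 * card W" "3 * card (W - Z - D) \<le> 2 * card W" by linarith+
    then show ?thesis using Dsub Dcl by (intro exI[of _ D] exI[of _ "W - Z - D"]) blast
  qed
qed

text \<open>Origin of 14: the two sides exceed \<open>n\<close> by at most \<beta> * sqrt n in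
  total, and the linear term adds at most as much again because \<open>28 * \<beta> \<le> s\<close>.
  The square roots gain at least 14 * 0.15 = 2.1 times \<beta> * sqrt n, which covers both.\<close>

lemma division_recurrence:
  fixes a b n \<beta> s :: real
  assumes "0 < n" "0 < \<beta>" "28 * \<beta> \<le> s" "0 \<le> a" "0 \<le> b" "a \<le> 3 * n / 4" "b \<le> 3 * n / 4"
    and "n \<le> a + b" "a + b \<le> n + \<beta> * sqrt n"
  shows "(a + 28 * \<beta> * a / s - 14 * \<beta> * sqrt a) + (b + 28 * \<beta> * b / s - 14 * \<beta> * sqrt b)
     \<le> n + 28 * \<beta> * n / s - 14 * \<beta> * sqrt n"
proof -
  have "0 < s" using assms by linarith
  \<comment> \<open>The factor 1.15 is 2 / sqrt 3 rounded down: 1.15 * 1.15 * 3 / 4 =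
    0.991875.\<close>
  have sqrt_ge: "1.15 * x / sqrt n \<le> sqrt x" if "0 \<le> x" "x \<le> 3 * n / 4" for x
  proof (rule real_le_rsqrt)
    have "(1.15 * x / sqrt n)\<^sup>2 = 1.3225 * x / n * x"
      using \<open>0 < n\<close> by (simp add: power_divide power_mult_distrib) (simp add: power2_eq_square)
    also have "\<dots> \<le> 1 * x"
      using that \<open>0 < n\<close> by (intro mult_right_mono) (auto simp: divide_simps)
    finally show "(1.15 * x / sqrt n)\<^sup>2 \<le> x" by simp
  qed
  have "1.15 * sqrt n = 1.15 * n / sqrt n" using \<open>0 < n\<close> real_div_sqrt[of n] by (metis less_imp_le times_divide_eq_right)
  also have "\<dots> \<le> 1.15 * (a + b) / sqrt n" using assms by (intro divide_right_mono) auto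
  also have "\<dots> = 1.15 * a / sqrt n + 1.15 * b / sqrt n" by (simp add: distrib_left add_divide_distrib)
  also have "\<dots> \<le> sqrt a + sqrt b" using assms by (intro add_mono sqrt_ge) auto
  finally have "1.15 * sqrt n \<le> sqrt a + sqrt b" .
  then have 1: "\<beta> * (1.15 * sqrt n) \<le> \<beta> * (sqrt a + sqrt b)" using assms by (intro mult_left_mono) auto
  have "28 * \<beta> * (a + b) / s \<le> 28 * \<beta> * (n + \<beta> * sqrt n) / s"
    using assms \<open>0 < s\<close> by (intro divide_right_mono mult_left_mono) auto
  also have "\<dots> = 28 * \<beta> * n / s + (28 * \<beta> / s) * (\<beta> * sqrt n)"
    by (simp add: distrib_left add_divide_distrib)
  also have "\<dots> \<le> 28 * \<beta> * n / s + 1 * (\<beta> * sqrt n)"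
    using assms \<open>0 < s\<close> by (intro add_left_mono mult_right_mono) (auto simp: divide_simps)
  finally have 2: "28 * \<beta> * (a + b) / s \<le> 28 * \<beta> * n / s + \<beta> * sqrt n" by simp
  have "0 \<le> \<beta> * sqrt n" using assms by simp
  have "(a + 28 * \<beta> * a / s - 14 * \<beta> * sqrt a) + (b + 28 * \<beta> * b / s - 14 * \<beta> * sqrt b) =
     (a + b) + 28 * \<beta> * (a + b) / s - 14 * (\<beta> * (sqrt a + sqrt b))"
    by (simp add: distrib_left add_divide_distrib)
  also have "\<dots> \<le> (n + \<beta> * sqrt n) + (28 * \<beta> * n / s + \<beta> * sqrt n) - 14 * (\<beta> * (1.15 * sqrt n))"
    using 1 2 assms by linarith
  also have "\<dots> \<le> n + 28 * \<beta> * n / s - 14 * \<beta> * sqrt n" using \<open>0 \<le> \<beta> * sqrt n\<close> by simp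
  finally show ?thesis .
qed

text \<open>A vertex that lies in one piece only has all its neighbours in that piece; this is what
  confines an exchange. The pieces form a list so that sums over them count shared vertices, and
  repeated pieces, with multiplicity.\<close>

definition division :: "('a \<times> 'a) set \<Rightarrow> 'a set \<Rightarrow> 'a set list \<Rightarrow> bool" where
  "division E W Rs \<longleftrightarrow> \<Union>(set Rs) = W \<and>
     (\<forall>x\<in>W. \<forall>y\<in>W. (x, y) \<in> E \<longrightarrow> (\<exists>R\<in>set Rs. x \<in> R \<and> y \<in> R))"

definition separates :: "('a \<times> 'a) set \<Rightarrow> 'a set \<Rightarrow> real \<Rightarrow> 'a set \<Rightarrow> 'a set \<Rightarrow> 'a set \<Rightarrow> bool" where
  "separates E W \<beta> Z P Q \<longleftrightarrow> Z \<subseteq> W \<and> P \<union> Q = W - Z \<and> P \<inter> Q = {} \<and> (\<forall>x\<in>P. \<forall>y\<in>Q. (x, y) \<notin> E) \<and>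
     card Z \<le> \<beta> * sqrt (card W) \<and> 3 * card P \<le> 2 * card W \<and> 3 * card Q \<le> 2 * card W"

text \<open>
  The negative term pays for the vertices of the separators, which are counted on both sides: since
  neither side has more than \<open>3 n / 4\<close> vertices, the square roots of the two sizes add up to at
  least \<open>1.15 sqrt n\<close>.
\<close>

lemma division_exists_large:
  fixes \<beta> r :: real
  assumes "finite W" "sym E" "0 < \<beta>" "28 * \<beta> \<le> sqrt r"
    and sep: "\<And>W'. W' \<subseteq> W \<Longrightarrow> \<exists>Z P Q. separates E W' \<beta> Z P Q"
    and "r / 4 \<le> card W"
  shows "\<exists>Rs. division E W Rs \<and> (\<forall>R\<in>set Rs. card R \<le> r) \<and>
    real (sum_list (map card Rs)) \<le> card W + 28 * \<beta> * card W / sqrt r - 14 * \<beta> * sqrt (card W)"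
  using assms(1,5,6)
proof (induction "card W" arbitrary: W rule: less_induct)
  case less
  define n where "n = real (card W)"
  have "0 < sqrt r" using assms(3,4) by linarith
  then have "0 < r" by simp
  then have "0 < n" using less.prems(3) by (simp add: n_def)
  show ?case
  proof (cases "n \<le> r")
    case True
    \<comment> \<open>A single piece has no excess, so the two correction terms only have to add up
      to something nonnegative. This holds from size \<open>r / 4\<close> on, because 28 = 2 *
      14.\<close>
    have "14 * \<beta> * sqrt n \<le> 28 * \<beta> * n / sqrt r"
    proof -
      have "sqrt r \<le> sqrt (4 * n)" using less.prems(3) by (simp add: n_def)
      then have "sqrt r \<le> 2 * sqrt n" by (simp add: real_sqrt_mult)
      then have "sqrt r * sqrt n \<le> 2 * sqrt n * sqrt n" by (rule mult_right_mono) (simp add: n_def)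
      also have "\<dots> = 2 * n" using \<open>0 < n\<close> by simp
      finally have "sqrt n * sqrt r \<le> 2 * n" by (simp only: mult.commute)
      then have "sqrt n \<le> 2 * n / sqrt r" using \<open>0 < sqrt r\<close> by (simp add: field_simps)
      then have "14 * \<beta> * sqrt n \<le> 14 * \<beta> * (2 * n / sqrt r)"
        using assms(3) by (intro mult_left_mono) auto
      then show ?thesis by simp
    qed
    then show ?thesis
      using True by (intro exI[of _ "[W]"]) (auto simp: division_def n_def)
  next
    case False
    obtain Z P Q where "separates E W \<beta> Z P Q" using less.prems(2) by blast
    then have sub: "Z \<subseteq> W" "P \<union> Q = W - Z" "P \<inter> Q = {}" "\<And>x y. x \<in> P \<Longrightarrow> y \<in> Q \<Longrightarrow> (x, y) \<notin> E"
      and card: "card Z \<le> \<beta> * sqrt n" "3 * card P \<le> 2 * card W" "3 * card Q \<le> 2 * card W"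
      unfolding separates_def n_def by blast+
    have fin: "finite Z" "finite P" "finite Q"
      using sub less.prems(1) by (metis finite_subset Diff_subset finite_Un finite_Diff)+
    have cardA: "card (P \<union> Z) = card P + card Z" and cardB: "card (Q \<union> Z) = card Q + card Z"
      using fin sub by (auto intro!: card_Un_disjoint)
    have "card (P \<union> Q) + card Z = card W"
      using sub(1,2) less.prems(1) fin by (metis card_Diff_subset card_mono le_add_diff_inverse2)
    then have total: "card P + card Q + card Z = card W" using card_Un_disjoint[of P Q] fin sub by simp
    have "28 * \<beta> * sqrt n \<le> sqrt r * sqrt n" using assms(4) by (rule mult_right_mono) (use \<open>0 < n\<close> in simp)
    also have "\<dots> \<le> sqrt n * sqrt n" using False \<open>0 < n\<close> by (intro mult_right_mono) auto
    finally have "\<beta> * sqrt n \<le> n / 28" using \<open>0 < n\<close> by simp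
    then have cardZ: "real (card Z) \<le> n / 28" using card(1) by linarith
    define a where "a = real (card (P \<union> Z))"
    define b where "b = real (card (Q \<union> Z))"
    \<comment> \<open>As 2/3 + 1/28 is below 3/4, the separator can be added to either side. Both
      sides then keep at least \<open>n / 4\<close> vertices, more than \<open>r / 4\<close>, as the
      induction demands.\<close>
    have ab: "a \<le> 3 * n / 4" "b \<le> 3 * n / 4" "n \<le> a + b" "a + b \<le> n + \<beta> * sqrt n"
      using cardZ card total unfolding a_def b_def cardA cardB n_def by linarith+
    have IH: "\<exists>Rs. division E X Rs \<and> (\<forall>R\<in>set Rs. card R \<le> r) \<and>
        real (sum_list (map card Rs)) \<le> card X + 28 * \<beta> * card X / sqrt r - 14 * \<beta> * sqrt (card X)"
      if "X \<subseteq> W" "real (card X) \<le> 3 * n / 4" "n / 4 \<le> real (card X)" for X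
    proof (rule less.hyps)
      show "card X < card W" using that \<open>0 < n\<close> unfolding n_def by linarith
      show "finite X" using that less.prems(1) by (meson finite_subset)
      show "r / 4 \<le> real (card X)" using that False by linarith
    qed (use that less.prems in blast)
    obtain Rs where Rs: "division E (P \<union> Z) Rs" "\<forall>R\<in>set Rs. card R \<le> r"
        "real (sum_list (map card Rs)) \<le> a + 28 * \<beta> * a / sqrt r - 14 * \<beta> * sqrt a"
      using IH[of "P \<union> Z"] ab sub unfolding a_def b_def by auto
    obtain Rs' where Rs': "division E (Q \<union> Z) Rs'" "\<forall>R\<in>set Rs'. card R \<le> r"
        "real (sum_list (map card Rs')) \<le> b + 28 * \<beta> * b / sqrt r - 14 * \<beta> * sqrt b"
      using IH[of "Q \<union> Z"] ab sub unfolding a_def b_def by auto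
    have W: "W = (P \<union> Z) \<union> (Q \<union> Z)" using sub by blast
    have "(x \<in> P \<union> Z \<and> y \<in> P \<union> Z) \<or> (x \<in> Q \<union> Z \<and> y \<in> Q \<union> Z)"
      if "x \<in> W" "y \<in> W" "(x, y) \<in> E" for x y
      using that sub(4) W symD[OF \<open>sym E\<close>] by blast
    then have "division E W (Rs @ Rs')"
      using Rs(1) Rs'(1) W unfolding division_def by (metis Un_iff set_append Union_Un_distrib)
    moreover have "real (sum_list (map card (Rs @ Rs'))) \<le> n + 28 * \<beta> * n / sqrt r - 14 * \<beta> * sqrt n"
      using division_recurrence[of n \<beta> "sqrt r" a b] Rs(3) Rs'(3) ab assms(3,4) \<open>0 < n\<close>
      by (simp add: a_def b_def)
    ultimately show ?thesis using Rs(2) Rs'(2) unfolding n_def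
      by (intro exI[of _ "Rs @ Rs'"]) auto
  qed
qed

lemma division_exists:
  fixes \<beta> r :: real
  assumes "finite W" "sym E" "0 < \<beta>" "28 * \<beta> \<le> sqrt r"
    and sep: "\<And>W'. W' \<subseteq> W \<Longrightarrow> \<exists>Z P Q. separates E W' \<beta> Z P Q"
  shows "\<exists>Rs. division E W Rs \<and> (\<forall>R\<in>set Rs. card R \<le> r) \<and>
    real (sum_list (map card Rs)) \<le> card W + 28 * \<beta> * card W / sqrt r"
proof -
  have "0 < sqrt r" using assms(3,4) by linarith
  show ?thesis
  proof (cases "r / 4 \<le> card W")
    case True
    have "0 \<le> 14 * \<beta> * sqrt (card W)" using assms(3) by simp
    then show ?thesis using division_exists_large[OF assms True] by force
  next
    case False
    have "0 \<le> 28 * \<beta> * card W / sqrt r" using assms(3) \<open>0 < sqrt r\<close> by simp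
    moreover have "card W \<le> r" using False \<open>0 < sqrt r\<close> by simp
    ultimately show ?thesis by (intro exI[of _ "[W]"]) (auto simp: division_def)
  qed
qed

section \<open>The exchange graph\<close>

text \<open>A core of the new graph that contains both \<open>y\<close> and \<open>z\<close> becomes
  a core of \<open>E\<close> when \<open>x\<close> is put back as a subdivision of the new edge. A
  core missing one of them cannot use the new edge; this covers sets \<open>W\<close> that do not
  contain both ends.\<close>

lemma cycle_free_suppress:
  assumes "sym E" "cycle_free E W" "x \<in> W" "E `` {x} \<inter> W \<subseteq> {y, z}"
    and "(x, y) \<in> E" "(x, z) \<in> E" "y \<noteq> z"
  shows "cycle_free (E \<union> {(y, z), (z, y)}) (W - {x})"
  unfolding cycle_free_def
proof (intro allI impI notI)
  fix U assume U: "U \<subseteq> W - {x}" and core: "core (E \<union> {(y, z), (z, y)}) U"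
  have no: "\<not> core E U'" if "U' \<subseteq> W" for U' using assms(2) that by (auto simp: cycle_free_def)
  have two: "\<exists>a\<in>U. \<exists>b\<in>U. a \<noteq> b \<and> (v, a) \<in> E \<union> {(y, z), (z, y)} \<and> (v, b) \<in> E \<union> {(y, z), (z, y)}"
    if "v \<in> U" for v
    using core that unfolding core_def by blast
  have "U \<noteq> {}" using core by (simp add: core_def)
  show False
  proof (cases "y \<in> U \<and> z \<in> U")
    case True
    have "core E (insert x U)"
      unfolding core_def
    proof (intro conjI ballI)
      fix v assume "v \<in> insert x U"
      then consider "v = x" | "v \<in> U" by blast
      then show "\<exists>a\<in>insert x U. \<exists>b\<in>insert x U. a \<noteq> b \<and> (v, a) \<in> E \<and> (v, b) \<in> E"
      proof cases
        case 1
        then show ?thesis using True assms by blast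
      next
        case 2
        obtain a b where ab: "a \<in> U" "b \<in> U" "a \<noteq> b"
          "(v, a) \<in> E \<union> {(y, z), (z, y)}" "(v, b) \<in> E \<union> {(y, z), (z, y)}"
          using two[OF 2] by blast
        have sub: "x \<notin> U" using U by blast
        have xv: "(v, x) \<in> E" if "v \<in> {y, z}" using that assms symD[OF \<open>sym E\<close>] by blast
        consider "(v, a) \<in> E" "(v, b) \<in> E" | "(v, a) \<notin> E" "v \<in> {y, z}" "(v, b) \<in> E"
          | "(v, b) \<notin> E" "v \<in> {y, z}" "(v, a) \<in> E"
          using ab(3-5) by blast
        then show ?thesis
        proof cases
          case 1
          then show ?thesis using ab by blast
        next
          case 2
          moreover have "x \<noteq> b" using sub ab by blast
          ultimately show ?thesis using ab(2) xv by blast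
        next
          case 3
          moreover have "x \<noteq> a" using sub ab by blast
          ultimately show ?thesis using ab(1) xv by blast
        qed
      qed
    qed simp
    moreover have "insert x U \<subseteq> W" using U \<open>x \<in> W\<close> by blast
    ultimately show False using no by blast
  next
    case False
    have "core E U"
      unfolding core_def
    proof (intro conjI ballI)
      fix v assume "v \<in> U"
      then obtain a b where ab: "a \<in> U" "b \<in> U" "a \<noteq> b"
        "(v, a) \<in> E \<union> {(y, z), (z, y)}" "(v, b) \<in> E \<union> {(y, z), (z, y)}"
        using two by blast
      then have "(v, a) \<in> E" "(v, b) \<in> E" using False \<open>v \<in> U\<close> by blast+
      then show "\<exists>a\<in>U. \<exists>b\<in>U. a \<noteq> b \<and> (v, a) \<in> E \<and> (v, b) \<in> E" using ab by blast
    qed (use \<open>U \<noteq> {}\<close> in simp)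
    then show False using no U by blast
  qed
qed

lemma has_clique_minor_suppress:
  assumes "sym E" "x \<in> V" and x: "(x, y) \<in> E" "(x, z) \<in> E" "y \<noteq> z"
    and minor: "has_clique_minor (E \<union> {(y, z), (z, y)}) (V - {x}) h"
  shows "has_clique_minor E V h"
proof -
  let ?E = "E \<union> {(y, z), (z, y)}"
  obtain \<C> where \<C>: "finite \<C>" "card \<C> = h" and model: "clique_model ?E (V - {x}) \<C>"
    using minor unfolding has_clique_minor_def by blast
  have ne: "C \<noteq> {}" "C \<subseteq> V - {x}" "connected_set ?E C" if "C \<in> \<C>" for C
    using model that unfolding clique_model_def by blast+
  have disj: "C \<inter> D = {}" and adj: "\<exists>p\<in>C. \<exists>q\<in>D. (p, q) \<in> ?E"
    if "C \<in> \<C>" "D \<in> \<C>" "C \<noteq> D" for C D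
    using model that unfolding clique_model_def by blast+
  \<comment> \<open>suppressing \<open>x\<close> is contracting the edge \<open>{x, y}\<close>\<close>
  define f where "f C = (if y \<in> C then insert x C else C)" for C
  have fC: "C \<subseteq> f C" "f C \<subseteq> insert x C" for C by (auto simp: f_def)
  have "inj_on f \<C>"
  proof (rule inj_onI)
    fix C D assume "C \<in> \<C>" "D \<in> \<C>" "f C = f D"
    moreover have "f C - {x} = C" if "C \<in> \<C>" for C using ne(2)[OF that] by (auto simp: f_def)
    ultimately show "C = D" by metis
  qed
  have x': "(y, x) \<in> E" "(z, x) \<in> E" using x symD[OF \<open>sym E\<close>] by blast+
  have conn: "connected_set E (f C)" if C: "C \<in> \<C>" for C
  proof -
    have keep: "(p, q) \<in> linked E (f C)" if "p \<in> C" "q \<in> C" for p q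
    proof (rule linked_image[where f = "\<lambda>v. v" and E = ?E and W = C])
      show "(p, q) \<in> linked ?E C" using ne(3)[OF C] that by (auto simp: connected_set_def)
      fix a b assume ab: "a \<in> C" "b \<in> C" "(a, b) \<in> ?E"
      show "(a, b) \<in> linked E (f C)"
      proof (cases "(a, b) \<in> E")
        case True
        then show ?thesis using ab fC(1)[of C] by (intro linked_edge) auto
      next
        case False
        then have yz: "(a = y \<and> b = z) \<or> (a = z \<and> b = y)" using ab by blast
        then have "y \<in> C" using ab by blast
        then have "x \<in> f C" by (simp add: f_def)
        then have "(a, x) \<in> linked E (f C)" "(x, b) \<in> linked E (f C)"
          using yz x x' ab fC(1)[of C] by (auto intro!: linked_edge)
        then show ?thesis by (rule linked_trans)
      qed
    qed
    obtain r where r: "r \<in> C" using ne(1)[OF C] by blast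
    show ?thesis
    proof (rule connected_setI[OF \<open>sym E\<close>, of _ r])
      fix v assume "v \<in> f C"
      then consider "v \<in> C" | "v = x" "y \<in> C" by (auto simp: f_def split: if_splits)
      then show "(r, v) \<in> linked E (f C)"
      proof cases
        case 2
        then have "(y, x) \<in> linked E (f C)" using x' by (intro linked_edge) (auto simp: f_def)
        then show ?thesis using keep[OF r, of y] 2 linked_trans by metis
      qed (use keep r in blast)
    qed
  qed
  have "clique_model E V (f ` \<C>)"
    unfolding clique_model_def
  proof (intro conjI ballI impI)
    fix C' assume "C' \<in> f ` \<C>"
    then obtain C where C: "C \<in> \<C>" "C' = f C" by blast
    show "C' \<noteq> {}" "C' \<subseteq> V" "connected_set E C'"
      using C ne(1,2)[OF C(1)] fC[of C] conn \<open>x \<in> V\<close> by auto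
    fix D' assume "D' \<in> f ` \<C>" "C' \<noteq> D'"
    then obtain D where D: "D \<in> \<C>" "D' = f D" "C \<noteq> D" using C by blast
    have CD: "C \<inter> D = {}" using disj C(1) D by blast
    show "C' \<inter> D' = {}"
      using CD ne(2)[OF C(1)] ne(2)[OF D(1)] C(2) D(2) by (auto simp: f_def split: if_splits)
    obtain p q where pq: "p \<in> C" "q \<in> D" "(p, q) \<in> ?E" using adj[OF C(1) D(1,3)] by blast
    \<comment> \<open>A new edge between two branch sets is replaced by the edge between
      \<open>x\<close>, which belongs to the branch set of \<open>y\<close>, and
      \<open>z\<close>.\<close>
    then consider "(p, q) \<in> E" | "p = y" "q = z" | "p = z" "q = y" by blast
    then show "\<exists>p\<in>C'. \<exists>q\<in>D'. (p, q) \<in> E"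
    proof cases
      case 1
      then show ?thesis using pq fC(1) C D by blast
    next
      case 2
      then have "x \<in> C'" "q \<in> D'" using pq C D by (auto simp: f_def)
      then show ?thesis using 2 x by blast
    next
      case 3
      then have "x \<in> D'" "p \<in> C'" using pq C D by (auto simp: f_def)
      then show ?thesis using 3 x' by blast
    qed
  qed
  moreover have "finite (f ` \<C>)" "card (f ` \<C>) = h" using \<C> \<open>inj_on f \<C>\<close> by (auto simp: card_image)
  ultimately show ?thesis unfolding has_clique_minor_def by blast
qed

text \<open>A vertex separator in the sense of Menger's theorem: \<open>X\<close> may itself contain
  vertices of \<open>S\<close> and \<open>T\<close>.\<close>

definition cut_off :: "('a \<times> 'a) set \<Rightarrow> 'a set \<Rightarrow> 'a set \<Rightarrow> 'a set \<Rightarrow> 'a set \<Rightarrow> bool" where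
  "cut_off E V S T X \<longleftrightarrow> (\<forall>s\<in>S - X. \<forall>t\<in>T - X. (s, t) \<notin> linked E (V - X))"

text \<open>Deletion and suppression of \<open>x\<close> at once: in either case any two distinct
  neighbours of \<open>x\<close> are adjacent in \<open>E'\<close>, so a walk through
  \<open>x\<close> has a bypass. The invariant \<open>Q\<close> is the component of \<open>s\<close>
  without \<open>x\<close>, together with \<open>x\<close> if it is adjacent to that
  component.\<close>

lemma cut_off_suppress:
  assumes "irrefl E" "S \<union> T \<subseteq> V - {x}" "X \<subseteq> V - {x}" "E \<subseteq> E'"
    and N: "\<And>a b. a \<noteq> b \<Longrightarrow> a \<in> V \<Longrightarrow> b \<in> V \<Longrightarrow> (a, x) \<in> E \<Longrightarrow> (x, b) \<in> E \<Longrightarrow> (a, b) \<in> E'"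
    and cut: "cut_off E' (V - {x}) S T X"
  shows "cut_off E V S T X"
  unfolding cut_off_def
proof (intro ballI notI)
  fix s t assume s: "s \<in> S - X" and t: "t \<in> T - X" and st: "(s, t) \<in> linked E (V - X)"
  define A where "A = component_of E' (V - {x} - X) s"
  define Q where "Q = A \<union> {v. v = x \<and> (\<exists>a\<in>A. (a, x) \<in> E)}"
  have sV: "s \<in> V - {x} - X" using s assms(2) by blast
  have AV: "A \<subseteq> V - {x} - X" using component_of_subset[OF sV] by (simp add: A_def)
  have Acl: "b \<in> A" if "a \<in> A" "b \<in> V - {x} - X" "(a, b) \<in> E'" for a b
    using component_of_closed[of a E' "V - {x} - X" s b] that AV unfolding A_def by blast
  have "t \<in> Q"
  proof (rule linked_closed[OF st, THEN conjunct1])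
    show "s \<in> Q" by (simp add: Q_def A_def)
    fix p q assume p: "p \<in> Q" "p \<in> V - X" and q: "q \<in> V - X" and pq: "(p, q) \<in> E"
    show "q \<in> Q"
    proof (cases "p \<in> A")
      case True
      then show ?thesis using Acl[of p q] q pq \<open>E \<subseteq> E'\<close> unfolding Q_def by blast
    next
      case False
      then obtain a where a: "p = x" "a \<in> A" "(a, x) \<in> E" using p(1) unfolding Q_def by blast
      have "q \<noteq> x" using pq a(1) \<open>irrefl E\<close> by (auto simp: irrefl_def)
      moreover have "q \<in> A" if "a \<noteq> q"
        using N[OF that, of] a pq q AV \<open>q \<noteq> x\<close> Acl[OF a(2), of q] by blast
      ultimately show ?thesis using a(2) unfolding Q_def by blast
    qed
  qed
  then have "t \<in> A" using t assms(2) unfolding Q_def by blast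
  then have "(s, t) \<in> linked E' (V - {x} - X)" by (simp add: A_def component_of_def)
  with cut s t show False unfolding cut_off_def by blast
qed

text \<open>Let \<open>N\<close> be the remaining vertices. Counting ordered pairs, the forest on
  \<open>N\<close> and \<open>S\<close> gives e(N,N) + 2 e(N,S) at most 2|N| + 2|S|, and likewise
  for \<open>T\<close>. Half the sum of both bounds e(N,N) + e(N,S) + e(N,T), which is at least
  3|N|, by 2|N| + |S| + |T|. Hence |N| is at most |S| + |T|.\<close>

lemma card_le_of_degree_ge_3:
  assumes "finite V" "sym E" "irrefl E" "S \<subseteq> V" "T \<subseteq> V" "S \<inter> T = {}"
    and free: "cycle_free E (V - S)" "cycle_free E (V - T)"
    and deg: "\<And>x. x \<in> V - (S \<union> T) \<Longrightarrow> 3 \<le> card (E `` {x} \<inter> V)"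
  shows "card V \<le> 2 * card (S \<union> T)"
proof -
  define N where "N = V - (S \<union> T)"
  have fin: "finite N" "finite S" "finite T" using assms by (auto simp: N_def intro: finite_subset)
  define e where "e A B = card (E \<inter> A \<times> B)" for A B
  have e_swap: "e A B = e B A" for A B
  proof -
    have "prod.swap ` (E \<inter> A \<times> B) = E \<inter> B \<times> A"
      using symD[OF \<open>sym E\<close>] by force
    then show ?thesis unfolding e_def by (metis card_image inj_swap)
  qed
  have half: "e N N + 2 * e N B \<le> 2 * (card N + card B)"
    if "finite B" "N \<inter> B = {}" "cycle_free E (N \<union> B)" for B
  proof -
    have "card (E \<inter> N \<times> N) + card (E \<inter> N \<times> B) + card (E \<inter> B \<times> N) =
        card (E \<inter> N \<times> N \<union> E \<inter> N \<times> B \<union> E \<inter> B \<times> N)"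
      using that fin by (subst card_Un_disjoint; auto)+
    also have "\<dots> \<le> card (E \<inter> (N \<union> B) \<times> (N \<union> B))"
      using that fin by (intro card_mono) auto
    also have "\<dots> \<le> 2 * card (N \<union> B)"
      using that fin assms by (intro cycle_free_card_edges) auto
    finally show ?thesis
      using e_swap[of B N] card_Un_disjoint[of N B] that fin by (simp add: e_def)
  qed
  have "e N N + 2 * e N S \<le> 2 * (card N + card S)"
    using fin assms by (intro half) (auto simp: N_def intro: cycle_free_mono)
  moreover have "e N N + 2 * e N T \<le> 2 * (card N + card T)"
    using fin assms by (intro half) (auto simp: N_def intro: cycle_free_mono)
  moreover have "3 * card N \<le> e N N + e N S + e N T"
  proof -
    have "3 * card N = (\<Sum>x\<in>N. 3)" by simp
    also have "\<dots> \<le> (\<Sum>x\<in>N. card (E `` {x} \<inter> V))" using deg by (intro sum_mono) (simp add: N_def)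
    also have "\<dots> = card (SIGMA x:N. E `` {x} \<inter> V)" using fin assms by (subst card_SigmaI) auto
    also have "(SIGMA x:N. E `` {x} \<inter> V) = E \<inter> N \<times> V" by auto
    also have "\<dots> = E \<inter> N \<times> N \<union> E \<inter> N \<times> S \<union> E \<inter> N \<times> T" using assms by (auto simp: N_def)
    also have "card \<dots> \<le> e N N + e N S + e N T"
      unfolding e_def by (meson add_right_mono card_Un_le order_trans)
    finally show ?thesis .
  qed
  moreover have "card V = card N + (card S + card T)"
  proof -
    have "V = N \<union> (S \<union> T)" using assms by (auto simp: N_def)
    then show ?thesis
      using fin assms(6) card_Un_disjoint[of N "S \<union> T"] card_Un_disjoint[of S T] by (auto simp: N_def)
  qed
  moreover have "card (S \<union> T) = card S + card T" using fin assms(6) by (simp add: card_Un_disjoint)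
  moreover have "n + (s + t) \<le> 2 * (s + t)"
    if "a + 2 * b \<le> 2 * (n + s)" "a + 2 * c \<le> 2 * (n + t)" "3 * n \<le> a + b + c" for a b c n s t :: nat
  proof -
    have "2 * (a + b + c) \<le> 2 * (2 * n + s + t)" using add_mono[OF that(1,2)] by (simp add: algebra_simps)
    then have "a + b + c \<le> 2 * n + s + t" by simp
    with that(3) have "3 * n \<le> 2 * n + s + t" by (rule order_trans)
    then show ?thesis by simp
  qed
  ultimately show ?thesis by metis
qed

text \<open>Information flows in two directions: excluded clique minors pass from \<open>G\<close>
  to the exchange graph, where separators are sought, and the separators found there pass back to
  \<open>G\<close>.\<close>

theorem exchange_graph_exists:
  assumes "finite V" "sym E" "irrefl E" "S \<subseteq> V" "T \<subseteq> V" "S \<inter> T = {}"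
    and "cycle_free E (V - S)" "cycle_free E (V - T)"
  shows "\<exists>U E'. S \<union> T \<subseteq> U \<and> U \<subseteq> V \<and> sym E' \<and> card U \<le> 2 * card (S \<union> T) \<and>
    (\<forall>h. has_clique_minor E' U h \<longrightarrow> has_clique_minor E V h) \<and>
    (\<forall>X\<subseteq>U. cut_off E' U S T X \<longrightarrow> cut_off E V S T X)"
  using assms
proof (induction "card V" arbitrary: V E rule: less_induct)
  case less
  show ?case
  proof (cases "\<forall>x\<in>V - (S \<union> T). 3 \<le> card (E `` {x} \<inter> V)")
    case True
    then have "card V \<le> 2 * card (S \<union> T)" using less.prems by (intro card_le_of_degree_ge_3) auto
    then show ?thesis using less.prems by (intro exI[of _ V] exI[of _ E]) blast
  next
    case False
    then obtain x where x: "x \<in> V" "x \<notin> S" "x \<notin> T" "card (E `` {x} \<inter> V) < 3" by fastforce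
    define M where "M = E `` {x} \<inter> V"
    have "finite M" using less.prems(1) by (simp add: M_def)
    \<comment> \<open>The two reductions of \<open>x\<close> differ only in \<open>E'\<close>. With
      at most one neighbour nothing has to be bypassed and \<open>E' = E\<close>; with two,
      \<open>E'\<close> joins them.\<close>
    have smaller: ?thesis
      if "sym E'" "irrefl E'" "cycle_free E' (V - {x} - S)" "cycle_free E' (V - {x} - T)" "E \<subseteq> E'"
        and minor: "\<And>h. has_clique_minor E' (V - {x}) h \<Longrightarrow> has_clique_minor E V h"
        and N: "\<And>a b. a \<noteq> b \<Longrightarrow> a \<in> V \<Longrightarrow> b \<in> V \<Longrightarrow> (a, x) \<in> E \<Longrightarrow> (x, b) \<in> E \<Longrightarrow> (a, b) \<in> E'"
      for E'
    proof -
      have ST: "S \<union> T \<subseteq> V - {x}" using less.prems x by blast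
      have "card (V - {x}) < card V" using x less.prems(1) by (meson card_Diff1_less)
      moreover have "finite (V - {x})" "S \<subseteq> V - {x}" "T \<subseteq> V - {x}" "S \<inter> T = {}"
        using less.prems ST by auto
      ultimately have "\<exists>U E''. S \<union> T \<subseteq> U \<and> U \<subseteq> V - {x} \<and> sym E'' \<and> card U \<le> 2 * card (S \<union> T) \<and>
        (\<forall>h. has_clique_minor E'' U h \<longrightarrow> has_clique_minor E' (V - {x}) h) \<and>
        (\<forall>X\<subseteq>U. cut_off E'' U S T X \<longrightarrow> cut_off E' (V - {x}) S T X)"
        using that(1-4) by (intro less.hyps)
      then obtain U E'' where U: "S \<union> T \<subseteq> U" "U \<subseteq> V - {x}" "sym E''" "card U \<le> 2 * card (S \<union> T)"
        and m: "\<And>h. has_clique_minor E'' U h \<Longrightarrow> has_clique_minor E' (V - {x}) h"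
        and c: "\<And>X. X \<subseteq> U \<Longrightarrow> cut_off E'' U S T X \<Longrightarrow> cut_off E' (V - {x}) S T X"
        by (elim exE conjE) simp
      have "cut_off E V S T X" if "X \<subseteq> U" "cut_off E'' U S T X" for X
      proof (rule cut_off_suppress[OF less.prems(3) ST _ \<open>E \<subseteq> E'\<close>])
        show "X \<subseteq> V - {x}" using that U(2) by blast
        show "cut_off E' (V - {x}) S T X" using c that by blast
      qed (rule N)
      then show ?thesis using U m minor by (intro exI[of _ U] exI[of _ E'']) blast
    qed
    have free: "cycle_free E (V - {x} - S)" "cycle_free E (V - {x} - T)"
      using less.prems by (auto intro: cycle_free_mono)
    show ?thesis
    proof (cases "\<exists>y\<in>M. \<exists>z\<in>M. y \<noteq> z")
      case False
      show ?thesis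
      proof (rule smaller)
        show "(a, b) \<in> E" if "a \<noteq> b" "a \<in> V" "b \<in> V" "(a, x) \<in> E" "(x, b) \<in> E" for a b
          using False that symD[OF less.prems(2)] unfolding M_def by blast
        show "has_clique_minor E V h" if "has_clique_minor E (V - {x}) h" for h
          using has_clique_minor_mono[OF that] by blast
      qed (use less.prems free in auto)
    next
      case True
      then obtain y z where yz: "y \<in> M" "z \<in> M" "y \<noteq> z" by blast
      have "M = {y, z}"
      proof -
        have "card {y, z} = 2" using yz by simp
        then show ?thesis using yz x(4) \<open>finite M\<close> card_seteq[of M "{y, z}"] unfolding M_def by simp
      qed
      show ?thesis
      proof (rule smaller[of "E \<union> {(y, z), (z, y)}"])
        show "sym (E \<union> {(y, z), (z, y)})" using less.prems(2) by (auto simp: sym_def)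
        show "irrefl (E \<union> {(y, z), (z, y)})" using less.prems(3) yz by (auto simp: irrefl_def)
        have *: "cycle_free (E \<union> {(y, z), (z, y)}) (V - {x} - B)"
          if "cycle_free E (V - B)" "x \<notin> B" for B
        proof -
          have "cycle_free (E \<union> {(y, z), (z, y)}) (V - B - {x})"
            using that yz x \<open>M = {y, z}\<close> less.prems
            by (intro cycle_free_suppress) (auto simp: M_def)
          then show ?thesis by (rule cycle_free_mono) blast
        qed
        show "cycle_free (E \<union> {(y, z), (z, y)}) (V - {x} - S)" using * x less.prems by blast
        show "cycle_free (E \<union> {(y, z), (z, y)}) (V - {x} - T)" using * x less.prems by blast
        show "has_clique_minor E V h" if "has_clique_minor (E \<union> {(y, z), (z, y)}) (V - {x}) h" for h
          using has_clique_minor_suppress[OF less.prems(2) x(1) _ _ yz(3) that] yz(1,2)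
          by (simp add: M_def)
        show "(a, b) \<in> E \<union> {(y, z), (z, y)}"
          if "a \<noteq> b" "a \<in> V" "b \<in> V" "(a, x) \<in> E" "(x, b) \<in> E" for a b
        proof -
          have "a \<in> M" "b \<in> M" using that symD[OF less.prems(2)] by (auto simp: M_def)
          then show ?thesis using \<open>M = {y, z}\<close> \<open>a \<noteq> b\<close> by blast
        qed
      qed blast
    qed
  qed
qed

section \<open>Local optima\<close>

text \<open>The separator theorem works with an integer \<open>t\<close> whose square is at least
  \<open>card W\<close>. Rounding the square root up at most doubles it, hence the factor 2.\<close>

lemma separates_exists:
  assumes "finite W" "sym E" "\<not> has_clique_minor E W h"
  shows "\<exists>Z P Q. separates E W (2 * real (h * h)) Z P Q"
proof -
  define n where "n = real (card W)"
  define t where "t = nat \<lceil>sqrt n\<rceil>"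
  have "0 \<le> n" by (simp add: n_def)
  have "sqrt n \<le> real t" unfolding t_def by (rule real_nat_ceiling_ge)
  then have "n \<le> real t * real t" using \<open>0 \<le> n\<close> by (metis mult_mono real_sqrt_ge_zero real_sqrt_mult_self abs_of_nonneg of_nat_0_le_iff)
  then have "card W \<le> t * t" unfolding n_def by (metis of_nat_le_iff of_nat_mult)
  have "real t \<le> 2 * sqrt n"
  proof (cases "card W = 0")
    case True
    then show ?thesis by (simp add: t_def n_def)
  next
    case False
    then have "1 \<le> sqrt n" by (simp add: n_def)
    moreover have "real t \<le> sqrt n + 1" unfolding t_def using \<open>1 \<le> sqrt n\<close> by linarith
    ultimately show ?thesis by linarith
  qed
  obtain Z where Z: "Z \<subseteq> W" "card Z \<le> h * (h * t)"
    and comp: "\<And>v. v \<in> W - Z \<Longrightarrow> 2 * card (component_of E (W - Z) v) \<le> card W"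
    using clique_minor_free_separator[OF assms \<open>card W \<le> t * t\<close>] by blast
  obtain P Q where PQ: "P \<union> Q = W - Z" "P \<inter> Q = {}" "\<forall>x\<in>P. \<forall>y\<in>Q. (x, y) \<notin> E"
    "3 * card P \<le> 2 * card W" "3 * card Q \<le> 2 * card W"
    using balanced_partition[OF assms(1,2) Z(1) comp] by blast
  have "real (card Z) \<le> real (h * (h * t))" using Z(2) by (rule of_nat_mono)
  also have "\<dots> = real (h * h) * real t" by simp
  also have "\<dots> \<le> real (h * h) * (2 * sqrt n)"
    using \<open>real t \<le> 2 * sqrt n\<close> by (intro mult_left_mono) auto
  finally have "real (card Z) \<le> 2 * real (h * h) * sqrt n" by simp
  then show ?thesis using Z(1) PQ unfolding separates_def n_def by blast
qed

text \<open>A core need not be connected. The component of one of its vertices in \<open>S\<close>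
  is again a core, hence also meets \<open>T\<close>, and this provides the connection that
  \<open>X\<close> should have cut.\<close>

lemma cycle_free_of_cut_off:
  assumes "sym E" "cycle_free E (V - S)" "cycle_free E (V - T)" "cut_off E V S T X"
  shows "cycle_free E (V - X)"
  unfolding cycle_free_def
proof (intro allI impI notI)
  fix U assume U: "U \<subseteq> V - X" and core: "core E U"
  have "\<not> U \<subseteq> V - S" using assms(2) core by (auto simp: cycle_free_def)
  then obtain s where s: "s \<in> U" "s \<in> S" using U by blast
  define C where "C = component_of E U s"
  have "C \<subseteq> U" using component_of_subset[OF s(1)] by (simp add: C_def)
  have "core E C"
    unfolding core_def
  proof (intro conjI ballI)
    show "C \<noteq> {}" using component_of_self[of s E U] unfolding C_def by blast
    fix v assume v: "v \<in> C"
    then have "v \<in> U" using \<open>C \<subseteq> U\<close> by blast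
    then obtain a b where ab: "a \<in> U" "b \<in> U" "a \<noteq> b" "(v, a) \<in> E" "(v, b) \<in> E"
      using core unfolding core_def by blast
    then have "a \<in> C" "b \<in> C"
      using v \<open>v \<in> U\<close> component_of_closed[of v E U s] unfolding C_def by blast+
    then show "\<exists>a\<in>C. \<exists>b\<in>C. a \<noteq> b \<and> (v, a) \<in> E \<and> (v, b) \<in> E" using ab by blast
  qed
  then have "\<not> C \<subseteq> V - T" using assms(3) by (auto simp: cycle_free_def)
  then obtain t where t: "t \<in> C" "t \<in> T" using U \<open>C \<subseteq> U\<close> by blast
  have "(s, t) \<in> linked E U" using t(1) by (simp add: C_def component_of_def)
  then have "(s, t) \<in> linked E (V - X)" using U linked_mono by metis
  moreover have "s \<notin> X" "t \<notin> X" using s t U \<open>C \<subseteq> U\<close> by blast+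
  ultimately show False using assms(4) s t unfolding cut_off_def by blast
qed

section \<open>Exchange along the pieces of a division\<close>

definition shared :: "'a set list \<Rightarrow> nat \<Rightarrow> 'a set" where
  "shared Rs j = {v \<in> Rs ! j. \<exists>i<length Rs. i \<noteq> j \<and> v \<in> Rs ! i}"

definition unshared :: "'a set list \<Rightarrow> nat \<Rightarrow> 'a set" where
  "unshared Rs j = Rs ! j - shared Rs j"

lemma unshared_disjoint:
  "i < length Rs \<Longrightarrow> j < length Rs \<Longrightarrow> i \<noteq> j \<Longrightarrow> unshared Rs i \<inter> unshared Rs j = {}"
  by (auto simp: unshared_def shared_def)

text \<open>Let p and d be the total sizes of the unshared and the shared parts, so that the pieces
  have total size p + d. A shared vertex is counted at least twice in d, so the union has at most p
  + d / 2 vertices. Positions rather than sets index the pieces, since two equal pieces share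
  everything.\<close>

lemma sum_card_shared:
  assumes fin: "\<And>R. R \<in> set Rs \<Longrightarrow> finite R"
  shows "(\<Sum>j<length Rs. card (shared Rs j)) + 2 * card (\<Union>(set Rs)) \<le> 2 * sum_list (map card Rs)"
proof -
  let ?m = "length Rs"
  define B where "B = (\<Union>j<?m. shared Rs j)"
  define d where "d = (\<Sum>j<?m. card (shared Rs j))"
  define p where "p = (\<Sum>j<?m. card (unshared Rs j))"
  have finR: "finite (Rs ! j)" if "j < ?m" for j using fin that by simp
  have sh: "shared Rs j \<subseteq> Rs ! j" for j by (auto simp: shared_def)
  have fins: "finite (shared Rs j)" "finite (unshared Rs j)" if "j < ?m" for j
    using finR[OF that] sh[of j] by (auto simp: unshared_def intro: finite_subset)
  have "finite B" using fins by (simp add: B_def)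
  have "sum_list (map card Rs) = (\<Sum>j<?m. card (Rs ! j))"
    by (simp add: sum_list_sum_nth atLeast0LessThan)
  also have "\<dots> = (\<Sum>j<?m. card (unshared Rs j) + card (shared Rs j))"
  proof (rule sum.cong)
    fix j assume "j \<in> {..<?m}"
    then show "card (Rs ! j) = card (unshared Rs j) + card (shared Rs j)"
      using finR[of j] sh[of j] card_mono[OF finR[of j] sh] fins(1)[of j]
      by (simp add: unshared_def card_Diff_subset)
  qed simp
  finally have total: "sum_list (map card Rs) = p + d" by (simp add: p_def d_def sum.distrib)
  have "\<Union>(set Rs) = (\<Union>j<?m. unshared Rs j) \<union> B"
    using sh by (fastforce simp: B_def unshared_def in_set_conv_nth)
  then have "card (\<Union>(set Rs)) \<le> card (\<Union>j<?m. unshared Rs j) + card B"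
    by (simp add: card_Un_le)
  also have "card (\<Union>j<?m. unshared Rs j) \<le> p" unfolding p_def by (rule card_UN_le) simp
  finally have union: "card (\<Union>(set Rs)) \<le> p + card B" by simp
  have "2 * card B = (\<Sum>v\<in>B. 2)" by simp
  also have "\<dots> \<le> (\<Sum>v\<in>B. card {j \<in> {..<?m}. v \<in> shared Rs j})"
  proof (rule sum_mono)
    fix v assume "v \<in> B"
    then obtain j i where "j < ?m" "v \<in> Rs ! j" "i < ?m" "i \<noteq> j" "v \<in> Rs ! i"
      by (auto simp: B_def shared_def)
    then have "{i, j} \<subseteq> {j \<in> {..<?m}. v \<in> shared Rs j}" "card {i, j} = 2"
      by (auto simp: shared_def)
    then show "2 \<le> card {j \<in> {..<?m}. v \<in> shared Rs j}"
      by (metis card_mono finite_Collect_conjI finite_lessThan Collect_mem_eq)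
  qed
  also have "\<dots> = (\<Sum>j<?m. card {v \<in> B. v \<in> shared Rs j})"
    using \<open>finite B\<close> by (intro sum_multicount_gen[symmetric]) auto
  also have "\<dots> = d"
    unfolding d_def by (intro sum.cong arg_cong[of _ _ card]) (auto simp: B_def)
  finally show ?thesis using union total unfolding d_def by linarith
qed

text \<open>Shared vertices are charged three times: once for the part of \<open>S\<close> in them,
  once as inserted vertices of the swap, and once for the part of \<open>T\<close> in them, which
  several pieces may insert. By \<open>sum_card_shared\<close> their number is at most twice the
  excess of the division, hence 6 = 3 * 2.\<close>

lemma exchange_inequality:
  fixes S T :: "'a set"
  assumes fin: "finite U" and S: "S \<subseteq> U" and T: "T \<subseteq> U" and disj: "S \<inter> T = {}"
    and Rs: "\<Union>(set Rs) = U"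
    and swap: "\<And>j. j < length Rs \<Longrightarrow>
      card (S \<inter> unshared Rs j) \<le> card (T \<inter> Rs ! j) + card (shared Rs j)"
  shows "card S + 6 * card U \<le> card T + 6 * sum_list (map card Rs)"
proof -
  let ?m = "length Rs"
  define d where "d = (\<Sum>j<?m. card (shared Rs j))"
  have finR: "finite R" if "R \<in> set Rs" for R using fin Rs that by (metis Union_upper finite_subset)
  have sub: "Rs ! j \<subseteq> U" if "j < ?m" for j using Rs that nth_mem by blast
  have sh: "shared Rs j \<subseteq> Rs ! j" for j by (auto simp: shared_def)
  have finT: "finite T" using T fin by (rule finite_subset)
  have split: "Rs ! j = unshared Rs j \<union> shared Rs j" for j using sh by (auto simp: unshared_def)
  have "S \<subseteq> (\<Union>j<?m. (S \<inter> unshared Rs j) \<union> shared Rs j)"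
  proof
    fix v assume "v \<in> S"
    then obtain R where "R \<in> set Rs" "v \<in> R" using S Rs by blast
    then obtain j where "j < ?m" "v \<in> Rs ! j" by (metis in_set_conv_nth)
    then show "v \<in> (\<Union>j<?m. (S \<inter> unshared Rs j) \<union> shared Rs j)"
      using split[of j] \<open>v \<in> S\<close> by blast
  qed
  moreover have "finite (\<Union>j<?m. (S \<inter> unshared Rs j) \<union> shared Rs j)"
    using sub split fin by (intro finite_UN_I) (auto intro: finite_subset)
  ultimately have "card S \<le> card (\<Union>j<?m. (S \<inter> unshared Rs j) \<union> shared Rs j)"
    by (rule card_mono[rotated])
  also have "\<dots> \<le> (\<Sum>j<?m. card ((S \<inter> unshared Rs j) \<union> shared Rs j))" by (rule card_UN_le) simp
  also have "\<dots> \<le> (\<Sum>j<?m. card (S \<inter> unshared Rs j) + card (shared Rs j))"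
    by (intro sum_mono card_Un_le)
  also have "\<dots> \<le> (\<Sum>j<?m. card (T \<inter> unshared Rs j) + 3 * card (shared Rs j))"
  proof (rule sum_mono)
    fix j assume "j \<in> {..<?m}"
    then have j: "j < ?m" by simp
    have "T \<inter> Rs ! j \<subseteq> (T \<inter> unshared Rs j) \<union> shared Rs j" using split[of j] by blast
    then have "card (T \<inter> Rs ! j) \<le> card ((T \<inter> unshared Rs j) \<union> shared Rs j)"
      using finT finR[of "Rs ! j"] sh[of j] j by (intro card_mono) (auto intro: finite_subset)
    also have "\<dots> \<le> card (T \<inter> unshared Rs j) + card (shared Rs j)" by (rule card_Un_le)
    finally show "card (S \<inter> unshared Rs j) + card (shared Rs j)
        \<le> card (T \<inter> unshared Rs j) + 3 * card (shared Rs j)"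
      using swap[OF j] by linarith
  qed
  also have "\<dots> = (\<Sum>j<?m. card (T \<inter> unshared Rs j)) + 3 * d"
    by (simp add: sum.distrib sum_distrib_left d_def)
  also have "(\<Sum>j<?m. card (T \<inter> unshared Rs j)) = card (\<Union>j<?m. T \<inter> unshared Rs j)"
  proof (rule card_UN_disjoint[symmetric])
    show "\<forall>i\<in>{..<?m}. \<forall>j\<in>{..<?m}. i \<noteq> j \<longrightarrow> (T \<inter> unshared Rs i) \<inter> (T \<inter> unshared Rs j) = {}"
      using unshared_disjoint[of _ Rs] by blast
  qed (use finT in auto)
  also have "\<dots> \<le> card T" using finT by (intro card_mono) auto
  finally have "card S \<le> card T + 3 * d" by simp
  moreover have "d + 2 * card U \<le> 2 * sum_list (map card Rs)"
    using sum_card_shared[of Rs] finR Rs by (simp add: d_def)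
  ultimately show ?thesis by linarith
qed

theorem local_optimum_card:
  fixes \<epsilon> :: real
  assumes "finite V" "sym E" "irrefl E" "\<not> has_clique_minor E V h"
    and S: "S \<subseteq> V" "cycle_free E (V - S)" and T: "T \<subseteq> V" "cycle_free E (V - T)"
    and \<epsilon>: "0 < \<epsilon>" "\<epsilon> \<le> 1" and c: "(2016 * real (h * h) / \<epsilon>)\<^sup>2 \<le> real c"
    and opt: "\<And>S'. S' \<subseteq> V \<Longrightarrow> cycle_free E (V - S') \<Longrightarrow> card (S - S') \<le> c \<Longrightarrow> card (S' - S) \<le> c \<Longrightarrow>
      card S \<le> card S'"
  shows "real (card S) \<le> (1 + \<epsilon>) * real (card T)"
proof -
  have "h \<noteq> 0"
  proof
    assume "h = 0"
    then have "has_clique_minor E V h"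
      unfolding has_clique_minor_def clique_model_def by (intro exI[of _ "{}"]) simp
    with assms show False by blast
  qed
  \<comment> \<open>Common vertices take part in no exchange. Without them the two solutions are
    disjoint, while the forests left by them are the same as before.\<close>
  define S1 where "S1 = S - T"
  define T1 where "T1 = T - S"
  define V' where "V' = V - (S \<inter> T)"
  have fin: "finite S" "finite T" "finite V'" "finite S1" "finite T1"
    using assms by (auto simp: V'_def S1_def T1_def intro: finite_subset)
  have VS: "V' - S1 = V - S" "V' - T1 = V - T" by (auto simp: V'_def S1_def T1_def)
  obtain U E' where U: "S1 \<union> T1 \<subseteq> U" "U \<subseteq> V'" "sym E'" "card U \<le> 2 * card (S1 \<union> T1)"
    and minor: "\<And>h. has_clique_minor E' U h \<Longrightarrow> has_clique_minor E V' h"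
    and cut: "\<And>X. X \<subseteq> U \<Longrightarrow> cut_off E' U S1 T1 X \<Longrightarrow> cut_off E V' S1 T1 X"
  proof -
    have "\<exists>U E'. S1 \<union> T1 \<subseteq> U \<and> U \<subseteq> V' \<and> sym E' \<and> card U \<le> 2 * card (S1 \<union> T1) \<and>
      (\<forall>h. has_clique_minor E' U h \<longrightarrow> has_clique_minor E V' h) \<and>
      (\<forall>X\<subseteq>U. cut_off E' U S1 T1 X \<longrightarrow> cut_off E V' S1 T1 X)"
      using fin assms(2,3) S T unfolding VS[symmetric]
      by (intro exchange_graph_exists) (auto simp: V'_def S1_def T1_def)
    then show ?thesis using that by (elim exE conjE) simp
  qed
  have finU: "finite U" using U(2) fin by (blast intro: finite_subset)
  have no_minor: "\<not> has_clique_minor E' W h" if "W \<subseteq> U" for W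
    using minor[of h] has_clique_minor_mono[of E' W h U] has_clique_minor_mono[of E V' h V] assms(4) that
    by (auto simp: V'_def)
  define \<beta> where "\<beta> = 2 * real (h * h)"
  \<comment> \<open>\<open>28 \<beta> / sqrt r = \<epsilon> / 36\<close>, so at most an \<open>\<epsilon> / 18\<close> fraction of \<open>U\<close> is shared\<close>
  define r where "r = (2016 * real (h * h) / \<epsilon>)\<^sup>2"
  have sqrt_r: "sqrt r = 2016 * real (h * h) / \<epsilon>" using \<epsilon> by (simp add: r_def)
  have "0 < \<beta>" using \<open>h \<noteq> 0\<close> by (simp add: \<beta>_def)
  have "28 * \<beta> \<le> sqrt r"
  proof -
    have "28 * \<beta> * \<epsilon> \<le> 28 * \<beta> * 1" using \<epsilon> \<open>0 < \<beta>\<close> by (intro mult_left_mono) auto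
    also have "\<dots> \<le> 2016 * real (h * h)" by (simp add: \<beta>_def)
    finally show ?thesis unfolding sqrt_r using \<epsilon> by (simp add: field_simps)
  qed
  have "\<exists>Rs. division E' U Rs \<and> (\<forall>R\<in>set Rs. card R \<le> r) \<and>
      real (sum_list (map card Rs)) \<le> card U + 28 * \<beta> * card U / sqrt r"
  proof (rule division_exists[OF finU U(3) \<open>0 < \<beta>\<close> \<open>28 * \<beta> \<le> sqrt r\<close>])
    fix W assume "W \<subseteq> U"
    then show "\<exists>Z P Q. separates E' W \<beta> Z P Q"
      unfolding \<beta>_def using finU U(3) no_minor by (intro separates_exists) (auto intro: finite_subset)
  qed
  then obtain Rs where div: "\<Union>(set Rs) = U"
      "\<And>x y. x \<in> U \<Longrightarrow> y \<in> U \<Longrightarrow> (x, y) \<in> E' \<Longrightarrow> \<exists>R\<in>set Rs. x \<in> R \<and> y \<in> R"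
    and small: "\<And>R. R \<in> set Rs \<Longrightarrow> card R \<le> r"
    and total: "real (sum_list (map card Rs)) \<le> card U + 28 * \<beta> * card U / sqrt r"
    unfolding division_def by blast
  have "card S1 + 6 * card U \<le> card T1 + 6 * sum_list (map card Rs)"
  proof (rule exchange_inequality[OF finU _ _ _ div(1)])
    show "S1 \<subseteq> U" "T1 \<subseteq> U" "S1 \<inter> T1 = {}" using U(1) by (auto simp: S1_def T1_def)
    fix j assume j: "j < length Rs"
    define R where "R = Rs ! j"
    define I where "I = unshared Rs j"
    define D where "D = shared Rs j"
    have RID: "R = I \<union> D" "I \<inter> D = {}" by (auto simp: R_def I_def D_def unshared_def shared_def)
    have "R \<in> set Rs" using j by (simp add: R_def)
    then have RU: "R \<subseteq> U" using div(1) by blast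
    have finRID: "finite R" using RU finU by (rule finite_subset)
    have "real (card R) \<le> real c" using small[OF \<open>R \<in> set Rs\<close>] c unfolding r_def by linarith
    then have Rc: "card R \<le> c" by simp
    \<comment> \<open>Inside the piece, \<open>S1\<close> gives up its unshared vertices; in return
      all of \<open>T1\<close> in the piece and all shared vertices are inserted.\<close>
    define X where "X = (S1 - I) \<union> (T1 \<inter> R) \<union> D"
    have XU: "X \<subseteq> U" using U(1) RU RID by (auto simp: X_def)
    have "cut_off E' U S1 T1 X"
      unfolding cut_off_def
    proof (intro ballI notI)
      fix s t assume s: "s \<in> S1 - X" and t: "t \<in> T1 - X" and st: "(s, t) \<in> linked E' (U - X)"
      have "t \<in> I"
      \<comment> \<open>The walk never leaves \<open>I\<close>: from an unshared vertex of
        \<open>R\<close> every edge stays in \<open>R\<close>, and the shared vertices of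
        \<open>R\<close> are in \<open>X\<close>. But \<open>X\<close> contains all of
        \<open>T1\<close> in \<open>I\<close>.\<close>
      proof (rule linked_closed[OF st, THEN conjunct1])
        show "s \<in> I" using s by (auto simp: X_def)
        fix x y assume x: "x \<in> I" "x \<in> U - X" and y: "y \<in> U - X" and xy: "(x, y) \<in> E'"
        obtain R' where R': "R' \<in> set Rs" "x \<in> R'" "y \<in> R'" using div(2) x y xy by blast
        then obtain i where i: "i < length Rs" "R' = Rs ! i" by (metis in_set_conv_nth)
        have "i = j" using x(1) R' i j unfolding I_def unshared_def shared_def by blast
        then have "y \<in> R" using R' i by (simp add: R_def)
        then show "y \<in> I" using y RID by (auto simp: X_def)
      qed
      then show False using t RID by (auto simp: X_def)
    qed
    then have "cut_off E V' S1 T1 X" using cut XU by blast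
    moreover have "cycle_free E (V' - S1)" "cycle_free E (V' - T1)" using S(2) T(2) by (simp_all add: VS)
    ultimately have free: "cycle_free E (V' - X)" using cycle_free_of_cut_off[OF assms(2)] by metis
    define S' where "S' = X \<union> (S \<inter> T)"
    have "V - S' = V' - X" by (auto simp: S'_def V'_def)
    moreover have "S' \<subseteq> V" using XU U(2) S by (auto simp: S'_def V'_def)
    moreover have "S - S' \<subseteq> R" "S' - S \<subseteq> R"
      using RID by (auto simp: S'_def X_def S1_def T1_def)
    then have "card (S - S') \<le> c" "card (S' - S) \<le> c"
      using Rc card_mono[OF finRID] by (meson order_trans)+
    ultimately have "card S \<le> card S'" using opt free by simp
    also have "\<dots> \<le> card ((S - (S1 \<inter> I)) \<union> ((T1 \<inter> R) \<union> D))"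
    proof (rule card_mono)
      show "S' \<subseteq> (S - (S1 \<inter> I)) \<union> ((T1 \<inter> R) \<union> D)" by (auto simp: S'_def X_def S1_def)
      show "finite ((S - (S1 \<inter> I)) \<union> ((T1 \<inter> R) \<union> D))" using fin finRID RID by simp
    qed
    also have "\<dots> \<le> card (S - (S1 \<inter> I)) + (card (T1 \<inter> R) + card D)"
      by (meson card_Un_le add_left_mono order_trans)
    also have "card (S - (S1 \<inter> I)) = card S - card (S1 \<inter> I)"
      using fin by (intro card_Diff_subset) (auto simp: S1_def)
    finally have "card S \<le> card S - card (S1 \<inter> I) + (card (T1 \<inter> R) + card D)" .
    moreover have "card (S1 \<inter> I) \<le> card S" using fin by (intro card_mono) (auto simp: S1_def)
    ultimately show "card (S1 \<inter> unshared Rs j) \<le> card (T1 \<inter> Rs ! j) + card (shared Rs j)"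
      unfolding I_def R_def D_def by linarith
  qed
  then have "real (card S1) + 6 * real (card U) \<le> real (card T1) + 6 * real (sum_list (map card Rs))"
    by linarith
  moreover have "28 * \<beta> * card U / sqrt r = \<epsilon> / 36 * card U"
    unfolding sqrt_r \<beta>_def using \<epsilon> \<open>h \<noteq> 0\<close> by (simp add: field_simps)
  \<comment> \<open>The loss 6 * \<epsilon> / 36 per vertex of \<open>U\<close> becomes \<epsilon> /
    3 per vertex of \<open>S1\<close> and \<open>T1\<close>, since \<open>U\<close> is at most twice
    as large as both together.\<close>
  ultimately have "real (card S1) \<le> real (card T1) + \<epsilon> / 6 * real (card U)" using total by linarith
  also have "\<dots> \<le> real (card T1) + \<epsilon> / 6 * (2 * (real (card S1) + real (card T1)))"
  proof -
    have "card U \<le> 2 * (card S1 + card T1)"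
      using U(4) card_Un_le[of S1 T1] by (meson mult_le_mono2 order_trans)
    then have "real (card U) \<le> real (2 * (card S1 + card T1))" by (rule of_nat_mono)
    then have "real (card U) \<le> 2 * (real (card S1) + real (card T1))" by simp
    then show ?thesis using \<epsilon> by (intro add_left_mono mult_left_mono) auto
  qed
  finally have "(1 - \<epsilon> / 3) * real (card S1) \<le> (1 + \<epsilon> / 3) * real (card T1)"
    by (simp add: algebra_simps)
  also have "\<dots> \<le> ((1 - \<epsilon> / 3) * (1 + \<epsilon>)) * real (card T1)"
  proof (rule mult_right_mono)
    \<comment> \<open>The two sides of the claim differ by (\<epsilon> - \<epsilon> * \<epsilon>) /
      3, which is nonnegative for \<epsilon> at most 1.\<close>
    have "\<epsilon> * \<epsilon> \<le> 1 * \<epsilon>" using \<epsilon> by (intro mult_right_mono) auto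
    then show "1 + \<epsilon> / 3 \<le> (1 - \<epsilon> / 3) * (1 + \<epsilon>)" by (simp add: field_simps)
  qed simp
  finally have "(1 - \<epsilon> / 3) * real (card S1) \<le> (1 - \<epsilon> / 3) * ((1 + \<epsilon>) * real (card T1))" by (simp only: mult.assoc)
  then have main: "real (card S1) \<le> (1 + \<epsilon>) * real (card T1)" using \<epsilon> by simp
  have "card S = card S1 + card (S \<inter> T)" "card T = card T1 + card (S \<inter> T)"
    using fin card_Diff_subset_Int[of S T] card_Diff_subset_Int[of T S] card_mono[of S "S \<inter> T"] card_mono[of T "S \<inter> T"]
    by (simp_all add: S1_def T1_def Int_commute)
  moreover have "real (card (S \<inter> T)) \<le> (1 + \<epsilon>) * real (card (S \<inter> T))" using \<epsilon> by (simp add: algebra_simps)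
  ultimately show ?thesis using main by (simp add: distrib_left)
qed

section \<open>Correctness and running time of the implementation\<close>

lemma val_mem [simp]: "val (mem x ys) \<longleftrightarrow> x \<in> set ys"
  by (induction ys) auto

lemma val_difference [simp]: "val (difference xs ys) = filter (\<lambda>x. x \<notin> set ys) xs"
  by (induction xs) auto

lemma val_join [simp]: "val (join xs ys) = xs @ ys"
  by (induction xs) auto

lemma val_cons_all [simp]: "val (cons_all x xss) = map ((#) x) xss"
  by (induction xss) auto

lemma small_subseqs_sound:
  "ys \<in> set (val (small_subseqs k xs)) \<Longrightarrow>
     set ys \<subseteq> set xs \<and> length ys \<le> k \<and> (distinct xs \<longrightarrow> distinct ys)"
proof (induction k xs arbitrary: ys rule: small_subseqs.induct)
  case (3 k x xs)
  from "3.prems" consider zs where "zs \<in> set (val (small_subseqs k xs))" "ys = x # zs"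
    | "ys \<in> set (val (small_subseqs (Suc k) xs))" by auto
  then show ?case
  proof cases
    case 1
    then show ?thesis using "3.IH"(1)[of zs] by auto
  next
    case 2
    then show ?thesis using "3.IH"(2) by fastforce
  qed
qed auto

lemma small_subseqs_complete:
  "A \<subseteq> set xs \<Longrightarrow> card A \<le> k \<Longrightarrow> \<exists>ys\<in>set (val (small_subseqs k xs)). set ys = A"
proof (induction k xs arbitrary: A rule: small_subseqs.induct)
  case (1 xs)
  then have "finite A" using finite_subset by blast
  then show ?case using 1 by simp
next
  case (3 k x xs)
  show ?case
  proof (cases "x \<in> A")
    case True
    have "finite A" using "3.prems" finite_subset by blast
    then have "card (A - {x}) \<le> k" using True "3.prems" by simp
    moreover have "A - {x} \<subseteq> set xs" using "3.prems" by auto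
    ultimately obtain ys where "ys \<in> set (val (small_subseqs k xs))" "set ys = A - {x}"
      using "3.IH"(1) by blast
    then show ?thesis using True by (intro bexI[of _ "x # ys"]) auto
  next
    case False
    then have "A \<subseteq> set xs" using "3.prems" by auto
    then obtain ys where "ys \<in> set (val (small_subseqs (Suc k) xs))" "set ys = A"
      using "3.IH"(2) "3.prems"(2) by blast
    then show ?thesis by (intro bexI[of _ ys]) auto
  qed
qed auto

lemma val_degree_in:
  "distinct es \<Longrightarrow> val (degree_in es W v) = card (set es `` {v} \<inter> set W)"
proof (induction es)
  case (Cons e es)
  obtain a b where e: "e = (a, b)" by (cases e)
  have fin: "finite (set es `` {v} \<inter> set W)" by simp
  have "set (e # es) `` {v} \<inter> set W =
      (if a = v \<and> b \<in> set W then insert b (set es `` {v} \<inter> set W) else set es `` {v} \<inter> set W)"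
    by (auto simp: e)
  moreover have "b \<notin> set es `` {v}" if "a = v" using Cons.prems that by (auto simp: e)
  ultimately show ?case using Cons fin by (auto simp: e)
qed simp

lemma degree_le_1_iff:
  "distinct es \<Longrightarrow> val (degree_in es W v) \<le> 1 \<longleftrightarrow>
     (\<forall>a\<in>set W. \<forall>b\<in>set W. (v, a) \<in> set es \<and> (v, b) \<in> set es \<longrightarrow> a = b)"
  by (auto simp: val_degree_in card_le_Suc0_iff_eq)

text \<open>The list \<open>us\<close> being scanned is kept apart from \<open>W\<close>, in which
  the degrees are taken, so that the induction shortens only the former.\<close>

lemma val_delete_leaf:
  "(\<exists>v\<in>set us. val (degree_in es W v) \<le> 1 \<and> val (delete_leaf es W us) = remove1 v us) \<or>
   (\<forall>v\<in>set us. \<not> val (degree_in es W v) \<le> 1) \<and> val (delete_leaf es W us) = us"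
  by (induction us) auto

lemma cycle_free_remove_leaf:
  assumes leaf: "\<And>a b. a \<in> W \<Longrightarrow> b \<in> W \<Longrightarrow> (v, a) \<in> E \<Longrightarrow> (v, b) \<in> E \<Longrightarrow> a = b"
    and free: "cycle_free E (W - {v})"
  shows "cycle_free E W"
  unfolding cycle_free_def
proof (intro allI impI notI)
  fix U assume U: "U \<subseteq> W" "core E U"
  have "v \<notin> U"
  proof
    assume "v \<in> U"
    then obtain a b where "a \<in> U" "b \<in> U" "a \<noteq> b" "(v, a) \<in> E" "(v, b) \<in> E"
      using U(2) unfolding core_def by blast
    then show False using leaf U(1) by blast
  qed
  then show False using U free unfolding cycle_free_def by blast
qed

text \<open>Read backwards from the empty set, every round puts back a vertex of degree at most 1 or
  changes nothing. So a positive answer is sound for any number of rounds.\<close>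

lemma vanishes_imp_cycle_free:
  assumes "distinct es"
  shows "distinct W \<Longrightarrow> val (vanishes es W rs) \<Longrightarrow> cycle_free (set es) (set W)"
proof (induction rs arbitrary: W)
  case Nil
  then show ?case by (simp add: cycle_free_def core_def)
next
  case (Cons r rs)
  define W' where "W' = val (delete_leaf es W W)"
  have v: "val (vanishes es W' rs)" using Cons.prems by (simp add: W'_def)
  from val_delete_leaf[of W es W] show ?case
  proof (elim disjE bexE conjE)
    fix v assume "v \<in> set W" and deg: "val (degree_in es W v) \<le> 1" and W': "val (delete_leaf es W W) = remove1 v W"
    have "distinct W'" using Cons.prems W' by (simp add: W'_def distinct_remove1)
    then have "cycle_free (set es) (set W')" using Cons.IH v by blast
    then have "cycle_free (set es) (set W - {v})" using W' Cons.prems by (simp add: W'_def set_remove1_eq)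
    then show ?thesis
      using deg degree_le_1_iff[OF assms] by (intro cycle_free_remove_leaf[of "set W" v]) blast+
  qed (use Cons.IH v Cons.prems W'_def in auto)
qed

text \<open>A nonempty cycle-free set is no core and thus offers a vertex to delete;
  \<open>length W\<close> such rounds empty it.\<close>

lemma cycle_free_imp_vanishes:
  assumes "distinct es"
  shows "distinct W \<Longrightarrow> length W \<le> length rs \<Longrightarrow> cycle_free (set es) (set W) \<Longrightarrow> val (vanishes es W rs)"
proof (induction rs arbitrary: W)
  case (Cons r rs)
  define W' where "W' = val (delete_leaf es W W)"
  have "distinct W' \<and> length W' \<le> length rs \<and> cycle_free (set es) (set W')"
  proof (cases "W = []")
    case True
    then show ?thesis using Cons.prems by (simp add: W'_def)
  next
    case False
    then have "\<not> core (set es) (set W)" "set W \<noteq> {}" using Cons.prems by (auto simp: cycle_free_def)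
    then have "\<exists>v\<in>set W. val (degree_in es W v) \<le> 1"
      unfolding core_def degree_le_1_iff[OF assms] by blast
    then obtain v where "v \<in> set W" "W' = remove1 v W"
      using val_delete_leaf[of W es W] unfolding W'_def by blast
    then show ?thesis
      using Cons.prems cycle_free_mono[of "set es" "set W" "set W'"]
      by (auto simp: distinct_remove1 length_remove1 set_remove1_subset)
  qed
  then show ?case using Cons.IH by (simp add: W'_def)
qed simp

lemma val_is_fvs:
  assumes "distinct es" "distinct vs"
  shows "val (is_fvs vs es S) \<longleftrightarrow> cycle_free (set es) (set vs - set S)"
proof -
  let ?W = "filter (\<lambda>x. x \<notin> set S) vs"
  have set: "set ?W = set vs - set S" by auto
  have "distinct ?W" using assms by simp
  then have "val (vanishes es ?W ?W) \<longleftrightarrow> cycle_free (set es) (set ?W)"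
    using vanishes_imp_cycle_free[OF assms(1)] cycle_free_imp_vanishes[OF assms(1)] by blast
  then show ?thesis unfolding set by (simp add: is_fvs_def)
qed

section \<open>The search for an improving swap\<close>

lemma try_insertions_Some:
  "val (try_insertions vs es S R Ys) = Some S' \<Longrightarrow>
    \<exists>Y\<in>set Ys. S' = R @ Y \<and> length S' < length S \<and> val (is_fvs vs es S')"
  by (induction Ys) (auto simp: shorter_iff split: if_splits)

lemma try_insertions_None:
  "val (try_insertions vs es S R Ys) = None \<Longrightarrow> Y \<in> set Ys \<Longrightarrow>
    \<not> (length (R @ Y) < length S \<and> val (is_fvs vs es (R @ Y)))"
  by (induction Ys) (auto simp: shorter_iff split: if_splits)

lemma try_removals_Some:
  "val (try_removals vs es S Ys Xs) = Some S' \<Longrightarrow>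
    \<exists>X\<in>set Xs. \<exists>Y\<in>set Ys. S' = filter (\<lambda>x. x \<notin> set X) S @ Y \<and> length S' < length S \<and> val (is_fvs vs es S')"
proof (induction Xs)
  case (Cons X Xs)
  show ?case
  proof (cases "val (try_insertions vs es S (filter (\<lambda>x. x \<notin> set X) S) Ys)")
    case None
    then show ?thesis using Cons by auto
  next
    case (Some S'')
    then show ?thesis using Cons.prems try_insertions_Some[OF Some] by auto
  qed
qed simp

lemma try_removals_None:
  "val (try_removals vs es S Ys Xs) = None \<Longrightarrow> X \<in> set Xs \<Longrightarrow> Y \<in> set Ys \<Longrightarrow>
    \<not> (length (filter (\<lambda>x. x \<notin> set X) S @ Y) < length S \<and>
       val (is_fvs vs es (filter (\<lambda>x. x \<notin> set X) S @ Y)))"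
proof (induction Xs)
  case (Cons X' Xs)
  show ?case
  proof (cases "val (try_insertions vs es S (filter (\<lambda>x. x \<notin> set X') S) Ys)")
    case None
    then show ?thesis using Cons try_insertions_None[OF None Cons.prems(3)] by auto
  next
    case (Some S'')
    then show ?thesis using Cons.prems by simp
  qed
qed simp

context
  fixes vs :: "nat list" and es :: "(nat \<times> nat) list" and G :: "nat pair_pre_digraph"
  assumes G: "pair_graph G" and rep: "represents vs es G"
begin

lemma rep_simps: "distinct vs" "distinct es" "set vs = pverts G" "set es = parcs G"
  using rep by (simp_all add: represents_def)

lemma val_is_fvs_iff:
  "set S \<subseteq> pverts G \<Longrightarrow> val (is_fvs vs es S) \<longleftrightarrow> feedback_vertex_set G (set S)"
  by (simp add: val_is_fvs rep_simps feedback_vertex_set_iff[OF G])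

lemma find_improvement_Some:
  assumes "distinct S" "set S \<subseteq> pverts G" "val (find_improvement c vs es S) = Some S'"
  shows "distinct S'" "improving_swap c G (set S) (set S')"
proof -
  obtain X Y where X: "X \<in> set (val (small_subseqs c S))"
    and Y: "Y \<in> set (val (small_subseqs c (filter (\<lambda>x. x \<notin> set S) vs)))"
    and S': "S' = filter (\<lambda>x. x \<notin> set X) S @ Y" "length S' < length S" "val (is_fvs vs es S')"
  proof -
    have "val (try_removals vs es S (val (small_subseqs c (filter (\<lambda>x. x \<notin> set S) vs)))
        (val (small_subseqs c S))) = Some S'"
      using assms(3) by (simp add: find_improvement_def)
    from try_removals_Some[OF this] show ?thesis using that by blast
  qed
  have X': "length X \<le> c" using small_subseqs_sound[OF X] by blast
  have Y': "length Y \<le> c" "set Y \<subseteq> pverts G - set S" "distinct Y"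
    using small_subseqs_sound[OF Y] rep_simps by auto
  show "distinct S'" using S'(1) assms Y' by auto
  have "set S - set S' \<subseteq> set X" "set S' - set S \<subseteq> set Y" using S'(1) by auto
  then have "card (set S - set S') \<le> card (set X)" "card (set S' - set S) \<le> card (set Y)"
    by (auto intro: card_mono)
  then have "card (set S - set S') \<le> c" "card (set S' - set S) \<le> c"
    using X' Y'(1) card_length[of X] card_length[of Y] by linarith+
  moreover have "card (set S') < card (set S)"
    using S'(2) \<open>distinct S'\<close> \<open>distinct S\<close> by (simp add: distinct_card)
  moreover have "set S' \<subseteq> pverts G" using S'(1) Y' assms(2) by auto
  ultimately show "improving_swap c G (set S) (set S')"
    using S'(3) by (simp add: improving_swap_def val_is_fvs_iff)
qed

text \<open>An improving \<open>A\<close> would be among the candidates: removing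
  \<open>set S - A\<close> and inserting \<open>A - set S\<close> are both enumerated, as both have
  at most \<open>c\<close> elements.\<close>

lemma find_improvement_None:
  assumes "distinct S" "set S \<subseteq> pverts G" "val (find_improvement c vs es S) = None"
  shows "\<not> improving_swap c G (set S) A"
proof
  assume "improving_swap c G (set S) A"
  then have A: "feedback_vertex_set G A" "card (set S - A) \<le> c" "card (A - set S) \<le> c" "card A < card (set S)"
    by (simp_all add: improving_swap_def)
  then have "A \<subseteq> pverts G" by (simp add: feedback_vertex_set_def)
  obtain X where X: "X \<in> set (val (small_subseqs c S))" "set X = set S - A"
    using small_subseqs_complete[of "set S - A" S c] A(2) by blast
  have "A - set S \<subseteq> set (filter (\<lambda>x. x \<notin> set S) vs)" using \<open>A \<subseteq> pverts G\<close> rep_simps by auto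
  then obtain Y where Y: "Y \<in> set (val (small_subseqs c (filter (\<lambda>x. x \<notin> set S) vs)))" "set Y = A - set S"
    using small_subseqs_complete A(3) by blast
  let ?S = "filter (\<lambda>x. x \<notin> set X) S @ Y"
  have set: "set ?S = A" using X(2) Y(2) by auto
  have "distinct Y" using small_subseqs_sound[OF Y(1)] rep_simps by auto
  then have "distinct ?S" using assms(1) Y(2) by auto
  then have "length ?S < length S"
    using set A(4) assms(1) by (metis distinct_card)
  moreover have "val (is_fvs vs es ?S)" using val_is_fvs_iff[of ?S, unfolded set] A(1) \<open>A \<subseteq> pverts G\<close> by blast
  moreover have "val (try_removals vs es S (val (small_subseqs c (filter (\<lambda>x. x \<notin> set S) vs)))
      (val (small_subseqs c S))) = None"
    using assms(3) by (simp add: find_improvement_def)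
  from try_removals_None[OF this X(1) Y(1)]
  have "\<not> (length ?S < length S \<and> val (is_fvs vs es ?S))" .
  ultimately show False by blast
qed

lemma local_search_correct:
  "distinct S \<Longrightarrow> set S \<subseteq> pverts G \<Longrightarrow>
     local_search_output c G (set S) (set (val (local_search c vs es S)))"
proof (induction "length S" arbitrary: S rule: less_induct)
  case less
  show ?case
  proof (cases "val (find_improvement c vs es S)")
    case None
    then have "val (local_search c vs es S) = S" by (simp add: local_search.simps)
    then show ?thesis using find_improvement_None[OF less.prems None] by (simp add: local_search_output_def)
  next
    case (Some S')
    then have val: "val (local_search c vs es S) = val (local_search c vs es S')"
      by (simp add: local_search.simps[of c vs es S])
    have S': "distinct S'" "improving_swap c G (set S) (set S')"
      using find_improvement_Some[OF less.prems Some] by blast+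
    have "set S' \<subseteq> pverts G" using S'(2) by (simp add: improving_swap_def feedback_vertex_set_def)
    then have "local_search_output c G (set S') (set (val (local_search c vs es S')))"
      using less.hyps[OF find_improvement_length[OF Some] S'(1)] by blast
    then show ?thesis using S'(2) unfolding val local_search_output_def
      by (meson converse_rtranclp_into_rtranclp)
  qed
qed

end

section \<open>Step counts of the single functions\<close>

lemma steps_mem: "steps (mem x ys) \<le> length ys + 1"
  by (induction ys) auto

lemma steps_difference: "steps (difference xs ys) \<le> (length xs + 1) * (length ys + 2)"
proof (induction xs)
  case (Cons x xs)
  then show ?case using steps_mem[of x ys] by simp
qed simp

lemma steps_join: "steps (join xs ys) = length xs + 1"
  by (induction xs) auto

lemma steps_shorter: "steps (shorter xs ys) \<le> length ys + 1"
  by (induction xs ys rule: shorter.induct) auto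

lemma steps_cons_all: "steps (cons_all x xss) = length xss + 1"
  by (induction xss) auto

lemma length_small_subseqs: "length (val (small_subseqs k xs)) \<le> (length xs + 1) ^ k"
proof (induction k xs rule: small_subseqs.induct)
  case (3 k x xs)
  let ?n = "length xs + 1"
  have "length (val (small_subseqs (Suc k) (x # xs))) =
      length (val (small_subseqs k xs)) + length (val (small_subseqs (Suc k) xs))" by simp
  also have "\<dots> \<le> ?n ^ k + ?n ^ Suc k"
    using "3.IH"(1) "3.IH"(2)[OF refl refl] by (rule add_mono)
  also have "\<dots> = ?n ^ k * (?n + 1)" by simp
  also have "\<dots> \<le> (?n + 1) ^ k * (?n + 1)" by (intro mult_right_mono power_mono) auto
  finally show ?case by (simp add: mult.commute)
qed auto

text \<open>One power more than for the number of subsequences: at every level of the recursion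
  \<open>cons_all\<close> and \<open>join\<close> run through the lists collected so far.\<close>

lemma steps_small_subseqs: "steps (small_subseqs k xs) \<le> 3 * (length xs + 1) ^ (k + 1)"
proof (induction k xs rule: small_subseqs.induct)
  case (3 k x xs)
  define n where "n = length xs + 1"
  let ?A = "length (val (small_subseqs k xs))"
  have A: "?A \<le> n ^ k" using length_small_subseqs[of k xs] by (simp add: n_def)
  have "1 \<le> n ^ k" "1 \<le> n ^ (k + 1)" by (simp_all add: n_def del: power_Suc)
  have "steps (small_subseqs (Suc k) (x # xs)) \<le>
      3 + 2 * ?A + steps (small_subseqs k xs) + steps (small_subseqs (Suc k) xs)"
    by (simp add: steps_cons_all steps_join)
  also have "\<dots> \<le> 3 + 2 * n ^ k + 3 * n ^ (k + 1) + 3 * n ^ (k + 2)"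
  proof -
    have "steps (small_subseqs k xs) \<le> 3 * n ^ (k + 1)" using "3.IH"(1) by (simp only: n_def)
    moreover have "steps (small_subseqs (Suc k) xs) \<le> 3 * n ^ (k + 2)"
      using "3.IH"(2)[OF refl refl] by (simp add: n_def del: power_Suc)
    ultimately show ?thesis using A by linarith
  qed
  also have "\<dots> \<le> 3 * (n ^ (k + 2) + 2 * n ^ (k + 1) + n ^ k)"
    using \<open>1 \<le> n ^ k\<close> \<open>1 \<le> n ^ (k + 1)\<close> unfolding distrib_left by linarith
  also have "n ^ (k + 2) + 2 * n ^ (k + 1) + n ^ k = n ^ k * (n + 1) * (n + 1)" by (simp add: algebra_simps)
  also have "3 * (n ^ k * (n + 1) * (n + 1)) \<le> 3 * ((n + 1) ^ k * (n + 1) * (n + 1))"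
    by (intro mult_left_mono mult_right_mono power_mono) auto
  finally show ?case by (simp add: n_def algebra_simps)
qed auto

lemma steps_degree_in: "steps (degree_in es W v) \<le> (length es + 1) * (length W + 2)"
proof (induction es)
  case (Cons e es)
  obtain a b where "e = (a, b)" by (cases e)
  then show ?case using Cons steps_mem[of b W] by auto
qed simp

lemma steps_delete_leaf:
  "steps (delete_leaf es W us) \<le> (length us + 1) * ((length es + 1) * (length W + 2) + 1)"
proof (induction us)
  case (Cons v us)
  define K where "K = (length es + 1) * (length W + 2)"
  have "steps (degree_in es W v) \<le> K" unfolding K_def by (rule steps_degree_in)
  then have "steps (delete_leaf es W (v # us)) \<le> 1 + K + steps (delete_leaf es W us)" by simp
  also have "\<dots> \<le> 1 + K + (length us + 1) * (K + 1)" 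
    using Cons.IH unfolding K_def by (rule add_left_mono)
  also have "\<dots> = (length (v # us) + 1) * (K + 1)" by simp
  finally show ?case unfolding K_def .
qed simp

lemma length_delete_leaf: "length (val (delete_leaf es W us)) \<le> length us"
  by (induction us) auto

lemma steps_vanishes:
  "length W \<le> w \<Longrightarrow>
    steps (vanishes es W rs) \<le> (length rs + 1) * ((w + 1) * ((length es + 1) * (w + 2) + 1) + 1)"
proof (induction rs arbitrary: W)
  case (Cons r rs)
  let ?K = "\<lambda>l. (l + 1) * ((length es + 1) * (l + 2) + 1)"
  have "steps (delete_leaf es W W) \<le> ?K (length W)" by (rule steps_delete_leaf)
  also have "\<dots> \<le> ?K w" using Cons.prems by (intro mult_le_mono add_le_mono) auto
  finally have 1: "steps (delete_leaf es W W) \<le> ?K w" .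
  have "length (val (delete_leaf es W W)) \<le> w"
    using length_delete_leaf[of es W W] Cons.prems by linarith
  then have "steps (vanishes es (val (delete_leaf es W W)) rs) \<le> (length rs + 1) * (?K w + 1)"
    by (rule Cons.IH)
  then have "steps (vanishes es W (r # rs)) \<le> 1 + ?K w + (length rs + 1) * (?K w + 1)"
    using 1 by simp
  then show ?case by simp
qed simp

section \<open>Step counts as multiples of powers of a common base \<open>N\<close>\<close>

context
  fixes N :: nat and vs :: "nat list" and es :: "(nat \<times> nat) list"
  assumes vs: "length vs + 2 \<le> N" and es: "length es + 1 \<le> N\<^sup>2"
begin

lemma N_power: "k \<le> l \<Longrightarrow> N ^ k \<le> N ^ l"
  using vs by (intro power_increasing) auto

text \<open>Rounds, scanned vertices and membership tests contribute a factor \<open>N\<close> each,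
  and the arcs contribute \<open>N\<^sup>2\<close>, which makes \<open>N ^ 5\<close>. The bound on
  \<open>S\<close> is doubled because a candidate is the concatenation of two lists, each shorter
  than \<open>N\<close>.\<close>

lemma steps_is_fvs:
  assumes "length S + 2 \<le> 2 * N"
  shows "steps (is_fvs vs es S) \<le> 6 * N ^ 5"
proof -
  have "steps (difference vs S) \<le> (length vs + 1) * (length S + 2)" by (rule steps_difference)
  also have "\<dots> \<le> N * (2 * N)" using vs assms by (intro mult_le_mono) auto
  finally have 1: "steps (difference vs S) \<le> 2 * N ^ 2" by (simp add: power2_eq_square)
  let ?W = "filter (\<lambda>x. x \<notin> set S) vs"
  have W: "length ?W \<le> length vs" by simp
  have "steps (vanishes es ?W ?W) \<le>
      (length ?W + 1) * ((length vs + 1) * ((length es + 1) * (length vs + 2) + 1) + 1)"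
    by (rule steps_vanishes[OF W])
  also have "\<dots> \<le> N * (N * (N\<^sup>2 * N + 1) + 1)"
  proof -
    have "length ?W + 1 \<le> N" using vs W by linarith
    then show ?thesis using vs es by (intro mult_le_mono add_le_mono) auto
  qed
  also have "\<dots> = N ^ 5 + N ^ 2 + N ^ 1" by (simp add: algebra_simps eval_nat_numeral)
  finally have 2: "steps (vanishes es ?W ?W) \<le> N ^ 5 + N ^ 2 + N ^ 1" .
  have "steps (is_fvs vs es S) \<le> N ^ 0 + 2 * N ^ 2 + (N ^ 5 + N ^ 2 + N ^ 1)"
    using 1 2 by (simp add: is_fvs_def)
  then show ?thesis using N_power[of 0 5] N_power[of 1 5] N_power[of 2 5] by simp
qed


lemma steps_try_insertions:
  assumes "length S + 2 \<le> N" "length R + 2 \<le> N" "\<And>Y. Y \<in> set Ys \<Longrightarrow> length Y + 2 \<le> N"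
  shows "steps (try_insertions vs es S R Ys) \<le> (length Ys + 1) * (9 * N ^ 5)"
  using assms(3)
proof (induction Ys)
  case Nil
  then show ?case using N_power[of 0 5] by simp
next
  case (Cons Y Ys)
  have "length Y + 2 \<le> N" using Cons.prems by simp
  then have "steps (is_fvs vs es (R @ Y)) \<le> 6 * N ^ 5" using assms(2) by (intro steps_is_fvs) simp
  moreover have "steps (shorter (R @ Y) S) \<le> N ^ 1"
    using steps_shorter[of "R @ Y" S] assms(1) by simp
  moreover have "steps (join R Y) \<le> N ^ 1" using steps_join[of R Y] assms(2) by simp
  moreover have "N ^ 0 \<le> N ^ 5" "N ^ 1 \<le> N ^ 5" by (rule N_power, simp)+
  ultimately have "1 + steps (join R Y) + steps (shorter (R @ Y) S) + steps (is_fvs vs es (R @ Y)) \<le> 9 * N ^ 5"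
    by simp
  moreover have "steps (try_insertions vs es S R (Y # Ys)) \<le>
      (1 + steps (join R Y) + steps (shorter (R @ Y) S) + steps (is_fvs vs es (R @ Y))) +
      steps (try_insertions vs es S R Ys)" by simp
  moreover have "steps (try_insertions vs es S R Ys) \<le> (length Ys + 1) * (9 * N ^ 5)"
    using Cons by simp
  ultimately show ?case by simp
qed

lemma steps_try_removals:
  assumes "length S + 2 \<le> N" "\<And>Y. Y \<in> set Ys \<Longrightarrow> length Y + 2 \<le> N" "\<And>X. X \<in> set Xs \<Longrightarrow> length X + 2 \<le> N"
  shows "steps (try_removals vs es S Ys Xs) \<le> (length Xs + 1) * ((length Ys + 1) * (11 * N ^ 5))"
  using assms(3)
proof (induction Xs)
  case Nil
  have "1 * (1 * 1) \<le> (length ([] :: nat list list) + 1) * ((length Ys + 1) * (11 * N ^ 5))"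
    using N_power[of 0 5] by (intro mult_le_mono) auto
  then show ?case by simp
next
  case (Cons X Xs)
  let ?R = "filter (\<lambda>x. x \<notin> set X) S"
  let ?L = "length Ys + 1"
  have "length ?R + 2 \<le> N" using assms(1) length_filter_le[of "\<lambda>x. x \<notin> set X" S] by linarith
  then have ins: "steps (try_insertions vs es S ?R Ys) \<le> ?L * (9 * N ^ 5)"
    using assms(1,2) by (intro steps_try_insertions) auto
  have "steps (difference S X) \<le> (length S + 1) * (length X + 2)" by (rule steps_difference)
  also have "\<dots> \<le> N * N" using assms(1) Cons.prems by (intro mult_le_mono) auto
  also have "\<dots> \<le> N ^ 5" using N_power[of 2 5] by (simp add: power2_eq_square)
  finally have "1 + steps (difference S X) \<le> 2 * N ^ 5" using N_power[of 0 5] by simp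
  also have "\<dots> \<le> ?L * (2 * N ^ 5)" by simp
  finally have diff: "1 + steps (difference S X) \<le> ?L * (2 * N ^ 5)" .
  have "steps (try_removals vs es S Ys (X # Xs)) \<le>
      (1 + steps (difference S X)) + steps (try_insertions vs es S ?R Ys) + steps (try_removals vs es S Ys Xs)"
    by (simp split: option.split)
  also have "\<dots> \<le> ?L * (2 * N ^ 5) + ?L * (9 * N ^ 5) + (length Xs + 1) * (?L * (11 * N ^ 5))"
    using ins diff Cons by (intro add_mono) auto
  also have "\<dots> = (length (X # Xs) + 1) * (?L * (11 * N ^ 5))" by (simp add: algebra_simps)
  finally show ?case .
qed

text \<open>All pairs of a removal and an insertion, at most \<open>2 * N ^ c\<close> each, are
  tested at cost \<open>11 * N ^ 5\<close>, which gives 44. The other 8 = 3 + 3 + 1 + 1 pay for the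
  two enumerations, the complement and the call itself.\<close>

lemma steps_find_improvement:
  assumes "distinct vs" "distinct S" "set S \<subseteq> set vs"
  shows "steps (find_improvement c vs es S) \<le> 52 * N ^ (2 * c + 5)"
proof -
  have "length S \<le> length vs" using assms by (metis card_mono distinct_card List.finite_set)
  then have S: "length S + 2 \<le> N" using vs by linarith
  let ?W = "filter (\<lambda>x. x \<notin> set S) vs"
  let ?Xs = "val (small_subseqs c S)"
  let ?Ys = "val (small_subseqs c ?W)"
  have W: "length ?W + 2 \<le> N" using vs length_filter_le[of "\<lambda>x. x \<notin> set S" vs] by linarith
  have len: "length Z + 2 \<le> N" if "Z \<in> set (val (small_subseqs c xs))" "distinct xs" "length xs + 2 \<le> N" for Z and xs :: "nat list"
  proof -
    have "set Z \<subseteq> set xs" "distinct Z" using small_subseqs_sound[OF that(1)] that(2) by auto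
    then have "length Z \<le> length xs" using that(2) by (metis card_mono distinct_card List.finite_set)
    then show ?thesis using that(3) by linarith
  qed
  have card: "length (val (small_subseqs c xs)) + 1 \<le> 2 * N ^ c" "steps (small_subseqs c xs) \<le> 3 * N ^ (c + 1)"
    if "length xs + 2 \<le> N" for xs :: "nat list"
  proof -
    have "(length xs + 1) ^ c \<le> N ^ c" "(length xs + 1) ^ (c + 1) \<le> N ^ (c + 1)"
      using that by (intro power_mono; simp)+
    moreover have "1 \<le> N ^ c" using that by simp
    ultimately show "length (val (small_subseqs c xs)) + 1 \<le> 2 * N ^ c" "steps (small_subseqs c xs) \<le> 3 * N ^ (c + 1)"
      using length_small_subseqs[of c xs] steps_small_subseqs[of c xs] by linarith+
  qed
  have "steps (try_removals vs es S ?Ys ?Xs) \<le> (length ?Xs + 1) * ((length ?Ys + 1) * (11 * N ^ 5))"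
    using S W len assms by (intro steps_try_removals) auto
  also have "\<dots> \<le> (2 * N ^ c) * ((2 * N ^ c) * (11 * N ^ 5))"
    using card(1)[OF S] card(1)[OF W] by (intro mult_le_mono) auto
  also have "\<dots> = 44 * (N ^ c * N ^ c * N ^ 5)" by (simp only: mult.assoc mult.left_commute)
  also have "N ^ c * N ^ c * N ^ 5 = N ^ (2 * c + 5)" by (simp only: power_add mult_2)
  finally have 1: "steps (try_removals vs es S ?Ys ?Xs) \<le> 44 * N ^ (2 * c + 5)" .
  have "steps (difference vs S) \<le> (length vs + 1) * (length S + 2)" by (rule steps_difference)
  also have "\<dots> \<le> N ^ 2" using vs S unfolding power2_eq_square by (intro mult_le_mono) auto
  also have "\<dots> \<le> N ^ (2 * c + 5)" by (rule N_power) simp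
  finally have 2: "steps (difference vs S) \<le> N ^ (2 * c + 5)" .
  have "steps (find_improvement c vs es S) =
      1 + steps (small_subseqs c S) + steps (difference vs S) + steps (small_subseqs c ?W)
        + steps (try_removals vs es S ?Ys ?Xs)"
    by (simp add: find_improvement_def)
  moreover have "N ^ (c + 1) \<le> N ^ (2 * c + 5)" "N ^ 0 \<le> N ^ (2 * c + 5)" by (rule N_power, simp)+
  ultimately show ?thesis using 1 2 card(2)[OF S] card(2)[OF W] by simp
qed

end

text \<open>Each improvement shortens the list, which bounds the number of rounds by
  \<open>length S + 1\<close>; 53 is the cost 52 of a search plus the call.\<close>

lemma steps_local_search:
  assumes "pair_graph G" "represents vs es G"
  shows "distinct S \<Longrightarrow> set S \<subseteq> pverts G \<Longrightarrow>
    steps (local_search c vs es S) \<le> (length S + 1) * (53 * (card (pverts G) + 2) ^ (2 * c + 5))"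
proof (induction "length S" arbitrary: S rule: less_induct)
  case less
  let ?N = "card (pverts G) + 2"
  let ?F = "53 * ?N ^ (2 * c + 5)"
  have rep: "distinct vs" "distinct es" "set vs = pverts G" "set es = parcs G"
    using assms(2) by (simp_all add: represents_def)
  have vs: "length vs + 2 \<le> ?N" using rep by (metis distinct_card order_refl)
  have "length es = card (parcs G)" using rep by (metis distinct_card)
  also have "\<dots> \<le> card (pverts G \<times> pverts G)"
    using pair_graphD[OF assms(1)] by (intro card_mono) auto
  also have "\<dots> = card (pverts G) * card (pverts G)" by (rule card_cartesian_product)
  finally have es: "length es + 1 \<le> ?N\<^sup>2" by (simp add: power2_eq_square)
  have "steps (find_improvement c vs es S) \<le> 52 * ?N ^ (2 * c + 5)"
    using less.prems rep by (intro steps_find_improvement[OF vs es]) auto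
  moreover have "1 \<le> ?N ^ (2 * c + 5)" by simp
  ultimately have find: "1 + steps (find_improvement c vs es S) \<le> ?F" by linarith
  show ?case
  proof (cases "val (find_improvement c vs es S)")
    case None
    then have "steps (local_search c vs es S) = 1 + steps (find_improvement c vs es S)"
      by (simp add: local_search.simps)
    also have "\<dots> \<le> 1 * ?F" using find by simp
    also have "\<dots> \<le> (length S + 1) * ?F" by (intro mult_le_mono1) simp
    finally show ?thesis .
  next
    case (Some S')
    have S': "distinct S'" "set S' \<subseteq> pverts G"
      using find_improvement_Some[OF assms less.prems Some]
      by (simp_all add: improving_swap_def feedback_vertex_set_def)
    have "length S' < length S" by (rule find_improvement_length[OF Some])
    then have "steps (local_search c vs es S') \<le> (length S' + 1) * ?F" using less.hyps S' by blast
    also have "\<dots> \<le> length S * ?F" using \<open>length S' < length S\<close> by (intro mult_le_mono1) simp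
    finally have "steps (local_search c vs es S') \<le> length S * ?F" .
    moreover have "steps (local_search c vs es S) =
        1 + steps (find_improvement c vs es S) + steps (local_search c vs es S')"
      using Some by (simp add: local_search.simps[of c vs es S])
    ultimately have "steps (local_search c vs es S) \<le> ?F + length S * ?F" using find by linarith
    then show ?thesis by simp
  qed
qed

section \<open>The approximation theorem\<close>

lemma local_search_output_fvs:
  assumes "feedback_vertex_set G S\<^sub>0" "local_search_output c G S\<^sub>0 S"
  shows "feedback_vertex_set G S"
proof -
  have "(improving_swap c G)\<^sup>*\<^sup>* S\<^sub>0 S" using assms(2) by (simp add: local_search_output_def)
  then show ?thesis
    by (induction rule: rtranclp_induct) (use assms(1) in \<open>auto simp: improving_swap_def\<close>)
qed

lemma no_infinite_improvement:
  "\<not> (\<exists>\<sigma>. \<sigma> 0 = S\<^sub>0 \<and> (\<forall>i. improving_swap c G (\<sigma> i) (\<sigma> (Suc i))))"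
proof
  assume "\<exists>\<sigma>. \<sigma> 0 = S\<^sub>0 \<and> (\<forall>i. improving_swap c G (\<sigma> i) (\<sigma> (Suc i)))"
  then obtain \<sigma> where "\<forall>i. improving_swap c G (\<sigma> i) (\<sigma> (Suc i))" by (elim exE conjE)
  then have less: "card (\<sigma> (Suc i)) < card (\<sigma> i)" for i by (simp add: improving_swap_def)
  have "card (\<sigma> i) + i \<le> card (\<sigma> 0)" for i
  proof (induction i)
    case (Suc i)
    then show ?case using less[of i] by linarith
  qed simp
  from this[of "Suc (card (\<sigma> 0))"] show False by simp
qed

lemma fvs_opt_attained:
  assumes "feedback_vertex_set G S\<^sub>0"
  obtains T where "feedback_vertex_set G T" "card T = fvs_opt G"
proof -
  have "\<exists>k S. feedback_vertex_set G S \<and> card S = k" using assms by blast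
  then have "\<exists>S. feedback_vertex_set G S \<and> card S = fvs_opt G"
    unfolding fvs_opt_def by (rule LeastI_ex)
  then show ?thesis using that by (elim exE conjE)
qed

lemma local_search_approximation:
  fixes H :: "'b pair_pre_digraph" and G :: "'a pair_pre_digraph" and \<epsilon> :: real
  assumes "pair_graph H" "pair_graph G" "\<not> is_minor H G" "0 < \<epsilon>"
    and c: "(2016 * real (card (pverts H) * card (pverts H)) / min 1 \<epsilon>)\<^sup>2 \<le> real c"
    and S\<^sub>0: "feedback_vertex_set G S\<^sub>0" and out: "local_search_output c G S\<^sub>0 S"
  shows "real (card S) \<le> (1 + \<epsilon>) * real (fvs_opt G)"
proof -
  note G = pair_graphD[OF assms(2)]
  have no: "\<not> has_clique_minor (parcs G) (pverts G) (card (pverts H))"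
    using clique_model_imp_is_minor[OF assms(1,2)] assms(3) by (rule contrapos_nn[rotated])
  have S: "S \<subseteq> pverts G" "cycle_free (parcs G) (pverts G - S)"
    using local_search_output_fvs[OF S\<^sub>0 out] by (simp_all add: feedback_vertex_set_iff[OF assms(2)])
  obtain T where "feedback_vertex_set G T" "card T = fvs_opt G" using fvs_opt_attained[OF S\<^sub>0] .
  then have T: "T \<subseteq> pverts G" "cycle_free (parcs G) (pverts G - T)"
    by (simp_all add: feedback_vertex_set_iff[OF assms(2)])
  have "real (card S) \<le> (1 + min 1 \<epsilon>) * real (card T)"
  proof (rule local_optimum_card[OF G(1,3,4) no S T _ _ c])
    fix S' assume "S' \<subseteq> pverts G" "cycle_free (parcs G) (pverts G - S')"
      "card (S - S') \<le> c" "card (S' - S) \<le> c"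
    moreover have "\<not> improving_swap c G S S'" using out by (simp add: local_search_output_def)
    ultimately show "card S \<le> card S'"
      by (simp add: improving_swap_def feedback_vertex_set_iff[OF assms(2)])
  qed (use \<open>0 < \<epsilon>\<close> in auto)
  also have "\<dots> \<le> (1 + \<epsilon>) * real (fvs_opt G)"
    unfolding \<open>card T = fvs_opt G\<close> by (intro mult_right_mono) auto
  finally show ?thesis .
qed

lemma shifted_power_bigo:
  assumes "real k \<le> a"
  shows "(\<lambda>n. C * real ((n + 2) ^ k)) \<in> O(\<lambda>n. real n powr a)"
proof (rule bigoI[of _ "\<bar>C\<bar> * 3 ^ k"], rule eventually_mono[OF eventually_ge_at_top[of 1]])
  fix n :: nat assume n: "1 \<le> n"
  have "real ((n + 2) ^ k) = real (n + 2) ^ k" by simp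
  also have "\<dots> \<le> (3 * real n) ^ k" using n by (intro power_mono) auto
  also have "\<dots> = 3 ^ k * real n powr real k" using n by (simp add: power_mult_distrib powr_realpow)
  also have "\<dots> \<le> 3 ^ k * real n powr a" using n assms by (intro mult_left_mono powr_mono) auto
  finally have "\<bar>C\<bar> * real ((n + 2) ^ k) \<le> \<bar>C\<bar> * (3 ^ k * real n powr a)" by (intro mult_left_mono) auto
  then show "norm (C * real ((n + 2) ^ k)) \<le> \<bar>C\<bar> * 3 ^ k * norm (real n powr a)"
    by (simp add: abs_mult)
qed

text \<open>The polynomials come before \<open>H\<close> and \<epsilon>. Without
  \<open>min 1 \<epsilon>\<close> the exponent \<open>c'\<close> would tend to 0 for growing
  \<epsilon>; with it, large \<epsilon> are treated like 1.\<close>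

theorem theorem1:
  shows "\<exists>p q :: real poly. \<forall>(H :: nat pair_pre_digraph) (\<epsilon> :: real).
    pair_graph H \<longrightarrow> \<epsilon> > 0 \<longrightarrow>
    (\<exists>(c :: nat) (c' :: real) (T :: nat \<Rightarrow> real).
       c = nat \<lceil>poly p (real (card (pverts H))) / (min 1 \<epsilon>)\<^sup>2\<rceil> \<and>
       c' = poly q (real (card (pverts H))) / (min 1 \<epsilon>)\<^sup>2 \<and>
       T \<in> O(\<lambda>n. real n powr c') \<and>
       (\<forall>G :: nat pair_pre_digraph. pair_graph G \<longrightarrow> \<not> is_minor H G \<longrightarrow>
          (\<forall>S\<^sub>0. feedback_vertex_set G S\<^sub>0 \<longrightarrow>
             \<not> (\<exists>\<sigma>. \<sigma> 0 = S\<^sub>0 \<and> (\<forall>i. improving_swap c G (\<sigma> i) (\<sigma> (Suc i)))) \<and>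
             (\<forall>S. local_search_output c G S\<^sub>0 S \<longrightarrow>
                feedback_vertex_set G S \<and> real (card S) \<le> (1 + \<epsilon>) * real (fvs_opt G))) \<and>
          (\<forall>vs es S\<^sub>0. represents vs es G \<longrightarrow> distinct S\<^sub>0 \<longrightarrow> feedback_vertex_set G (set S\<^sub>0) \<longrightarrow>
             local_search_output c G (set S\<^sub>0) (set (val (local_search c vs es S\<^sub>0))) \<and>
             real (steps (local_search c vs es S\<^sub>0)) \<le> T (card (pverts G)))))"
proof (rule exI[of _ "monom (2016\<^sup>2) 4"], rule exI[of _ "monom (2 * 2016\<^sup>2) 4 + [:8:]"], intro allI impI)
  fix H :: "nat pair_pre_digraph" and \<epsilon> :: real
  assume H: "pair_graph H" and \<epsilon>: "\<epsilon> > 0"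
  define h where "h = card (pverts H)"
  define \<delta> where "\<delta> = min 1 \<epsilon>"
  have \<delta>: "0 < \<delta>" "\<delta> \<le> 1" using \<epsilon> by (auto simp: \<delta>_def)
  \<comment> \<open>\<open>?p\<close> is the square of 2016 h^2. For \<open>?q\<close>, rounding up
    makes \<open>c\<close> at most \<open>x + 1\<close>, so 2 c + 6 is at most 2 x + 8, and 8 is at
    most 8 / \<delta>^2.\<close>
  let ?p = "monom (2016\<^sup>2) 4 :: real poly"
  let ?q = "monom (2 * 2016\<^sup>2) 4 + [:8:] :: real poly"
  define x where "x = poly ?p (real h) / \<delta>\<^sup>2"
  define c where "c = nat \<lceil>x\<rceil>"
  define c' where "c' = poly ?q (real h) / \<delta>\<^sup>2"
  \<comment> \<open>One power beyond \<open>2 * c + 5\<close> accounts for the number of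
    rounds.\<close>
  define T where "T n = 53 * real ((n + 2) ^ (2 * c + 6))" for n
  have "0 \<le> x" using \<delta> by (simp add: x_def poly_monom)
  have "x \<le> real c" unfolding c_def by (rule real_nat_ceiling_ge)
  moreover have "(2016 * real (h * h) / \<delta>)\<^sup>2 = x"
    by (simp add: x_def poly_monom power_divide power_mult_distrib eval_nat_numeral)
  ultimately have c: "(2016 * real (h * h) / \<delta>)\<^sup>2 \<le> real c" by simp
  have "real (2 * c + 6) \<le> c'"
  proof -
    have "real c \<le> x + 1" unfolding c_def using \<open>0 \<le> x\<close> by linarith
    then have "real (2 * c + 6) \<le> 2 * x + 8" by simp
    also have "8 \<le> 8 / \<delta>\<^sup>2" using \<delta> by (simp add: le_divide_eq power_le_one)
    also have "2 * x + 8 / \<delta>\<^sup>2 = c'" by (simp add: x_def c'_def poly_monom add_divide_distrib)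
    finally show ?thesis by simp
  qed
  then have bigo: "T \<in> O(\<lambda>n. real n powr c')" unfolding T_def by (rule shifted_power_bigo)
  have approx: "feedback_vertex_set G S \<and> real (card S) \<le> (1 + \<epsilon>) * real (fvs_opt G)"
    if "pair_graph G" "\<not> is_minor H G" "feedback_vertex_set G S\<^sub>0" "local_search_output c G S\<^sub>0 S"
    for G :: "nat pair_pre_digraph" and S\<^sub>0 S
    using local_search_approximation[OF H that(1,2) \<epsilon> c[unfolded h_def \<delta>_def] that(3,4)]
      local_search_output_fvs[OF that(3,4)] by blast
  have algorithm: "local_search_output c G (set S\<^sub>0) (set (val (local_search c vs es S\<^sub>0))) \<and>
      real (steps (local_search c vs es S\<^sub>0)) \<le> T (card (pverts G))"
    if G: "pair_graph G" and rep: "represents vs es G" and S\<^sub>0: "distinct S\<^sub>0" "feedback_vertex_set G (set S\<^sub>0)"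
    for G :: "nat pair_pre_digraph" and vs es S\<^sub>0
  proof
    let ?n = "card (pverts G)"
    have sub: "set S\<^sub>0 \<subseteq> pverts G" using S\<^sub>0(2) by (simp add: feedback_vertex_set_def)
    show "local_search_output c G (set S\<^sub>0) (set (val (local_search c vs es S\<^sub>0)))"
      by (rule local_search_correct[OF G rep S\<^sub>0(1) sub])
    have "length S\<^sub>0 \<le> ?n"
      using S\<^sub>0(1) sub pair_graphD(1)[OF G] by (metis card_mono distinct_card)
    have "steps (local_search c vs es S\<^sub>0) \<le> (length S\<^sub>0 + 1) * (53 * (?n + 2) ^ (2 * c + 5))"
      by (rule steps_local_search[OF G rep S\<^sub>0(1) sub])
    also have "\<dots> \<le> (?n + 2) * (53 * (?n + 2) ^ (2 * c + 5))"
      using \<open>length S\<^sub>0 \<le> ?n\<close> by (intro mult_le_mono1) simp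
    also have "\<dots> = 53 * (?n + 2) ^ Suc (2 * c + 5)" by (simp only: power_Suc mult.left_commute)
    also have "Suc (2 * c + 5) = 2 * c + 6" by simp
    finally have "real (steps (local_search c vs es S\<^sub>0)) \<le> real (53 * (?n + 2) ^ (2 * c + 6))"
      by (rule of_nat_mono)
    then show "real (steps (local_search c vs es S\<^sub>0)) \<le> T ?n" by (simp add: T_def)
  qed
  show "\<exists>(c :: nat) (c' :: real) (T :: nat \<Rightarrow> real).
       c = nat \<lceil>poly ?p (real (card (pverts H))) / (min 1 \<epsilon>)\<^sup>2\<rceil> \<and>
       c' = poly ?q (real (card (pverts H))) / (min 1 \<epsilon>)\<^sup>2 \<and>
       T \<in> O(\<lambda>n. real n powr c') \<and>
       (\<forall>G :: nat pair_pre_digraph. pair_graph G \<longrightarrow> \<not> is_minor H G \<longrightarrow>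
          (\<forall>S\<^sub>0. feedback_vertex_set G S\<^sub>0 \<longrightarrow>
             \<not> (\<exists>\<sigma>. \<sigma> 0 = S\<^sub>0 \<and> (\<forall>i. improving_swap c G (\<sigma> i) (\<sigma> (Suc i)))) \<and>
             (\<forall>S. local_search_output c G S\<^sub>0 S \<longrightarrow>
                feedback_vertex_set G S \<and> real (card S) \<le> (1 + \<epsilon>) * real (fvs_opt G))) \<and>
          (\<forall>vs es S\<^sub>0. represents vs es G \<longrightarrow> distinct S\<^sub>0 \<longrightarrow> feedback_vertex_set G (set S\<^sub>0) \<longrightarrow>
             local_search_output c G (set S\<^sub>0) (set (val (local_search c vs es S\<^sub>0))) \<and>
             real (steps (local_search c vs es S\<^sub>0)) \<le> T (card (pverts G))))"
  proof (rule exI[of _ c], rule exI[of _ c'], rule exI[of _ T], intro conjI allI impI)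
    show "c = nat \<lceil>poly ?p (real (card (pverts H))) / (min 1 \<epsilon>)\<^sup>2\<rceil>"
      "c' = poly ?q (real (card (pverts H))) / (min 1 \<epsilon>)\<^sup>2"
      by (simp_all only: c_def c'_def x_def h_def \<delta>_def)
    show "T \<in> O(\<lambda>n. real n powr c')" by (rule bigo)
    show "\<not> (\<exists>\<sigma>. \<sigma> 0 = S\<^sub>0 \<and> (\<forall>i. improving_swap c G (\<sigma> i) (\<sigma> (Suc i))))"
      for G :: "nat pair_pre_digraph" and S\<^sub>0
      by (rule no_infinite_improvement)
    fix G :: "nat pair_pre_digraph" assume G: "pair_graph G" "\<not> is_minor H G"
    show "feedback_vertex_set G S" "real (card S) \<le> (1 + \<epsilon>) * real (fvs_opt G)"
      if "feedback_vertex_set G S\<^sub>0" "local_search_output c G S\<^sub>0 S" for S\<^sub>0 S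
      using approx[OF G that] by simp_all
    show "local_search_output c G (set S\<^sub>0) (set (val (local_search c vs es S\<^sub>0)))"
      "real (steps (local_search c vs es S\<^sub>0)) \<le> T (card (pverts G))"
      if "represents vs es G" "distinct S\<^sub>0" "feedback_vertex_set G (set S\<^sub>0)" for vs es S\<^sub>0
      using algorithm[OF G(1) that] by simp_all
  qed
qed

end
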